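(* Let $f_1 : X_1 \to Y$ and $f_2 : X_2 \to Y$ be morphisms of locally ringed spaces, and let $$\eta : X_1 \times_Y^{\mathbf{LRS}} X_2 \to X_1 \times_Y^{\mathbf{RS}} X_2$$ be the natural comparison morphism. Suppose $(f_1)_{x_1} : \mathcal{O}_{Y,f_1(x_1)} \to \mathcal{O}_{X_1,x_1}$ is surjective for every $x_1 \in X_1$. Then $\eta$ is an isomorphism. In particular, $\eta$ is an isomorphism under either of the following hypotheses: 1. $f_1$ is an immersion. 2. $f_1 : \mathrm{Spec}\, k(y) \to Y$ is the natural map associated to a point $y \in Y$.
   Context: $\mathbf{RS}$ is the category of ringed spaces and $\mathbf{LRS}$ that of locally ringed spaces (with morphisms those having local stalk maps). Both have fibered products, denoted $\times^{\mathbf{RS}}$ and $\times^{\mathbf{LRS}}$; $X_1 \times_Y^{\mathbf{RS}} X_2$ is the fibered product of topological spaces with structure sheaf $\pi_1^{-1}\mathcal{O}_{X_1} \otimes_{g^{-1}\mathcal{O}_Y} \pi_2^{-1}\mathcal{O}_{X_2}$, where $\pi_i$ are the projections and $g = f_1\pi_1 = f_2\pi_2$. The comparison morphism $\eta$ is the $\mathbf{RS}$ morphism induced by the two projections of $X_1 \times_Y^{\mathbf{LRS}} X_2$ and the universal property of $X_1 \times_Y^{\mathbf{RS}} X_2$; "isomorphism" means isomorphism of ringed spaces. $k(y)$ is the residue field of $\mathcal{O}_{Y,y}$. An immersion is, as usual, a morphism that is a homeomorphism onto a locally closed subspace with surjective stalk maps on structure sheaves. *)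

theory Defs
  imports "HOL-Analysis.Product_Topology" "HOL-Algebra.QuotRing" "HOL-Library.Poly_Mapping"
begin

section \<open>Presheaves of commutative rings\<close>

record ('a, 'r) presheaf =
  sections :: "'a set \<Rightarrow> 'r ring"
  res :: "'a set \<Rightarrow> 'a set \<Rightarrow> 'r \<Rightarrow> 'r"

text \<open>\<open>res F U V\<close> is the restriction from \<open>U\<close> to \<open>V \<subseteq> U\<close>.  The values of \<open>sections F\<close> and
  \<open>res F\<close> at sets that are not open are irrelevant throughout.\<close>

definition is_presheaf :: "'a topology \<Rightarrow> ('a, 'r) presheaf \<Rightarrow> bool" where
  "is_presheaf T F \<longleftrightarrow>
    (\<forall>U. openin T U \<longrightarrow> cring (sections F U)) \<and>
    (\<forall>U V. openin T U \<and> openin T V \<and> V \<subseteq> U \<longrightarrow>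
       res F U V \<in> ring_hom (sections F U) (sections F V)) \<and>
    (\<forall>U. openin T U \<longrightarrow> (\<forall>s \<in> carrier (sections F U). res F U U s = s)) \<and>
    (\<forall>U V W. openin T U \<and> openin T V \<and> openin T W \<and> W \<subseteq> V \<and> V \<subseteq> U \<longrightarrow>
       (\<forall>s \<in> carrier (sections F U). res F V W (res F U V s) = res F U W s))"

definition is_sheaf :: "'a topology \<Rightarrow> ('a, 'r) presheaf \<Rightarrow> bool" where
  "is_sheaf T F \<longleftrightarrow> is_presheaf T F \<and>
    (\<forall>\<C>. (\<forall>V \<in> \<C>. openin T V) \<longrightarrow>
      (\<forall>s \<in> carrier (sections F (\<Union>\<C>)). \<forall>t \<in> carrier (sections F (\<Union>\<C>)).
         (\<forall>V \<in> \<C>. res F (\<Union>\<C>) V s = res F (\<Union>\<C>) V t) \<longrightarrow> s = t) \<and>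
      (\<forall>s. (\<forall>V \<in> \<C>. s V \<in> carrier (sections F V)) \<and>
           (\<forall>V \<in> \<C>. \<forall>W \<in> \<C>. res F V (V \<inter> W) (s V) = res F W (V \<inter> W) (s W)) \<longrightarrow>
         (\<exists>t \<in> carrier (sections F (\<Union>\<C>)). \<forall>V \<in> \<C>. res F (\<Union>\<C>) V t = s V)))"


section \<open>Germs and stalks\<close>

text \<open>The colimit of \<open>F\<close> over the open neighbourhoods of an arbitrary set \<open>A\<close>.  For a singleton
  this is the stalk; for \<open>A = f ` U\<close> it gives the inverse image presheaf.  An element is an
  equivalence class of pairs of an open neighbourhood and a section over it.\<close>

type_synonym ('a, 'r) germ = "('a set \<times> 'r) set"

definition germ_of ::
  "'a topology \<Rightarrow> ('a, 'r) presheaf \<Rightarrow> 'a set \<Rightarrow> 'a set \<Rightarrow> 'r \<Rightarrow> ('a, 'r) germ" where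
  "germ_of T F A U s =
    {(V, t). openin T V \<and> A \<subseteq> V \<and> t \<in> carrier (sections F V) \<and>
       (\<exists>W. openin T W \<and> A \<subseteq> W \<and> W \<subseteq> U \<inter> V \<and> res F U W s = res F V W t)}"

text \<open>In the ring operations the germs on the right do not depend on the chosen representatives,
  so that the union is the union of copies of a single class.\<close>

definition germ_ring :: "'a topology \<Rightarrow> ('a, 'r) presheaf \<Rightarrow> 'a set \<Rightarrow> ('a, 'r) germ ring" where
  "germ_ring T F A =
    \<lparr>carrier = {germ_of T F A U s | U s. openin T U \<and> A \<subseteq> U \<and> s \<in> carrier (sections F U)},
     mult = (\<lambda>x y. \<Union>(U, s) \<in> x. \<Union>(V, t) \<in> y.
       germ_of T F A (U \<inter> V)
         (res F U (U \<inter> V) s \<otimes>\<^bsub>sections F (U \<inter> V)\<^esub> res F V (U \<inter> V) t)),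
     one = germ_of T F A (topspace T) \<one>\<^bsub>sections F (topspace T)\<^esub>,
     zero = germ_of T F A (topspace T) \<zero>\<^bsub>sections F (topspace T)\<^esub>,
     add = (\<lambda>x y. \<Union>(U, s) \<in> x. \<Union>(V, t) \<in> y.
       germ_of T F A (U \<inter> V)
         (res F U (U \<inter> V) s \<oplus>\<^bsub>sections F (U \<inter> V)\<^esub> res F V (U \<inter> V) t))\<rparr>"


section \<open>Sheafification, inverse image, tensor product\<close>

definition pointwise_ring :: "'a set \<Rightarrow> ('a \<Rightarrow> 'r ring) \<Rightarrow> ('a \<Rightarrow> 'r) set \<Rightarrow> ('a \<Rightarrow> 'r) ring" where
  "pointwise_ring U R C =
    \<lparr>carrier = C,
     mult = (\<lambda>s t. \<lambda>x\<in>U. s x \<otimes>\<^bsub>R x\<^esub> t x),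
     one = (\<lambda>x\<in>U. \<one>\<^bsub>R x\<^esub>),
     zero = (\<lambda>x\<in>U. \<zero>\<^bsub>R x\<^esub>),
     add = (\<lambda>s t. \<lambda>x\<in>U. s x \<oplus>\<^bsub>R x\<^esub> t x)\<rparr>"

definition sheafify :: "'a topology \<Rightarrow> ('a, 'r) presheaf \<Rightarrow> ('a, 'a \<Rightarrow> ('a, 'r) germ) presheaf" where
  "sheafify T F =
    \<lparr>sections = (\<lambda>U. pointwise_ring U (\<lambda>x. germ_ring T F {x})
       {s \<in> (\<Pi>\<^sub>E x\<in>U. carrier (germ_ring T F {x})).
          \<forall>x\<in>U. \<exists>V. openin T V \<and> x \<in> V \<and> V \<subseteq> U \<and>
            (\<exists>t \<in> carrier (sections F V). \<forall>y\<in>V. s y = germ_of T F {y} V t)}),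
     res = (\<lambda>U V s. restrict s V)\<rparr>"

definition sheafify_unit ::
  "'a topology \<Rightarrow> ('a, 'r) presheaf \<Rightarrow> 'a set \<Rightarrow> 'r \<Rightarrow> 'a \<Rightarrow> ('a, 'r) germ" where
  "sheafify_unit T F U s = (\<lambda>x\<in>U. germ_of T F {x} U s)"

text \<open>The morphism of sheafifications induced by a morphism \<open>\<phi>\<close> of presheaves into \<open>G\<close>.\<close>

definition sheafify_map ::
  "'a topology \<Rightarrow> ('a, 's) presheaf \<Rightarrow> ('a set \<Rightarrow> 'r \<Rightarrow> 's) \<Rightarrow>
   'a set \<Rightarrow> ('a \<Rightarrow> ('a, 'r) germ) \<Rightarrow> ('a \<Rightarrow> ('a, 's) germ)" where
  "sheafify_map T G \<phi> U s = (\<lambda>x\<in>U. \<Union>(V, t) \<in> s x. germ_of T G {x} V (\<phi> V t))"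

definition inverse_image_presheaf ::
  "('b \<Rightarrow> 'a) \<Rightarrow> 'a topology \<Rightarrow> ('a, 'r) presheaf \<Rightarrow> ('b, ('a, 'r) germ) presheaf" where
  "inverse_image_presheaf f T F =
    \<lparr>sections = (\<lambda>U. germ_ring T F (f ` U)),
     res = (\<lambda>U V c. \<Union>(W, s) \<in> c. germ_of T F (f ` V) W s)\<rparr>"

definition inverse_image ::
  "'b topology \<Rightarrow> ('b \<Rightarrow> 'a) \<Rightarrow> 'a topology \<Rightarrow> ('a, 'r) presheaf \<Rightarrow>
   ('b, 'b \<Rightarrow> ('b, ('a, 'r) germ) germ) presheaf" where
  "inverse_image Z f T F = sheafify Z (inverse_image_presheaf f T F)"

text \<open>\<open>A \<otimes>\<^sub>C B\<close> for ring homomorphisms \<open>\<alpha> : C \<rightarrow> A\<close> and \<open>\<beta> : C \<rightarrow> B\<close>: the free abelian group on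
  \<open>A \<times> B\<close>, with the multiplication \<open>(a, b) (a', b') = (a a', b b')\<close>, modulo the
  \<open>C\<close>-bilinearity relations.  The additive subgroup which these relations generate is already
  an ideal.\<close>

definition pair_ring :: "'r ring \<Rightarrow> 's ring \<Rightarrow> ('r \<times> 's \<Rightarrow>\<^sub>0 int) ring" where
  "pair_ring A B =
    \<lparr>carrier = {x. Poly_Mapping.keys x \<subseteq> carrier A \<times> carrier B},
     mult = (\<lambda>x y. frag_extend (\<lambda>(a, b).
       frag_extend (\<lambda>(a', b'). frag_of (a \<otimes>\<^bsub>A\<^esub> a', b \<otimes>\<^bsub>B\<^esub> b')) y) x),
     one = frag_of (\<one>\<^bsub>A\<^esub>, \<one>\<^bsub>B\<^esub>),
     zero = 0,
     add = (+)\<rparr>"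

definition tensor_relations ::
  "'q ring \<Rightarrow> 'r ring \<Rightarrow> 's ring \<Rightarrow> ('q \<Rightarrow> 'r) \<Rightarrow> ('q \<Rightarrow> 's) \<Rightarrow> ('r \<times> 's \<Rightarrow>\<^sub>0 int) set" where
  "tensor_relations C A B \<alpha> \<beta> =
    {frag_of (a \<oplus>\<^bsub>A\<^esub> a', b) - frag_of (a, b) - frag_of (a', b) | a a' b.
       a \<in> carrier A \<and> a' \<in> carrier A \<and> b \<in> carrier B} \<union>
    {frag_of (a, b \<oplus>\<^bsub>B\<^esub> b') - frag_of (a, b) - frag_of (a, b') | a b b'.
       a \<in> carrier A \<and> b \<in> carrier B \<and> b' \<in> carrier B} \<union>
    {frag_of (\<alpha> c \<otimes>\<^bsub>A\<^esub> a, b) - frag_of (a, \<beta> c \<otimes>\<^bsub>B\<^esub> b) | c a b.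
       c \<in> carrier C \<and> a \<in> carrier A \<and> b \<in> carrier B}"

definition tensor_ideal ::
  "'q ring \<Rightarrow> 'r ring \<Rightarrow> 's ring \<Rightarrow> ('q \<Rightarrow> 'r) \<Rightarrow> ('q \<Rightarrow> 's) \<Rightarrow> ('r \<times> 's \<Rightarrow>\<^sub>0 int) set" where
  "tensor_ideal C A B \<alpha> \<beta> = Idl\<^bsub>pair_ring A B\<^esub> (tensor_relations C A B \<alpha> \<beta>)"

definition tensor_ring ::
  "'q ring \<Rightarrow> 'r ring \<Rightarrow> 's ring \<Rightarrow> ('q \<Rightarrow> 'r) \<Rightarrow> ('q \<Rightarrow> 's) \<Rightarrow> ('r \<times> 's \<Rightarrow>\<^sub>0 int) set ring" where
  "tensor_ring C A B \<alpha> \<beta> = pair_ring A B Quot tensor_ideal C A B \<alpha> \<beta>"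

definition pure_tensor ::
  "'q ring \<Rightarrow> 'r ring \<Rightarrow> 's ring \<Rightarrow> ('q \<Rightarrow> 'r) \<Rightarrow> ('q \<Rightarrow> 's) \<Rightarrow> 'r \<Rightarrow> 's \<Rightarrow>
   ('r \<times> 's \<Rightarrow>\<^sub>0 int) set" where
  "pure_tensor C A B \<alpha> \<beta> a b = tensor_ideal C A B \<alpha> \<beta> +>\<^bsub>pair_ring A B\<^esub> frag_of (a, b)"

definition tensor_presheaf ::
  "('a, 'q) presheaf \<Rightarrow> ('a, 'r) presheaf \<Rightarrow> ('a, 's) presheaf \<Rightarrow>
   ('a set \<Rightarrow> 'q \<Rightarrow> 'r) \<Rightarrow> ('a set \<Rightarrow> 'q \<Rightarrow> 's) \<Rightarrow> ('a, ('r \<times> 's \<Rightarrow>\<^sub>0 int) set) presheaf" where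
  "tensor_presheaf H F G \<alpha> \<beta> =
    \<lparr>sections = (\<lambda>U. tensor_ring (sections H U) (sections F U) (sections G U) (\<alpha> U) (\<beta> U)),
     res = (\<lambda>U V c. \<Union>x \<in> c.
       tensor_ideal (sections H V) (sections F V) (sections G V) (\<alpha> V) (\<beta> V)
         +>\<^bsub>pair_ring (sections F V) (sections G V)\<^esub>
         frag_extend (\<lambda>(a, b). frag_of (res F U V a, res G U V b)) x)\<rparr>"


section \<open>Ringed spaces\<close>

record ('a, 'r) ringed_space =
  rs_top :: "'a topology"
  rs_sheaf :: "('a, 'r) presheaf"

abbreviation rs_points :: "('a, 'r) ringed_space \<Rightarrow> 'a set" where
  "rs_points X \<equiv> topspace (rs_top X)"

abbreviation rs_sections :: "('a, 'r) ringed_space \<Rightarrow> 'a set \<Rightarrow> 'r ring" where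
  "rs_sections X \<equiv> sections (rs_sheaf X)"

definition is_ringed_space :: "('a, 'r) ringed_space \<Rightarrow> bool" where
  "is_ringed_space X \<longleftrightarrow> is_sheaf (rs_top X) (rs_sheaf X)"

text \<open>A morphism from \<open>X\<close> (points \<open>'a\<close>, sections \<open>'r\<close>) to \<open>Y\<close> (points \<open>'b\<close>, sections \<open>'s\<close>)
  consists of a continuous map and of the ring homomorphisms
  \<open>\<O>\<^sub>Y(V) \<rightarrow> \<O>\<^sub>X(f\<^sup>-\<^sup>1 V)\<close>.  All the maps involved are extensional, so that equality of morphisms
  is HOL equality.\<close>

record ('a, 'r, 'b, 's) rs_morphism =
  rs_map :: "'a \<Rightarrow> 'b"
  rs_comap :: "'b set \<Rightarrow> 's \<Rightarrow> 'r"

definition rs_preimage ::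
  "('a, 'r) ringed_space \<Rightarrow> ('a, 'r, 'b, 's) rs_morphism \<Rightarrow> 'b set \<Rightarrow> 'a set" where
  "rs_preimage X f V = {x \<in> rs_points X. rs_map f x \<in> V}"

definition rs_hom ::
  "('a, 'r) ringed_space \<Rightarrow> ('b, 's) ringed_space \<Rightarrow> ('a, 'r, 'b, 's) rs_morphism set" where
  "rs_hom X Y = {f.
     continuous_map (rs_top X) (rs_top Y) (rs_map f) \<and>
     rs_map f \<in> extensional (rs_points X) \<and>
     rs_comap f \<in> extensional {V. openin (rs_top Y) V} \<and>
     (\<forall>V. openin (rs_top Y) V \<longrightarrow>
        rs_comap f V \<in> extensional (carrier (rs_sections Y V)) \<and>
        rs_comap f V \<in> ring_hom (rs_sections Y V) (rs_sections X (rs_preimage X f V))) \<and>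
     (\<forall>U V. openin (rs_top Y) U \<and> openin (rs_top Y) V \<and> V \<subseteq> U \<longrightarrow>
        (\<forall>s \<in> carrier (rs_sections Y U).
           rs_comap f V (res (rs_sheaf Y) U V s) =
           res (rs_sheaf X) (rs_preimage X f U) (rs_preimage X f V) (rs_comap f U s)))}"

definition rs_id :: "('a, 'r) ringed_space \<Rightarrow> ('a, 'r, 'a, 'r) rs_morphism" where
  "rs_id X =
    \<lparr>rs_map = (\<lambda>x \<in> rs_points X. x),
     rs_comap = (\<lambda>V \<in> {V. openin (rs_top X) V}. \<lambda>s \<in> carrier (rs_sections X V). s)\<rparr>"

text \<open>\<open>rs_comp X Y Z g f\<close> is the composite of \<open>f : X \<rightarrow> Y\<close> and \<open>g : Y \<rightarrow> Z\<close>.\<close>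

definition rs_comp ::
  "('a, 'r) ringed_space \<Rightarrow> ('b, 's) ringed_space \<Rightarrow> ('c, 't) ringed_space \<Rightarrow>
   ('b, 's, 'c, 't) rs_morphism \<Rightarrow> ('a, 'r, 'b, 's) rs_morphism \<Rightarrow>
   ('a, 'r, 'c, 't) rs_morphism" where
  "rs_comp X Y Z g f =
    \<lparr>rs_map = (\<lambda>x \<in> rs_points X. rs_map g (rs_map f x)),
     rs_comap = (\<lambda>W \<in> {W. openin (rs_top Z) W}. \<lambda>s \<in> carrier (rs_sections Z W).
       rs_comap f (rs_preimage Y g W) (rs_comap g W s))\<rparr>"

definition rs_iso ::
  "('a, 'r) ringed_space \<Rightarrow> ('b, 's) ringed_space \<Rightarrow> ('a, 'r, 'b, 's) rs_morphism \<Rightarrow> bool" where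
  "rs_iso X Y f \<longleftrightarrow> f \<in> rs_hom X Y \<and>
    (\<exists>g \<in> rs_hom Y X. rs_comp X Y X g f = rs_id X \<and> rs_comp Y X Y f g = rs_id Y)"

text \<open>The map that \<open>f\<close> induces from germs of \<open>\<O>\<^sub>Y\<close> along \<open>f ` A\<close> to germs of \<open>\<O>\<^sub>X\<close> along \<open>A\<close>.\<close>

definition germ_map ::
  "('a, 'r) ringed_space \<Rightarrow> ('a, 'r, 'b, 's) rs_morphism \<Rightarrow> 'a set \<Rightarrow>
   ('b, 's) germ \<Rightarrow> ('a, 'r) germ" where
  "germ_map X f A c =
    (\<Union>(V, s) \<in> c. germ_of (rs_top X) (rs_sheaf X) A (rs_preimage X f V) (rs_comap f V s))"

definition stalk :: "('a, 'r) ringed_space \<Rightarrow> 'a \<Rightarrow> ('a, 'r) germ ring" where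
  "stalk X x = germ_ring (rs_top X) (rs_sheaf X) {x}"

definition stalk_map ::
  "('a, 'r) ringed_space \<Rightarrow> ('a, 'r, 'b, 's) rs_morphism \<Rightarrow> 'a \<Rightarrow>
   ('b, 's) germ \<Rightarrow> ('a, 'r) germ" where
  "stalk_map X f x = germ_map X f {x}"

definition stalks_surjective ::
  "('a, 'r) ringed_space \<Rightarrow> ('b, 's) ringed_space \<Rightarrow> ('a, 'r, 'b, 's) rs_morphism \<Rightarrow> bool" where
  "stalks_surjective X Y f \<longleftrightarrow>
    (\<forall>x \<in> rs_points X.
       stalk_map X f x ` carrier (stalk Y (rs_map f x)) = carrier (stalk X x))"

definition is_immersion ::
  "('a, 'r) ringed_space \<Rightarrow> ('b, 's) ringed_space \<Rightarrow> ('a, 'r, 'b, 's) rs_morphism \<Rightarrow> bool" where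
  "is_immersion X Y f \<longleftrightarrow>
    f \<in> rs_hom X Y \<and>
    embedding_map (rs_top X) (rs_top Y) (rs_map f) \<and>
    (\<exists>U C. openin (rs_top Y) U \<and> closedin (rs_top Y) C \<and> rs_map f ` rs_points X = U \<inter> C) \<and>
    stalks_surjective X Y f"


section \<open>Locally ringed spaces\<close>

definition is_local_ring :: "'r ring \<Rightarrow> bool" where
  "is_local_ring R \<longleftrightarrow> cring R \<and> (\<exists>!M. maximalideal M R)"

definition max_ideal :: "'r ring \<Rightarrow> 'r set" where
  "max_ideal R = (THE M. maximalideal M R)"

definition is_locally_ringed_space :: "('a, 'r) ringed_space \<Rightarrow> bool" where
  "is_locally_ringed_space X \<longleftrightarrow>
    is_ringed_space X \<and> (\<forall>x \<in> rs_points X. is_local_ring (stalk X x))"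

definition lrs_hom ::
  "('a, 'r) ringed_space \<Rightarrow> ('b, 's) ringed_space \<Rightarrow> ('a, 'r, 'b, 's) rs_morphism set" where
  "lrs_hom X Y = {f \<in> rs_hom X Y. \<forall>x \<in> rs_points X.
     stalk_map X f x ` max_ideal (stalk Y (rs_map f x)) \<subseteq> max_ideal (stalk X x)}"


section \<open>The fibered product of ringed spaces\<close>

context
  fixes X1 :: "('a, 'r) ringed_space" and X2 :: "('b, 's) ringed_space"
    and Y :: "('c, 't) ringed_space"
    and f1 :: "('a, 'r, 'c, 't) rs_morphism" and f2 :: "('b, 's, 'c, 't) rs_morphism"
begin

definition fp_top :: "('a \<times> 'b) topology" where
  "fp_top = subtopology (prod_topology (rs_top X1) (rs_top X2))
     {(x1, x2). rs_map f1 x1 = rs_map f2 x2}"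

text \<open>The sheaves \<open>\<pi>\<^sub>1\<^sup>-\<^sup>1 \<O>\<^bsub>X1\<^esub>\<close>, \<open>\<pi>\<^sub>2\<^sup>-\<^sup>1 \<O>\<^bsub>X2\<^esub>\<close> and \<open>g\<^sup>-\<^sup>1 \<O>\<^sub>Y\<close>, where \<open>g = f1 \<circ> \<pi>\<^sub>1 = f2 \<circ> \<pi>\<^sub>2\<close>,
  and the two maps out of the last one.\<close>

definition fp_sheaf1 :: "('a \<times> 'b, 'a \<times> 'b \<Rightarrow> ('a \<times> 'b, ('a, 'r) germ) germ) presheaf" where
  "fp_sheaf1 = inverse_image fp_top fst (rs_top X1) (rs_sheaf X1)"

definition fp_sheaf2 :: "('a \<times> 'b, 'a \<times> 'b \<Rightarrow> ('a \<times> 'b, ('b, 's) germ) germ) presheaf" where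
  "fp_sheaf2 = inverse_image fp_top snd (rs_top X2) (rs_sheaf X2)"

definition fp_sheafY :: "('a \<times> 'b, 'a \<times> 'b \<Rightarrow> ('a \<times> 'b, ('c, 't) germ) germ) presheaf" where
  "fp_sheafY = inverse_image fp_top (rs_map f1 \<circ> fst) (rs_top Y) (rs_sheaf Y)"

definition fp_base1 ::
  "('a \<times> 'b) set \<Rightarrow> ('a \<times> 'b \<Rightarrow> ('a \<times> 'b, ('c, 't) germ) germ) \<Rightarrow>
   ('a \<times> 'b \<Rightarrow> ('a \<times> 'b, ('a, 'r) germ) germ)" where
  "fp_base1 = sheafify_map fp_top (inverse_image_presheaf fst (rs_top X1) (rs_sheaf X1))
     (\<lambda>U. germ_map X1 f1 (fst ` U))"

definition fp_base2 ::
  "('a \<times> 'b) set \<Rightarrow> ('a \<times> 'b \<Rightarrow> ('a \<times> 'b, ('c, 't) germ) germ) \<Rightarrow>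
   ('a \<times> 'b \<Rightarrow> ('a \<times> 'b, ('b, 's) germ) germ)" where
  "fp_base2 = sheafify_map fp_top (inverse_image_presheaf snd (rs_top X2) (rs_sheaf X2))
     (\<lambda>U. germ_map X2 f2 (snd ` U))"

definition fp_presheaf where
  "fp_presheaf = tensor_presheaf fp_sheafY fp_sheaf1 fp_sheaf2 fp_base1 fp_base2"

definition rs_fibered_product where
  "rs_fibered_product = \<lparr>rs_top = fp_top, rs_sheaf = sheafify fp_top fp_presheaf\<rparr>"

definition fp_tensor where
  "fp_tensor U =
    pure_tensor (sections fp_sheafY U) (sections fp_sheaf1 U) (sections fp_sheaf2 U)
      (fp_base1 U) (fp_base2 U)"

text \<open>The projections of the fibered product: \<open>s \<mapsto> s \<otimes> 1\<close> and \<open>s \<mapsto> 1 \<otimes> s\<close> on sections.\<close>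

definition rs_proj1 where
  "rs_proj1 =
    \<lparr>rs_map = (\<lambda>z \<in> topspace fp_top. fst z),
     rs_comap = (\<lambda>V \<in> {V. openin (rs_top X1) V}. \<lambda>s \<in> carrier (rs_sections X1 V).
       let U = {z \<in> topspace fp_top. fst z \<in> V} in
       sheafify_unit fp_top fp_presheaf U
         (fp_tensor U
           (sheafify_unit fp_top (inverse_image_presheaf fst (rs_top X1) (rs_sheaf X1)) U
             (germ_of (rs_top X1) (rs_sheaf X1) (fst ` U) V s))
           \<one>\<^bsub>sections fp_sheaf2 U\<^esub>))\<rparr>"

definition rs_proj2 where
  "rs_proj2 =
    \<lparr>rs_map = (\<lambda>z \<in> topspace fp_top. snd z),
     rs_comap = (\<lambda>V \<in> {V. openin (rs_top X2) V}. \<lambda>s \<in> carrier (rs_sections X2 V).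
       let U = {z \<in> topspace fp_top. snd z \<in> V} in
       sheafify_unit fp_top fp_presheaf U
         (fp_tensor U
           \<one>\<^bsub>sections fp_sheaf1 U\<^esub>
           (sheafify_unit fp_top (inverse_image_presheaf snd (rs_top X2) (rs_sheaf X2)) U
             (germ_of (rs_top X2) (rs_sheaf X2) (snd ` U) V s))))\<rparr>"

end

text \<open>This type has to match the inferred one of the sections of \<^const>\<open>rs_fibered_product\<close>,
  a tower of nested sheafifications.\<close>

type_synonym ('a, 'r, 'b, 's) fp_section =
  "'a \<times> 'b \<Rightarrow>
    ('a \<times> 'b,
      (('a \<times> 'b \<Rightarrow> ('a \<times> 'b, ('a, 'r) germ) germ) \<times>
       ('a \<times> 'b \<Rightarrow> ('a \<times> 'b, ('b, 's) germ) germ) \<Rightarrow>\<^sub>0 int) set) germ"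


section \<open>The fibered product of locally ringed spaces\<close>

definition is_lrs_cone ::
  "('a, 'r) ringed_space \<Rightarrow> ('b, 's) ringed_space \<Rightarrow> ('c, 't) ringed_space \<Rightarrow>
   ('a, 'r, 'c, 't) rs_morphism \<Rightarrow> ('b, 's, 'c, 't) rs_morphism \<Rightarrow>
   ('p, 'u) ringed_space \<Rightarrow> ('p, 'u, 'a, 'r) rs_morphism \<Rightarrow> ('p, 'u, 'b, 's) rs_morphism \<Rightarrow>
   bool" where
  "is_lrs_cone X1 X2 Y f1 f2 P p1 p2 \<longleftrightarrow>
    is_locally_ringed_space P \<and> p1 \<in> lrs_hom P X1 \<and> p2 \<in> lrs_hom P X2 \<and>
    rs_comp P X1 Y f1 p1 = rs_comp P X2 Y f2 p2"

definition lrs_universal_for ::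
  "('q, 'v) ringed_space itself \<Rightarrow>
   ('a, 'r) ringed_space \<Rightarrow> ('b, 's) ringed_space \<Rightarrow> ('c, 't) ringed_space \<Rightarrow>
   ('a, 'r, 'c, 't) rs_morphism \<Rightarrow> ('b, 's, 'c, 't) rs_morphism \<Rightarrow>
   ('p, 'u) ringed_space \<Rightarrow> ('p, 'u, 'a, 'r) rs_morphism \<Rightarrow> ('p, 'u, 'b, 's) rs_morphism \<Rightarrow>
   bool" where
  "lrs_universal_for (ty :: ('q, 'v) ringed_space itself) X1 X2 Y f1 f2 P p1 p2 \<longleftrightarrow>
    (\<forall>(Q :: ('q, 'v) ringed_space) q1 q2. is_lrs_cone X1 X2 Y f1 f2 Q q1 q2 \<longrightarrow>
       (\<exists>!h. h \<in> lrs_hom Q P \<and> rs_comp Q P X1 p1 h = q1 \<and> rs_comp Q P X2 p2 h = q2))"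

text \<open>The argument \<open>ty\<close> of \<^const>\<open>lrs_universal_for\<close> only selects the type of the test objects.
  HOL cannot quantify over the types of the test objects inside a formula.  The universal
  property is demanded for test objects of the type of \<open>P\<close> itself and for those of the type of
  \<^const>\<open>rs_fibered_product\<close>.  A fibered product with respect to arbitrary test objects
  satisfies this definition, so what is proved for all \<open>P\<close> satisfying it applies to it.\<close>

definition is_lrs_fibered_product ::
  "('a, 'r) ringed_space \<Rightarrow> ('b, 's) ringed_space \<Rightarrow> ('c, 't) ringed_space \<Rightarrow>
   ('a, 'r, 'c, 't) rs_morphism \<Rightarrow> ('b, 's, 'c, 't) rs_morphism \<Rightarrow>
   ('p, 'u) ringed_space \<Rightarrow> ('p, 'u, 'a, 'r) rs_morphism \<Rightarrow> ('p, 'u, 'b, 's) rs_morphism \<Rightarrow>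
   bool" where
  "is_lrs_fibered_product X1 X2 Y f1 f2 P p1 p2 \<longleftrightarrow>
    is_lrs_cone X1 X2 Y f1 f2 P p1 p2 \<and>
    lrs_universal_for TYPE(('p, 'u) ringed_space) X1 X2 Y f1 f2 P p1 p2 \<and>
    lrs_universal_for TYPE(('a \<times> 'b, ('a, 'r, 'b, 's) fp_section) ringed_space)
      X1 X2 Y f1 f2 P p1 p2"

definition comparison ::
  "('a, 'r) ringed_space \<Rightarrow> ('b, 's) ringed_space \<Rightarrow> ('c, 't) ringed_space \<Rightarrow>
   ('a, 'r, 'c, 't) rs_morphism \<Rightarrow> ('b, 's, 'c, 't) rs_morphism \<Rightarrow>
   ('p, 'u) ringed_space \<Rightarrow> ('p, 'u, 'a, 'r) rs_morphism \<Rightarrow> ('p, 'u, 'b, 's) rs_morphism \<Rightarrow>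
   ('p, 'u, 'a \<times> 'b, ('a, 'r, 'b, 's) fp_section) rs_morphism" where
  "comparison X1 X2 Y f1 f2 P p1 p2 =
    (THE \<eta>. \<eta> \<in> rs_hom P (rs_fibered_product X1 X2 Y f1 f2) \<and>
       rs_comp P (rs_fibered_product X1 X2 Y f1 f2) X1 (rs_proj1 X1 X2 Y f1 f2) \<eta> = p1 \<and>
       rs_comp P (rs_fibered_product X1 X2 Y f1 f2) X2 (rs_proj2 X1 X2 Y f1 f2) \<eta> = p2)"


section \<open>Spectra and residue fields\<close>

definition fraction :: "'r ring \<Rightarrow> 'r set \<Rightarrow> 'r \<Rightarrow> 'r \<Rightarrow> ('r \<times> 'r) set" where
  "fraction A S a s =
    {(b, t). b \<in> carrier A \<and> t \<in> S \<and>
       (\<exists>u \<in> S. u \<otimes>\<^bsub>A\<^esub> (t \<otimes>\<^bsub>A\<^esub> a) = u \<otimes>\<^bsub>A\<^esub> (s \<otimes>\<^bsub>A\<^esub> b))}"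

definition localization :: "'r ring \<Rightarrow> 'r set \<Rightarrow> ('r \<times> 'r) set ring" where
  "localization A S =
    \<lparr>carrier = {fraction A S a s | a s. a \<in> carrier A \<and> s \<in> S},
     mult = (\<lambda>x y. \<Union>(a, s) \<in> x. \<Union>(b, t) \<in> y. fraction A S (a \<otimes>\<^bsub>A\<^esub> b) (s \<otimes>\<^bsub>A\<^esub> t)),
     one = fraction A S \<one>\<^bsub>A\<^esub> \<one>\<^bsub>A\<^esub>,
     zero = fraction A S \<zero>\<^bsub>A\<^esub> \<one>\<^bsub>A\<^esub>,
     add = (\<lambda>x y. \<Union>(a, s) \<in> x. \<Union>(b, t) \<in> y.
       fraction A S (t \<otimes>\<^bsub>A\<^esub> a \<oplus>\<^bsub>A\<^esub> s \<otimes>\<^bsub>A\<^esub> b) (s \<otimes>\<^bsub>A\<^esub> t))\<rparr>"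

definition spec_top :: "'r ring \<Rightarrow> 'r set topology" where
  "spec_top A =
    topology_generated_by ((\<lambda>a. {p. primeideal p A \<and> a \<notin> p}) ` carrier A)"

definition Spec :: "'r ring \<Rightarrow> ('r set, 'r set \<Rightarrow> ('r \<times> 'r) set) ringed_space" where
  "Spec A =
    \<lparr>rs_top = spec_top A,
     rs_sheaf =
       \<lparr>sections = (\<lambda>U. pointwise_ring U (\<lambda>p. localization A (carrier A - p))
          {s \<in> (\<Pi>\<^sub>E p\<in>U. carrier (localization A (carrier A - p))).
             \<forall>p\<in>U. \<exists>V. openin (spec_top A) V \<and> p \<in> V \<and> V \<subseteq> U \<and>
               (\<exists>a \<in> carrier A. \<exists>b \<in> carrier A. \<forall>q\<in>V.
                  b \<notin> q \<and> s q = fraction A (carrier A - q) a b)}),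
        res = (\<lambda>U V s. restrict s V)\<rparr>\<rparr>"

definition residue_field :: "('a, 'r) ringed_space \<Rightarrow> 'a \<Rightarrow> ('a, 'r) germ set ring" where
  "residue_field Y y = stalk Y y Quot max_ideal (stalk Y y)"

definition residue_class :: "('a, 'r) ringed_space \<Rightarrow> 'a \<Rightarrow> 'a set \<Rightarrow> 'r \<Rightarrow> ('a, 'r) germ set" where
  "residue_class Y y V s =
    max_ideal (stalk Y y) +>\<^bsub>stalk Y y\<^esub> germ_of (rs_top Y) (rs_sheaf Y) {y} V s"

text \<open>The natural map \<open>Spec k(y) \<rightarrow> Y\<close> sends the point to \<open>y\<close> and a section near \<open>y\<close> to its value
  in \<open>k(y)\<close>; the preimage of an open set that does not contain \<open>y\<close> is empty.\<close>

definition point_inclusion ::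
  "('a, 'r) ringed_space \<Rightarrow> 'a \<Rightarrow>
   (('a, 'r) germ set set,
    ('a, 'r) germ set set \<Rightarrow> (('a, 'r) germ set \<times> ('a, 'r) germ set) set, 'a, 'r) rs_morphism"
  where
  "point_inclusion Y y =
    \<lparr>rs_map = (\<lambda>p \<in> rs_points (Spec (residue_field Y y)). y),
     rs_comap = (\<lambda>V \<in> {V. openin (rs_top Y) V}. \<lambda>s \<in> carrier (rs_sections Y V).
       \<lambda>p \<in> {p \<in> rs_points (Spec (residue_field Y y)). y \<in> V}.
         fraction (residue_field Y y) (carrier (residue_field Y y) - p)
           (residue_class Y y V s) \<one>\<^bsub>residue_field Y y\<^esub>)\<rparr>"

end

theory Submission
  imports Defs "HOL-Algebra.Free_Abelian_Groups"
begin

text \<open>Let \<open>F\<close> be the fibered product in ringed spaces, and \<open>z = (x1, x2)\<close> a point of it.  Its sheaf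
  is generated, locally and as a sheaf of rings, by the pullbacks of sections of \<open>X1\<close> and \<open>X2\<close>.
  If \<open>f1\<close> is surjective on stalks, then every germ pulled back from \<open>X1\<close> comes from \<open>Y\<close>, and
  hence from \<open>X2\<close>; so the stalk of \<open>F\<close> at \<open>z\<close> is a quotient of the stalk of \<open>X2\<close> at \<open>x2\<close>.  The
  kernel lies in the maximal ideal: as \<open>f1\<close> is surjective and both \<open>f1\<close> and \<open>f2\<close> are local, the
  residue map at \<open>x2\<close> and the map that it induces on the stalk of \<open>X1\<close> at \<open>x1\<close> together define
  a homomorphism from the stalk of \<open>F\<close> to the residue field of \<open>x2\<close>.  Therefore \<open>F\<close> is locally
  ringed, its projections are local, and a morphism into \<open>F\<close> from a locally ringed space is
  local when its components are.  So \<open>F\<close> is also the fibered product in locally ringed spaces,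
  and the comparison is the isomorphism between two solutions of one universal problem.\<close>

section \<open>Maximal ideals and local rings\<close>

text \<open>A section of the fibered product is a function into germs of a tensor product of
  functions into germs of germs, so the arguments avoid computing with sections. Two facts about a
  stalk of \<open>F\<close> carry them: \<open>fp_stalk_induct\<close>, generation as a ring by the
  stalks of \<open>X1\<close> and \<open>X2\<close>, and \<open>stalk_lift\<close>, extension of
  compatible homomorphisms from these two stalks. Generation gives uniqueness of morphisms into
  \<open>F\<close> and surjectivity of the second projection on stalks; extension gives existence of
  morphisms and the map to the residue field. Morphisms are recovered from their stalk maps by
  gluing (\<open>rs_hom_of_stalk_maps\<close>), so an isomorphism between the stalk and a tensor
  product of stalks is never stated. Nor is the kernel of the second projection on stalks ever
  computed: it suffices that residue classes survive. Universality of \<open>P\<close> enters twice,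
  for the test object \<open>F\<close>, where it yields the inverse, and for \<open>P\<close>
  itself, where it identifies an endomorphism with the identity; these account for the two types of
  test objects in \<open>is_lrs_fibered_product\<close>.\<close>

lemma image_the_elem_quotient:
  assumes "ideal I R" "ring D" "h \<in> ring_hom R D" "h ` I \<subseteq> {\<zero>\<^bsub>D\<^esub>}" "x \<in> carrier R"
  shows "h ` (I +>\<^bsub>R\<^esub> x) = {h x}"
proof -
  interpret ideal I R by fact
  interpret D: ring D by fact
  interpret ring_hom_ring R D h by (rule ring_hom_ringI2) (use assms ring_axioms in auto)
  have "h (i \<oplus>\<^bsub>R\<^esub> x) = h x" if "i \<in> I" for i
    using that assms(4,5) by (auto simp: image_subset_iff Icarr)
  moreover have "h ` (I +>\<^bsub>R\<^esub> x) = (\<lambda>i. h (i \<oplus>\<^bsub>R\<^esub> x)) ` I"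
    by (auto simp: a_r_coset_def')
  moreover have "I \<noteq> {}"
    using additive_subgroup.zero_closed[OF ideal.axioms(1)[OF assms(1)]] by blast
  ultimately show ?thesis by auto
qed

text \<open>Two elements of a coset differ by an element of \<open>I\<close>, which \<open>h\<close>
  kills, so the image of a coset is a singleton. Applying \<open>the_elem\<close> to it gives the
  induced map without a choice of representatives.\<close>

lemma quotient_lift_hom:
  assumes "ideal I R" "ring D" "h \<in> ring_hom R D" "h ` I \<subseteq> {\<zero>\<^bsub>D\<^esub>}"
  shows "(\<lambda>c. the_elem (h ` c)) \<in> ring_hom (R Quot I) D"
proof -
  interpret ideal I R by fact
  have *: "the_elem (h ` (I +>\<^bsub>R\<^esub> x)) = h x" if "x \<in> carrier R" for x
    by (simp add: image_the_elem_quotient[OF assms that])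
  show ?thesis
  proof (rule ring_hom_memI)
    fix c assume "c \<in> carrier (R Quot I)"
    then show "the_elem (h ` c) \<in> carrier D"
      using * ring_hom_closed[OF assms(3)] by (auto simp: FactRing_def A_RCOSETS_def')
  next
    fix c d assume "c \<in> carrier (R Quot I)" "d \<in> carrier (R Quot I)"
    then obtain x y where x: "x \<in> carrier R" "c = I +>\<^bsub>R\<^esub> x" and y: "y \<in> carrier R" "d = I +>\<^bsub>R\<^esub> y"
      by (auto simp: FactRing_def A_RCOSETS_def')
    show "the_elem (h ` (c \<otimes>\<^bsub>R Quot I\<^esub> d)) = the_elem (h ` c) \<otimes>\<^bsub>D\<^esub> the_elem (h ` d)"
      using x y ring_hom_mult[OF assms(3)] by (simp add: FactRing_def rcoset_mult_add *)
    show "the_elem (h ` (c \<oplus>\<^bsub>R Quot I\<^esub> d)) = the_elem (h ` c) \<oplus>\<^bsub>D\<^esub> the_elem (h ` d)"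
      using x y ring_hom_add[OF assms(3)] by (simp add: FactRing_def a_rcos_sum *)
  next
    show "the_elem (h ` \<one>\<^bsub>R Quot I\<^esub>) = \<one>\<^bsub>D\<^esub>"
      using ring_hom_one[OF assms(3)] by (simp add: FactRing_def *)
  qed
qed

text \<open>Surjectivity is what gives absorption: a multiplier in \<open>S\<close> is the image of
  one in \<open>R\<close>.\<close>

lemma ideal_image_surj:
  assumes "ring R" "ring S" "h \<in> ring_hom R S" and surj: "h ` carrier R = carrier S" and "ideal J R"
  shows "ideal (h ` J) S"
proof -
  interpret R: ring R by fact
  interpret S: ring S by fact
  interpret ring_hom_ring R S h by (rule ring_hom_ringI2) fact+
  interpret J: ideal J R by fact
  show ?thesis
  proof (rule idealI)
    show "subgroup (h ` J) (add_monoid S)"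
    proof (rule S.add.subgroupI)
      show "h ` J \<noteq> {}" using J.zero_closed by blast
    next
      fix a assume "a \<in> h ` J"
      then obtain j where j: "j \<in> J" "a = h j" by auto
      then have "h (\<ominus>\<^bsub>R\<^esub> j) = \<ominus>\<^bsub>S\<^esub> a" by auto
      then show "\<ominus>\<^bsub>S\<^esub> a \<in> h ` J" using j J.a_inv_closed by (metis image_eqI)
    next
      fix a b assume "a \<in> h ` J" "b \<in> h ` J"
      then obtain j k where "j \<in> J" "a = h j" "k \<in> J" "b = h k" by auto
      moreover then have "h (j \<oplus>\<^bsub>R\<^esub> k) = a \<oplus>\<^bsub>S\<^esub> b" by auto
      ultimately show "a \<oplus>\<^bsub>S\<^esub> b \<in> h ` J" using J.a_closed by (metis image_eqI)
    qed (use J.Icarr in auto)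
  next
    fix a x assume "a \<in> h ` J" "x \<in> carrier S"
    moreover from this(2) have "x \<in> h ` carrier R" using surj by simp
    ultimately obtain j r where jr: "j \<in> J" "a = h j" "r \<in> carrier R" "x = h r" by auto
    then have "h (r \<otimes>\<^bsub>R\<^esub> j) = x \<otimes>\<^bsub>S\<^esub> a" "h (j \<otimes>\<^bsub>R\<^esub> r) = a \<otimes>\<^bsub>S\<^esub> x" by auto
    then show "x \<otimes>\<^bsub>S\<^esub> a \<in> h ` J" "a \<otimes>\<^bsub>S\<^esub> x \<in> h ` J"
      using jr J.I_l_closed J.I_r_closed by (metis image_eqI)+
  qed (rule S.ring_axioms)
qed

lemma ring_hom_eq_kernel:
  assumes "ring R" "ring S" "h \<in> ring_hom R S" "r \<in> carrier R" "t \<in> carrier R" "h r = h t"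
  shows "h (r \<ominus>\<^bsub>R\<^esub> t) = \<zero>\<^bsub>S\<^esub>"
proof -
  interpret R: ring R by fact
  interpret S: ring S by fact
  interpret ring_hom_ring R S h by (rule ring_hom_ringI2) fact+
  show ?thesis using assms by (simp add: R.minus_eq S.r_neg)
qed

text \<open>If \<open>h r = h j\<close> with \<open>j\<close> in \<open>J\<close>, then
  \<open>r - j\<close> lies in the kernel, which is contained in \<open>J\<close>. An ideal that
  contains the kernel is thus recovered from its image.\<close>

lemma ideal_saturated:
  assumes "ring R" "ring S" "h \<in> ring_hom R S" "ideal J R"
    and ker: "\<And>r. r \<in> carrier R \<Longrightarrow> h r = \<zero>\<^bsub>S\<^esub> \<Longrightarrow> r \<in> J" and r: "r \<in> carrier R" "h r \<in> h ` J"
  shows "r \<in> J"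
proof -
  interpret R: ring R by fact
  interpret J: ideal J R by fact
  obtain j where j: "j \<in> J" "h r = h j" using r(2) by auto
  have "r \<ominus>\<^bsub>R\<^esub> j \<in> J" using ring_hom_eq_kernel[OF assms(1-3) r(1) _ j(2)] r j by (intro ker) auto
  then have "(r \<ominus>\<^bsub>R\<^esub> j) \<oplus>\<^bsub>R\<^esub> j \<in> J" using j by simp
  then show ?thesis using r j by (simp add: R.minus_eq R.add.m_assoc R.l_neg)
qed

text \<open>The ideals above \<open>?N\<close> contain the kernel, so they are determined by their
  images, which lie above \<open>M\<close>; maximality of \<open>M\<close> leaves only two of
  them.\<close>

lemma maximalideal_vimage:
  assumes "cring R" "cring S" "h \<in> ring_hom R S" and surj: "h ` carrier R = carrier S" and "maximalideal M S"
  shows "maximalideal {r \<in> carrier R. h r \<in> M} R" (is "maximalideal ?N R")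
proof -
  interpret R: cring R by fact
  interpret S: cring S by fact
  interpret ring_hom_ring R S h by (rule ring_hom_ringI2) (use assms R.ring_axioms S.ring_axioms in auto)
  interpret M: maximalideal M S by fact
  show ?thesis
  proof (rule maximalidealI)
    show "ideal ?N R" using M.is_ideal by (rule ideal_vimage)
    have "\<one>\<^bsub>S\<^esub> \<notin> M" using M.I_notcarr M.one_imp_carrier by auto
    then show "carrier R \<noteq> ?N" using R.one_closed hom_one by force
  next
    fix J assume J: "ideal J R" "?N \<subseteq> J" "J \<subseteq> carrier R"
    have "M \<subseteq> h ` J"
    proof
      fix m assume "m \<in> M"
      then have "m \<in> h ` carrier R" unfolding surj by (rule M.Icarr)
      then show "m \<in> h ` J" using J(2) \<open>m \<in> M\<close> by auto
    qed
    moreover have "h ` J \<subseteq> carrier S" using J(3) by auto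
    ultimately consider "h ` J = M" | "h ` J = carrier S"
      using M.I_maximal ideal_image_surj[OF R.ring_axioms S.ring_axioms assms(3) surj J(1)] by blast
    then show "J = ?N \<or> J = carrier R"
    proof cases
      case 1
      then have "J \<subseteq> ?N" using J(3) by auto
      then have "J = ?N" using J(2) by (rule subset_antisym)
      then show ?thesis by (rule disjI1)
    next
      case 2
      have "carrier R \<subseteq> J"
      proof
        fix r assume r: "r \<in> carrier R"
        show "r \<in> J"
          by (rule ideal_saturated[OF R.ring_axioms S.ring_axioms assms(3) J(1)]) (use J(2) r 2 in auto)
      qed
      then show ?thesis using J(3) by auto
    qed
  qed
qed

text \<open>The kernel condition makes \<open>N\<close> the full preimage of its image. Hence the
  image is proper because \<open>N\<close> is, and an ideal above it pulls back to one above
  \<open>N\<close>.\<close>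

lemma maximalideal_image:
  assumes "cring R" "cring S" "h \<in> ring_hom R S" and surj: "h ` carrier R = carrier S" and "maximalideal N R"
    and ker: "\<And>r. r \<in> carrier R \<Longrightarrow> h r = \<zero>\<^bsub>S\<^esub> \<Longrightarrow> r \<in> N"
  shows "maximalideal (h ` N) S"
proof -
  interpret R: cring R by fact
  interpret S: cring S by fact
  interpret ring_hom_ring R S h by (rule ring_hom_ringI2) (use assms R.ring_axioms S.ring_axioms in auto)
  interpret N: maximalideal N R by fact
  have in_N: "r \<in> N" if "r \<in> carrier R" "h r \<in> h ` N" for r
    by (rule ideal_saturated[OF R.ring_axioms S.ring_axioms assms(3) N.is_ideal ker that])
  show ?thesis
  proof (rule maximalidealI)
    show "ideal (h ` N) S"
      by (rule ideal_image_surj[OF R.ring_axioms S.ring_axioms assms(3) surj N.is_ideal])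
    show "carrier S \<noteq> h ` N"
    proof
      assume eq: "carrier S = h ` N"
      have "carrier R \<subseteq> N"
      proof
        fix r assume "r \<in> carrier R"
        then show "r \<in> N" by (rule in_N) (use \<open>r \<in> carrier R\<close> eq[symmetric] in simp)
      qed
      then show False using N.I_notcarr N.Icarr by blast
    qed
  next
    fix J assume J: "ideal J S" "h ` N \<subseteq> J" "J \<subseteq> carrier S"
    let ?J = "{r \<in> carrier R. h r \<in> J}"
    have "J \<subseteq> h ` carrier R" unfolding surj by (rule J(3))
    then have hJ: "h ` ?J = J" by auto
    have "N \<subseteq> ?J" using J(2) N.Icarr by auto
    then consider "?J = N" | "?J = carrier R"
      using N.I_maximal[OF ideal_vimage[OF J(1)]] by blast
    then show "J = h ` N \<or> J = carrier S"
      using hJ surj by cases auto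
  qed
qed

lemma max_ideal_maximal: "is_local_ring R \<Longrightarrow> maximalideal (max_ideal R) R"
  unfolding is_local_ring_def max_ideal_def by (metis theI)

lemma max_ideal_unique: "is_local_ring R \<Longrightarrow> maximalideal M R \<Longrightarrow> M = max_ideal R"
  using max_ideal_maximal unfolding is_local_ring_def by blast

lemma maximalideal_subset: "maximalideal M R \<Longrightarrow> M \<subseteq> carrier R"
  by (meson additive_subgroup.a_subset ideal.axioms(1) maximalideal.axioms(1))

lemma max_ideal_subset: "is_local_ring R \<Longrightarrow> max_ideal R \<subseteq> carrier R"
  by (rule maximalideal_subset[OF max_ideal_maximal])

text \<open>The preimage of the maximal ideal is maximal by surjectivity, and there is only one
  maximal ideal. In particular a surjective homomorphism of local rings is local, and its kernel
  lies in the maximal ideal.\<close>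

lemma max_ideal_vimage_surj:
  assumes "is_local_ring R" "is_local_ring S" "h \<in> ring_hom R S" "h ` carrier R = carrier S"
  shows "max_ideal R = {r \<in> carrier R. h r \<in> max_ideal S}"
  using maximalideal_vimage[of R S h "max_ideal S"] max_ideal_unique[of R] max_ideal_maximal[of S] assms
  unfolding is_local_ring_def by metis

text \<open>Every maximal ideal of \<open>S\<close> pulls back to the one of \<open>R\<close>, whose
  image is therefore the only candidate; the condition on the kernel makes that image proper, and so
  excludes the zero ring. This serves for the stalks of the fibered product and again for the stalk
  of the spectrum of a residue field.\<close>

lemma local_ring_surj:
  assumes R: "is_local_ring R" and S: "cring S" and h: "h \<in> ring_hom R S" "h ` carrier R = carrier S"
    and ker: "\<And>r. r \<in> carrier R \<Longrightarrow> h r = \<zero>\<^bsub>S\<^esub> \<Longrightarrow> r \<in> max_ideal R"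
  shows "is_local_ring S" and "max_ideal S = h ` max_ideal R"
proof -
  have cR: "cring R" using R unfolding is_local_ring_def by auto
  have m: "maximalideal (h ` max_ideal R) S"
    using maximalideal_image[OF cR S h max_ideal_maximal[OF R] ker] by blast
  have u: "M = h ` max_ideal R" if "maximalideal M S" for M
  proof -
    have "{r \<in> carrier R. h r \<in> M} = max_ideal R"
      using maximalideal_vimage[OF cR S h that] max_ideal_unique[OF R] by blast
    moreover have "M \<subseteq> h ` carrier R" unfolding h(2) using that by (rule maximalideal_subset)
    then have "M = h ` {r \<in> carrier R. h r \<in> M}" by auto
    ultimately show ?thesis by simp
  qed
  show l: "is_local_ring S" unfolding is_local_ring_def using S m u by blast
  show "max_ideal S = h ` max_ideal R" using max_ideal_unique[OF l m] by simp
qed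

section \<open>The tensor product of rings\<close>

text \<open>Additivity in the function, not in the chain. The product of \<open>pair_ring\<close>
  nests one linear extension inside another, so a sum in the second factor changes the function that
  is extended.\<close>

lemma frag_extend_add_fun: "frag_extend (\<lambda>p. f p + g p) x = frag_extend f x + frag_extend g x"
  by (simp add: frag_extend_def frag_cmul_distrib2 sum.distrib)

lemma frag_extend_diff_fun: "frag_extend (\<lambda>p. f p - g p) x = frag_extend f x - frag_extend g x"
  using frag_extend_add_fun[of "\<lambda>p. f p - g p" g x] by simp

lemma pair_ring_carrier: "x \<in> carrier (pair_ring A B) \<longleftrightarrow> Poly_Mapping.keys x \<subseteq> carrier A \<times> carrier B"
  by (simp add: pair_ring_def)

lemma pair_ring_simps [simp]:
  "\<zero>\<^bsub>pair_ring A B\<^esub> = 0" "x \<oplus>\<^bsub>pair_ring A B\<^esub> y = x + y" "\<one>\<^bsub>pair_ring A B\<^esub> = frag_of (\<one>\<^bsub>A\<^esub>, \<one>\<^bsub>B\<^esub>)"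
  by (simp_all add: pair_ring_def)

lemma pair_ring_mult_simps [simp]:
  "0 \<otimes>\<^bsub>pair_ring A B\<^esub> y = 0" "x \<otimes>\<^bsub>pair_ring A B\<^esub> 0 = 0"
  "(x + x') \<otimes>\<^bsub>pair_ring A B\<^esub> y = x \<otimes>\<^bsub>pair_ring A B\<^esub> y + x' \<otimes>\<^bsub>pair_ring A B\<^esub> y"
  "x \<otimes>\<^bsub>pair_ring A B\<^esub> (y + y') = x \<otimes>\<^bsub>pair_ring A B\<^esub> y + x \<otimes>\<^bsub>pair_ring A B\<^esub> y'"
  "(x - x') \<otimes>\<^bsub>pair_ring A B\<^esub> y = x \<otimes>\<^bsub>pair_ring A B\<^esub> y - x' \<otimes>\<^bsub>pair_ring A B\<^esub> y"
  "x \<otimes>\<^bsub>pair_ring A B\<^esub> (y - y') = x \<otimes>\<^bsub>pair_ring A B\<^esub> y - x \<otimes>\<^bsub>pair_ring A B\<^esub> y'"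
  by (simp_all add: pair_ring_def frag_extend_add frag_extend_diff split_def
      frag_extend_add_fun frag_extend_diff_fun frag_extend_eq_0)

lemma pair_ring_mult_of [simp]:
  "frag_of p \<otimes>\<^bsub>pair_ring A B\<^esub> frag_of q = frag_of (fst p \<otimes>\<^bsub>A\<^esub> fst q, snd p \<otimes>\<^bsub>B\<^esub> snd q)"
  by (simp add: pair_ring_def split_def)

lemma frag_of_in_pair_ring [simp]:
  "frag_of p \<in> carrier (pair_ring A B) \<longleftrightarrow> fst p \<in> carrier A \<and> snd p \<in> carrier B"
  by (cases p) (simp add: pair_ring_carrier keys_frag_of)

lemma pair_ring_diff_closed:
  "x \<in> carrier (pair_ring A B) \<Longrightarrow> y \<in> carrier (pair_ring A B) \<Longrightarrow> x - y \<in> carrier (pair_ring A B)"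
  unfolding pair_ring_carrier using keys_diff[of x y] by blast

text \<open>The pairs generate the additive group. Differences replace both sums and negatives, so a
  linear property needs only one closure step.\<close>

lemma pair_ring_induct [consumes 1, case_names zero of diff]:
  assumes "x \<in> carrier (pair_ring A B)"
    and "P 0" "\<And>a b. a \<in> carrier A \<Longrightarrow> b \<in> carrier B \<Longrightarrow> P (frag_of (a, b))"
    and "\<And>x y. x \<in> carrier (pair_ring A B) \<Longrightarrow> y \<in> carrier (pair_ring A B) \<Longrightarrow> P x \<Longrightarrow> P y \<Longrightarrow> P (x - y)"
  shows "P x"
proof (rule free_Abelian_group_induct[OF assms(1)[unfolded pair_ring_carrier]])
  show "P (frag_of p)" if "p \<in> carrier A \<times> carrier B" for p
    using that assms(3) by (cases p) auto
qed (use assms(2,4) in \<open>simp_all add: pair_ring_carrier\<close>)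

text \<open>This is the monoid ring, with integer coefficients, of the product of the multiplicative
  monoids of \<open>A\<close> and \<open>B\<close>. Its laws of multiplication are additive in each
  variable, so they are checked on pairs; \<open>assoc1\<close>, \<open>assoc2\<close> and
  \<open>assoc\<close> free the variables one at a time.\<close>

lemma pair_ring_cring:
  assumes "cring A" "cring B"
  shows "cring (pair_ring A B)"
proof -
  interpret A: cring A by fact
  interpret B: cring B by fact
  let ?R = "pair_ring A B"
  have closed: "x \<otimes>\<^bsub>?R\<^esub> y \<in> carrier ?R" if "x \<in> carrier ?R" "y \<in> carrier ?R" for x y
    using that(1)
  proof (induction rule: pair_ring_induct)
    case zero
    then show ?case by (simp add: pair_ring_carrier)
  next
    case (of a b)
    show ?case using that(2)
      by (induction rule: pair_ring_induct)
        (use of in \<open>simp_all add: pair_ring_diff_closed\<close>, simp add: pair_ring_carrier)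
  next
    case (diff x y)
    then show ?case by (simp add: pair_ring_diff_closed)
  qed
  have comm: "x \<otimes>\<^bsub>?R\<^esub> y = y \<otimes>\<^bsub>?R\<^esub> x" if "x \<in> carrier ?R" "y \<in> carrier ?R" for x y
    using that(1)
  proof (induction rule: pair_ring_induct)
    case (of a b)
    show ?case using that(2)
      by (induction rule: pair_ring_induct) (use of in \<open>simp_all add: A.m_comm B.m_comm\<close>)
  qed simp_all
  have assoc1: "frag_of p \<otimes>\<^bsub>?R\<^esub> (frag_of q \<otimes>\<^bsub>?R\<^esub> z) = (frag_of p \<otimes>\<^bsub>?R\<^esub> frag_of q) \<otimes>\<^bsub>?R\<^esub> z"
    if "p \<in> carrier A \<times> carrier B" "q \<in> carrier A \<times> carrier B" "z \<in> carrier ?R" for p q z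
    using that(3) by (induction rule: pair_ring_induct) (use that in \<open>auto simp: A.m_assoc B.m_assoc\<close>)
  have assoc2: "frag_of p \<otimes>\<^bsub>?R\<^esub> (y \<otimes>\<^bsub>?R\<^esub> z) = (frag_of p \<otimes>\<^bsub>?R\<^esub> y) \<otimes>\<^bsub>?R\<^esub> z"
    if "p \<in> carrier A \<times> carrier B" "y \<in> carrier ?R" "z \<in> carrier ?R" for p y z
    using that(2) by (induction rule: pair_ring_induct)
      (use that in \<open>simp_all add: assoc1 del: pair_ring_mult_of\<close>)
  have assoc: "x \<otimes>\<^bsub>?R\<^esub> (y \<otimes>\<^bsub>?R\<^esub> z) = (x \<otimes>\<^bsub>?R\<^esub> y) \<otimes>\<^bsub>?R\<^esub> z"
    if "x \<in> carrier ?R" "y \<in> carrier ?R" "z \<in> carrier ?R" for x y z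
    using that(1) by (induction rule: pair_ring_induct) (use that in \<open>simp_all add: assoc2\<close>)
  have one: "frag_of (\<one>\<^bsub>A\<^esub>, \<one>\<^bsub>B\<^esub>) \<otimes>\<^bsub>?R\<^esub> x = x" if "x \<in> carrier ?R" for x
    using that by (induction rule: pair_ring_induct) simp_all
  show ?thesis
  proof (rule cringI)
    show "abelian_group ?R"
    proof (rule abelian_groupI)
      fix x assume "x \<in> carrier ?R"
      then have "-x \<in> carrier ?R \<and> -x \<oplus>\<^bsub>?R\<^esub> x = \<zero>\<^bsub>?R\<^esub>" by (simp add: pair_ring_carrier)
      then show "\<exists>y\<in>carrier ?R. y \<oplus>\<^bsub>?R\<^esub> x = \<zero>\<^bsub>?R\<^esub>" by blast
    next
      fix x y assume "x \<in> carrier ?R" "y \<in> carrier ?R"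
      then show "x \<oplus>\<^bsub>?R\<^esub> y \<in> carrier ?R"
        using keys_add[of x y] by (simp add: pair_ring_carrier) blast
    qed (simp_all add: pair_ring_carrier add.commute add.assoc)
    show "comm_monoid ?R"
      by (rule comm_monoidI) (simp_all add: closed one assoc, rule comm)
  qed simp
qed

text \<open>Of \<open>\<alpha>\<close> and \<open>\<beta>\<close> only values in the carriers are
  asked: the relations generate an ideal for any such maps, and the quotient is a commutative ring.
  For the sheafified maps \<open>fp_base1\<close> and \<open>fp_base2\<close> this leaves values and
  restrictions to be checked.\<close>

context
  fixes C :: "'q ring" and A :: "'r ring" and B :: "'s ring" and \<alpha> \<beta>
  assumes A: "cring A" and B: "cring B"
    and \<alpha>: "\<alpha> \<in> carrier C \<rightarrow> carrier A" and \<beta>: "\<beta> \<in> carrier C \<rightarrow> carrier B"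
begin

interpretation A: cring A by (rule A)
interpretation B: cring B by (rule B)
interpretation P: cring "pair_ring A B" by (rule pair_ring_cring[OF A B])

lemma pair_ring_uminus: "x \<in> carrier (pair_ring A B) \<Longrightarrow> \<ominus>\<^bsub>pair_ring A B\<^esub> x = - x"
  by (rule P.minus_equality) (simp_all add: pair_ring_carrier)

lemma tensor_relations_subset: "tensor_relations C A B \<alpha> \<beta> \<subseteq> carrier (pair_ring A B)"
  unfolding tensor_relations_def using \<alpha> \<beta>
  by (auto intro!: pair_ring_diff_closed A.m_closed B.m_closed dest: Pi_mem)

lemma tensor_ideal_ideal: "ideal (tensor_ideal C A B \<alpha> \<beta>) (pair_ring A B)"
  unfolding tensor_ideal_def by (rule P.genideal_ideal[OF tensor_relations_subset])

lemma tensor_ring_cring: "cring (tensor_ring C A B \<alpha> \<beta>)"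
  unfolding tensor_ring_def by (rule ideal.quotient_is_cring[OF tensor_ideal_ideal P.is_cring])

interpretation I: ideal "tensor_ideal C A B \<alpha> \<beta>" "pair_ring A B" by (rule tensor_ideal_ideal)

abbreviation (input) cls where "cls x \<equiv> tensor_ideal C A B \<alpha> \<beta> +>\<^bsub>pair_ring A B\<^esub> x"

lemma tensor_ring_carrier: "carrier (tensor_ring C A B \<alpha> \<beta>) = cls ` carrier (pair_ring A B)"
  by (auto simp: tensor_ring_def FactRing_def A_RCOSETS_def')

lemma cls_hom: "cls \<in> ring_hom (pair_ring A B) (tensor_ring C A B \<alpha> \<beta>)"
  unfolding tensor_ring_def by (rule I.rcos_ring_hom)

lemma cls_zero: "cls 0 = \<zero>\<^bsub>tensor_ring C A B \<alpha> \<beta>\<^esub>"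
  using ring_hom_zero[OF cls_hom P.ring_axioms cring.axioms(1)[OF tensor_ring_cring]] by simp

lemma cls_diff:
  assumes "x \<in> carrier (pair_ring A B)" "y \<in> carrier (pair_ring A B)"
  shows "cls (x - y) = cls x \<ominus>\<^bsub>tensor_ring C A B \<alpha> \<beta>\<^esub> cls y"
proof -
  interpret T: cring "tensor_ring C A B \<alpha> \<beta>" by (rule tensor_ring_cring)
  interpret h: ring_hom_ring "pair_ring A B" "tensor_ring C A B \<alpha> \<beta>" cls
    by (rule ring_hom_ringI2[OF P.ring_axioms T.ring_axioms cls_hom])
  have "x - y = x \<oplus>\<^bsub>pair_ring A B\<^esub> (\<ominus>\<^bsub>pair_ring A B\<^esub> y)" using assms by (simp add: pair_ring_uminus)
  then show ?thesis using assms by (simp only: h.hom_add h.hom_a_inv P.a_inv_closed T.minus_eq)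
qed

lemma cls_eq:
  assumes "x - y \<in> tensor_relations C A B \<alpha> \<beta>" "x \<in> carrier (pair_ring A B)" "y \<in> carrier (pair_ring A B)"
  shows "cls x = cls y"
proof -
  have "x - y \<in> tensor_ideal C A B \<alpha> \<beta>"
    using P.genideal_self[OF tensor_relations_subset] assms(1) unfolding tensor_ideal_def by blast
  then have "x \<in> cls y" unfolding a_r_coset_def' using assms by (auto intro!: bexI[of _ "x - y"])
  then show ?thesis using I.a_repr_independence'[of x y] assms by simp
qed

lemma pure_tensor_closed: "a \<in> carrier A \<Longrightarrow> b \<in> carrier B \<Longrightarrow>
    pure_tensor C A B \<alpha> \<beta> a b \<in> carrier (tensor_ring C A B \<alpha> \<beta>)"
  unfolding pure_tensor_def tensor_ring_carrier by auto

lemma pure_tensor_mult: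
  assumes "a \<in> carrier A" "b \<in> carrier B" "a' \<in> carrier A" "b' \<in> carrier B"
  shows "pure_tensor C A B \<alpha> \<beta> a b \<otimes>\<^bsub>tensor_ring C A B \<alpha> \<beta>\<^esub> pure_tensor C A B \<alpha> \<beta> a' b' =
    pure_tensor C A B \<alpha> \<beta> (a \<otimes>\<^bsub>A\<^esub> a') (b \<otimes>\<^bsub>B\<^esub> b')"
  unfolding pure_tensor_def using assms
  by (subst ring_hom_mult[OF cls_hom, symmetric]) auto

lemma pure_tensor_one: "pure_tensor C A B \<alpha> \<beta> \<one>\<^bsub>A\<^esub> \<one>\<^bsub>B\<^esub> = \<one>\<^bsub>tensor_ring C A B \<alpha> \<beta>\<^esub>"
  using ring_hom_one[OF cls_hom] by (simp add: pure_tensor_def)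

lemma pure_tensor_add1:
  assumes "a \<in> carrier A" "b \<in> carrier B" "a' \<in> carrier A"
  shows "pure_tensor C A B \<alpha> \<beta> (a \<oplus>\<^bsub>A\<^esub> a') b =
    pure_tensor C A B \<alpha> \<beta> a b \<oplus>\<^bsub>tensor_ring C A B \<alpha> \<beta>\<^esub> pure_tensor C A B \<alpha> \<beta> a' b"
proof -
  have "cls (frag_of (a \<oplus>\<^bsub>A\<^esub> a', b)) = cls (frag_of (a, b) + frag_of (a', b))"
  proof (rule cls_eq)
    show "frag_of (a \<oplus>\<^bsub>A\<^esub> a', b) - (frag_of (a, b) + frag_of (a', b)) \<in> tensor_relations C A B \<alpha> \<beta>"
      unfolding diff_diff_eq[symmetric] tensor_relations_def using assms by blast
    show "frag_of (a, b) + frag_of (a', b) \<in> carrier (pair_ring A B)"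
      using P.a_closed[of "frag_of (a, b)" "frag_of (a', b)"] assms by simp
  qed (use assms in simp)
  then show ?thesis unfolding pure_tensor_def using assms
    by (subst ring_hom_add[OF cls_hom, symmetric]) auto
qed

lemma pure_tensor_add2:
  assumes "a \<in> carrier A" "b \<in> carrier B" "b' \<in> carrier B"
  shows "pure_tensor C A B \<alpha> \<beta> a (b \<oplus>\<^bsub>B\<^esub> b') =
    pure_tensor C A B \<alpha> \<beta> a b \<oplus>\<^bsub>tensor_ring C A B \<alpha> \<beta>\<^esub> pure_tensor C A B \<alpha> \<beta> a b'"
proof -
  have "cls (frag_of (a, b \<oplus>\<^bsub>B\<^esub> b')) = cls (frag_of (a, b) + frag_of (a, b'))"
  proof (rule cls_eq)
    show "frag_of (a, b \<oplus>\<^bsub>B\<^esub> b') - (frag_of (a, b) + frag_of (a, b')) \<in> tensor_relations C A B \<alpha> \<beta>"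
      unfolding diff_diff_eq[symmetric] tensor_relations_def using assms by blast
    show "frag_of (a, b) + frag_of (a, b') \<in> carrier (pair_ring A B)"
      using P.a_closed[of "frag_of (a, b)" "frag_of (a, b')"] assms by simp
  qed (use assms in simp)
  then show ?thesis unfolding pure_tensor_def using assms
    by (subst ring_hom_add[OF cls_hom, symmetric]) auto
qed

lemma pure_tensor_base:
  assumes "c \<in> carrier C" "a \<in> carrier A" "b \<in> carrier B"
  shows "pure_tensor C A B \<alpha> \<beta> (\<alpha> c \<otimes>\<^bsub>A\<^esub> a) b = pure_tensor C A B \<alpha> \<beta> a (\<beta> c \<otimes>\<^bsub>B\<^esub> b)"
  unfolding pure_tensor_def
  by (rule cls_eq) (use assms \<alpha> \<beta> in \<open>auto simp: tensor_relations_def\<close>)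

lemma pure_tensor_hom1: "(\<lambda>a. pure_tensor C A B \<alpha> \<beta> a \<one>\<^bsub>B\<^esub>) \<in> ring_hom A (tensor_ring C A B \<alpha> \<beta>)"
  by (rule ring_hom_memI) (simp_all add: pure_tensor_closed pure_tensor_mult pure_tensor_add1 pure_tensor_one)

lemma pure_tensor_hom2: "(\<lambda>b. pure_tensor C A B \<alpha> \<beta> \<one>\<^bsub>A\<^esub> b) \<in> ring_hom B (tensor_ring C A B \<alpha> \<beta>)"
  by (rule ring_hom_memI) (simp_all add: pure_tensor_closed pure_tensor_mult pure_tensor_add2 pure_tensor_one)

text \<open>Writing a pure tensor as a product reduces it to the two ring homomorphisms out of
  \<open>A\<close> and \<open>B\<close>. This is why the two projections generate the stalks of the
  fibered product as rings.\<close>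

lemma pure_tensor_split: "a \<in> carrier A \<Longrightarrow> b \<in> carrier B \<Longrightarrow> pure_tensor C A B \<alpha> \<beta> a b =
   pure_tensor C A B \<alpha> \<beta> a \<one>\<^bsub>B\<^esub> \<otimes>\<^bsub>tensor_ring C A B \<alpha> \<beta>\<^esub> pure_tensor C A B \<alpha> \<beta> \<one>\<^bsub>A\<^esub> b"
  by (simp add: pure_tensor_mult)

lemma tensor_induct [consumes 1, case_names pure add uminus]:
  assumes "t \<in> carrier (tensor_ring C A B \<alpha> \<beta>)"
    and pure: "\<And>a b. a \<in> carrier A \<Longrightarrow> b \<in> carrier B \<Longrightarrow> P (pure_tensor C A B \<alpha> \<beta> a b)"
    and add: "\<And>s t. s \<in> carrier (tensor_ring C A B \<alpha> \<beta>) \<Longrightarrow> t \<in> carrier (tensor_ring C A B \<alpha> \<beta>) \<Longrightarrow>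
      P s \<Longrightarrow> P t \<Longrightarrow> P (s \<oplus>\<^bsub>tensor_ring C A B \<alpha> \<beta>\<^esub> t)"
    and uminus: "\<And>s. s \<in> carrier (tensor_ring C A B \<alpha> \<beta>) \<Longrightarrow> P s \<Longrightarrow> P (\<ominus>\<^bsub>tensor_ring C A B \<alpha> \<beta>\<^esub> s)"
  shows "P t"
proof -
  interpret T: cring "tensor_ring C A B \<alpha> \<beta>" by (rule tensor_ring_cring)
  obtain x where x: "x \<in> carrier (pair_ring A B)" "t = cls x"
    using assms(1) unfolding tensor_ring_carrier by auto
  have "P (cls x)" using x(1)
  proof (induction rule: pair_ring_induct)
    case zero
    \<comment> \<open>The class of the zero chain has to come from the three cases: it is 1
      \<otimes> 1 minus itself.\<close>
    let ?o = "pure_tensor C A B \<alpha> \<beta> \<one>\<^bsub>A\<^esub> \<one>\<^bsub>B\<^esub>"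
    have "P (?o \<oplus>\<^bsub>tensor_ring C A B \<alpha> \<beta>\<^esub> (\<ominus>\<^bsub>tensor_ring C A B \<alpha> \<beta>\<^esub> ?o))"
      by (intro add uminus pure) (auto simp: pure_tensor_closed)
    then show ?case by (simp add: cls_zero pure_tensor_closed T.r_neg)
  next
    case (of a b)
    then show ?case using pure by (simp add: pure_tensor_def)
  next
    case (diff x y)
    then show ?case
      using add uminus ring_hom_closed[OF cls_hom] by (simp add: cls_diff T.minus_eq)
  qed
  then show ?thesis using x(2) by simp
qed

text \<open>The kernel of \<open>h\<close> is an ideal that contains the relations, and
  \<open>tensor_ideal\<close> is the smallest such ideal.\<close>

lemma tensor_ideal_killed:
  assumes "ring D" "h \<in> ring_hom (pair_ring A B) D" "h ` tensor_relations C A B \<alpha> \<beta> \<subseteq> {\<zero>\<^bsub>D\<^esub>}"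
  shows "h ` tensor_ideal C A B \<alpha> \<beta> \<subseteq> {\<zero>\<^bsub>D\<^esub>}"
proof -
  interpret D: ring D by fact
  interpret h: ring_hom_ring "pair_ring A B" D h by (rule ring_hom_ringI2) (fact P.ring_axioms assms)+
  have "h r = \<zero>\<^bsub>D\<^esub>" if "r \<in> tensor_relations C A B \<alpha> \<beta>" for r
    using assms(3) that by (meson image_subset_iff singletonD)
  then have "tensor_relations C A B \<alpha> \<beta> \<subseteq> a_kernel (pair_ring A B) D h"
    unfolding a_kernel_def' using tensor_relations_subset by blast
  then have "tensor_ideal C A B \<alpha> \<beta> \<subseteq> a_kernel (pair_ring A B) D h"
    unfolding tensor_ideal_def by (rule P.genideal_minimal[OF h.kernel_is_ideal])
  then show ?thesis unfolding a_kernel_def' by blast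
qed

text \<open>The existence half of the universal property. The additive map comes from the universal
  property of free abelian groups, applied to the additive group of \<open>D\<close>; its
  multiplicativity is a bilinear identity, checked on pairs. The condition \<open>fg\<close> is what
  annihilates the third family of relations.\<close>

lemma tensor_lift_exists:
  assumes D: "cring D" and f: "f \<in> ring_hom A D" and g: "g \<in> ring_hom B D"
    and fg: "\<And>c. c \<in> carrier C \<Longrightarrow> f (\<alpha> c) = g (\<beta> c)"
  shows "\<exists>h \<in> ring_hom (tensor_ring C A B \<alpha> \<beta>) D.
    \<forall>a\<in>carrier A. \<forall>b\<in>carrier B. h (pure_tensor C A B \<alpha> \<beta> a b) = f a \<otimes>\<^bsub>D\<^esub> g b"
proof -
  interpret D: cring D by fact
  let ?S = "carrier A \<times> carrier B"
  have fc: "f a \<in> carrier D" if "a \<in> carrier A" for a using ring_hom_closed[OF f that] .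
  have gc: "g b \<in> carrier D" if "b \<in> carrier B" for b using ring_hom_closed[OF g that] .
  have "(\<lambda>(a, b). f a \<otimes>\<^bsub>D\<^esub> g b) ` ?S \<subseteq> carrier (add_monoid D)" using fc gc by auto
  then obtain h where h: "h \<in> hom (free_Abelian_group ?S) (add_monoid D)"
    "\<And>p. p \<in> ?S \<Longrightarrow> h (frag_of p) = (\<lambda>(a, b). f a \<otimes>\<^bsub>D\<^esub> g b) p"
    by (rule comm_group.free_Abelian_group_universal[OF D.a_comm_group]) blast
  have hc: "h x \<in> carrier D" if "x \<in> carrier (pair_ring A B)" for x
    using h(1) that unfolding hom_def pair_ring_carrier by force
  have hadd: "h (x + y) = h x \<oplus>\<^bsub>D\<^esub> h y"
    if "x \<in> carrier (pair_ring A B)" "y \<in> carrier (pair_ring A B)" for x y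
    using h(1) that unfolding hom_def pair_ring_carrier by simp
  have h0: "h 0 = \<zero>\<^bsub>D\<^esub>"
    using hadd[of 0 0] hc[of 0] by (simp add: pair_ring_carrier)
  have hdiff: "h (x - y) = h x \<ominus>\<^bsub>D\<^esub> h y"
    if "x \<in> carrier (pair_ring A B)" "y \<in> carrier (pair_ring A B)" for x y
  proof -
    have "h x = h (x - y) \<oplus>\<^bsub>D\<^esub> h y" using hadd[of "x - y" y] that by (simp add: pair_ring_diff_closed)
    then show ?thesis using that hc[of "x - y"] hc
      by (simp add: pair_ring_diff_closed D.minus_eq D.a_assoc D.r_neg)
  qed
  have hof: "h (frag_of (a, b)) = f a \<otimes>\<^bsub>D\<^esub> g b" if "a \<in> carrier A" "b \<in> carrier B" for a b
    using h(2)[of "(a, b)"] that by simp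
  have hmult1: "h (frag_of (a, b) \<otimes>\<^bsub>pair_ring A B\<^esub> y) = (f a \<otimes>\<^bsub>D\<^esub> g b) \<otimes>\<^bsub>D\<^esub> h y"
    if "a \<in> carrier A" "b \<in> carrier B" "y \<in> carrier (pair_ring A B)" for a b y
    using that(3)
  proof (induction rule: pair_ring_induct)
    case (of a' b')
    then show ?case using that fc gc
      by (simp add: hof ring_hom_mult[OF f] ring_hom_mult[OF g] D.m_ac)
  next
    case (diff x y)
    then show ?case using that fc gc
      by (simp add: hdiff hc D.minus_eq D.r_distr D.r_minus del: pair_ring_mult_of)
  qed (use that fc gc in \<open>simp add: h0\<close>)
  have hmult: "h (x \<otimes>\<^bsub>pair_ring A B\<^esub> y) = h x \<otimes>\<^bsub>D\<^esub> h y"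
    if "x \<in> carrier (pair_ring A B)" "y \<in> carrier (pair_ring A B)" for x y
    using that(1)
  proof (induction rule: pair_ring_induct)
    case (diff x' x'')
    then show ?case using that
      by (simp add: hdiff hc D.minus_eq D.l_distr D.l_minus)
  qed (use that hc in \<open>simp_all add: h0 hof hmult1\<close>)
  have hom: "h \<in> ring_hom (pair_ring A B) D"
    by (rule ring_hom_memI)
      (use hc hmult hadd hof in \<open>simp_all add: ring_hom_one[OF f] ring_hom_one[OF g]\<close>)
  have cancel: "x \<oplus>\<^bsub>D\<^esub> (y \<oplus>\<^bsub>D\<^esub> (\<ominus>\<^bsub>D\<^esub> x \<oplus>\<^bsub>D\<^esub> \<ominus>\<^bsub>D\<^esub> y)) = \<zero>\<^bsub>D\<^esub>"
    if "x \<in> carrier D" "y \<in> carrier D" for x y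
    using that D.r_neg[of "x \<oplus>\<^bsub>D\<^esub> y"] D.a_assoc[of x y "\<ominus>\<^bsub>D\<^esub> x \<oplus>\<^bsub>D\<^esub> \<ominus>\<^bsub>D\<^esub> y"]
    by (simp add: D.minus_add)
  have "h ` tensor_relations C A B \<alpha> \<beta> \<subseteq> {\<zero>\<^bsub>D\<^esub>}"
    unfolding tensor_relations_def using fc gc \<alpha> \<beta>
    by (auto simp: hdiff hof pair_ring_diff_closed ring_hom_add[OF f] ring_hom_add[OF g]
        ring_hom_mult[OF f] ring_hom_mult[OF g] fg D.l_distr D.r_distr D.minus_eq D.minus_add D.r_neg
        D.a_ac D.m_ac Pi_iff cancel)
  then have kill: "h ` tensor_ideal C A B \<alpha> \<beta> \<subseteq> {\<zero>\<^bsub>D\<^esub>}"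
    by (rule tensor_ideal_killed[OF D.ring_axioms hom])
  show ?thesis
  proof (intro bexI ballI)
    show "(\<lambda>c. the_elem (h ` c)) \<in> ring_hom (tensor_ring C A B \<alpha> \<beta>) D"
      unfolding tensor_ring_def by (rule quotient_lift_hom[OF tensor_ideal_ideal D.ring_axioms hom kill])
    fix a b assume "a \<in> carrier A" "b \<in> carrier B"
    then show "the_elem (h ` pure_tensor C A B \<alpha> \<beta> a b) = f a \<otimes>\<^bsub>D\<^esub> g b"
      unfolding pure_tensor_def
      by (simp add: image_the_elem_quotient[OF tensor_ideal_ideal D.ring_axioms hom kill] hof)
  qed
qed

end

section \<open>Germs\<close>

locale presheaf_on =
  fixes T :: "'a topology" and F :: "('a, 'r) presheaf"
  assumes presheaf: "is_presheaf T F"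
begin

abbreviation "sec U \<equiv> carrier (sections F U)"
abbreviation "germ \<equiv> germ_of T F"
abbreviation "germs \<equiv> germ_ring T F"

definition nbhd :: "'a set \<Rightarrow> 'a set \<Rightarrow> bool" where
  "nbhd A U \<longleftrightarrow> openin T U \<and> A \<subseteq> U"

lemma nbhd_Int: "nbhd A U \<Longrightarrow> nbhd A V \<Longrightarrow> nbhd A (U \<inter> V)"
  by (auto simp: nbhd_def)

lemma nbhd_mono: "nbhd A U \<Longrightarrow> B \<subseteq> A \<Longrightarrow> nbhd B U"
  by (auto simp: nbhd_def)

lemma nbhd_open: "nbhd A U \<Longrightarrow> openin T U"
  by (auto simp: nbhd_def)

lemma nbhd_topspace: "A \<subseteq> topspace T \<Longrightarrow> nbhd A (topspace T)"
  by (auto simp: nbhd_def)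

lemma sections_cring: "openin T U \<Longrightarrow> cring (sections F U)"
  using presheaf by (auto simp: is_presheaf_def)

lemma res_hom: "openin T U \<Longrightarrow> openin T V \<Longrightarrow> V \<subseteq> U \<Longrightarrow> res F U V \<in> ring_hom (sections F U) (sections F V)"
  using presheaf by (auto simp: is_presheaf_def)

lemma res_closed: "openin T U \<Longrightarrow> openin T V \<Longrightarrow> V \<subseteq> U \<Longrightarrow> s \<in> sec U \<Longrightarrow> res F U V s \<in> sec V"
  using res_hom ring_hom_closed by fast

lemma res_id: "openin T U \<Longrightarrow> s \<in> sec U \<Longrightarrow> res F U U s = s"
  using presheaf by (auto simp: is_presheaf_def)

lemma res_res: "openin T U \<Longrightarrow> openin T V \<Longrightarrow> openin T W \<Longrightarrow> W \<subseteq> V \<Longrightarrow> V \<subseteq> U \<Longrightarrow> s \<in> sec U \<Longrightarrow>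
    res F V W (res F U V s) = res F U W s"
  using presheaf unfolding is_presheaf_def by blast

text \<open>Agreement on some smaller neighbourhood is an equivalence relation on pairs, and the
  germs are its classes.\<close>

lemma germ_eq_iff:
  assumes "nbhd A U" "s \<in> sec U" "nbhd A V" "t \<in> sec V"
  shows "germ A U s = germ A V t \<longleftrightarrow> (\<exists>W. nbhd A W \<and> W \<subseteq> U \<inter> V \<and> res F U W s = res F V W t)"
proof
  assume "germ A U s = germ A V t"
  moreover have "(V, t) \<in> germ A V t" using assms by (auto simp: germ_of_def nbhd_def)
  ultimately have "(V, t) \<in> germ A U s" by simp
  then show "\<exists>W. nbhd A W \<and> W \<subseteq> U \<inter> V \<and> res F U W s = res F V W t"
    by (auto simp: germ_of_def nbhd_def)
next
  \<comment> \<open>One inclusion suffices, by symmetry in the two pairs. A pair that agrees with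
    \<open>(V, t)\<close> on \<open>W'\<close> agrees with \<open>(U, s)\<close> on
    \<open>W \<inter> W'\<close>, which is transitivity.\<close>
  have *: "germ A V t \<subseteq> germ A U s" if st: "nbhd A U" "s \<in> sec U" "nbhd A V" "t \<in> sec V"
    and ex: "\<exists>W. nbhd A W \<and> W \<subseteq> U \<inter> V \<and> res F U W s = res F V W t" for U V s t
  proof (clarsimp simp: germ_of_def)
    fix V' t' W'
    assume V': "openin T V'" "A \<subseteq> V'" "t' \<in> sec V'"
      and W': "openin T W'" "A \<subseteq> W'" "W' \<subseteq> V" "W' \<subseteq> V'" "res F V W' t = res F V' W' t'"
    obtain W where W: "nbhd A W" "W \<subseteq> U \<inter> V" "res F U W s = res F V W t" using ex by blast
    have o: "openin T U" "openin T V" "openin T W" "openin T (W \<inter> W')"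
      using st W(1) W'(1) by (auto simp: nbhd_def)
    have "res F U (W \<inter> W') s = res F W (W \<inter> W') (res F U W s)"
      using o W st by (subst res_res) auto
    also have "\<dots> = res F V (W \<inter> W') t" unfolding W(3) using o W st by (subst res_res) auto
    also have "\<dots> = res F W' (W \<inter> W') (res F V W' t)" using o W' st by (subst res_res) auto
    also have "\<dots> = res F V' (W \<inter> W') t'" unfolding W'(5) using o W' V' by (subst res_res) auto
    finally show "\<exists>W. openin T W \<and> A \<subseteq> W \<and> W \<subseteq> U \<and> W \<subseteq> V' \<and> res F U W s = res F V' W t'"
      using o W W' by (intro exI[of _ "W \<inter> W'"]) (auto simp: nbhd_def)
  qed
  assume ex: "\<exists>W. nbhd A W \<and> W \<subseteq> U \<inter> V \<and> res F U W s = res F V W t"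
  then have "\<exists>W. nbhd A W \<and> W \<subseteq> V \<inter> U \<and> res F V W t = res F U W s" by (metis Int_commute)
  then show "germ A U s = germ A V t" using * ex assms by (simp add: subset_antisym)
qed

lemma germ_eqI:
  assumes "nbhd A U" "s \<in> sec U" "nbhd A V" "t \<in> sec V" "nbhd A W" "W \<subseteq> U" "W \<subseteq> V"
    "res F U W s = res F V W t"
  shows "germ A U s = germ A V t"
  using assms germ_eq_iff[of A U s V t] by blast

lemma germ_mem_iff:
  assumes "nbhd A U" "s \<in> sec U"
  shows "(V, t) \<in> germ A U s \<longleftrightarrow> nbhd A V \<and> t \<in> sec V \<and> germ A V t = germ A U s"
proof -
  have "(V, t) \<in> germ A U s \<longleftrightarrow> nbhd A V \<and> t \<in> sec V \<and>
      (\<exists>W. nbhd A W \<and> W \<subseteq> U \<inter> V \<and> res F U W s = res F V W t)"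
    by (auto simp: germ_of_def nbhd_def)
  then show ?thesis using germ_eq_iff[OF assms, of V t] by metis
qed

lemma germ_self: "nbhd A U \<Longrightarrow> s \<in> sec U \<Longrightarrow> (U, s) \<in> germ A U s"
  by (simp add: germ_mem_iff)

lemma germ_res:
  assumes "nbhd A U" "s \<in> sec U" "nbhd A W" "W \<subseteq> U"
  shows "germ A W (res F U W s) = germ A U s"
  using assms by (intro germ_eqI[of _ _ _ _ _ W]) (auto simp: nbhd_def res_closed res_id)

text \<open>The operations on germs are written as unions over all representatives. When the term
  does not depend on the representative the union is that term, because a germ is never
  empty.\<close>

lemma germ_UN:
  assumes "nbhd A U" "s \<in> sec U"
    and "\<And>V t. nbhd A V \<Longrightarrow> t \<in> sec V \<Longrightarrow> germ A V t = germ A U s \<Longrightarrow> \<phi> V t = c"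
  shows "(\<Union>(V, t) \<in> germ A U s. \<phi> V t) = c"
proof -
  have "\<phi> (fst p) (snd p) = c" if "p \<in> germ A U s" for p
    using that assms(3) germ_mem_iff[OF assms(1,2), of "fst p" "snd p"] by auto
  then show ?thesis using germ_self[OF assms(1,2)] by (auto simp: split_def)
qed

lemma germ_closed: "nbhd A U \<Longrightarrow> s \<in> sec U \<Longrightarrow> germ A U s \<in> carrier (germs A)"
  by (auto simp: germ_ring_def nbhd_def)

lemma germ_cases:
  assumes "c \<in> carrier (germs A)"
  obtains U s where "nbhd A U" "s \<in> sec U" "c = germ A U s"
  using assms by (auto simp: germ_ring_def nbhd_def)

text \<open>Germs along one set have representatives over one open set: the intersection of their
  neighbourhoods.\<close>

lemma germ_cases2:
  assumes "c \<in> carrier (germs A)" "d \<in> carrier (germs A)"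
  obtains U s t where "nbhd A U" "s \<in> sec U" "t \<in> sec U" "c = germ A U s" "d = germ A U t"
proof -
  obtain U s where U: "nbhd A U" "s \<in> sec U" "c = germ A U s" by (rule germ_cases[OF assms(1)])
  obtain V t where V: "nbhd A V" "t \<in> sec V" "d = germ A V t" by (rule germ_cases[OF assms(2)])
  have e: "c = germ A (U \<inter> V) (res F U (U \<inter> V) s)" "d = germ A (U \<inter> V) (res F V (U \<inter> V) t)"
    using U V nbhd_Int[of A U V] by (auto simp: germ_res)
  have r: "res F U (U \<inter> V) s \<in> sec (U \<inter> V)" "res F V (U \<inter> V) t \<in> sec (U \<inter> V)"
    using U V by (auto simp: nbhd_def intro!: res_closed)
  show thesis by (rule that[OF nbhd_Int[OF U(1) V(1)] r e])
qed

lemma germ_cases3: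
  assumes "c \<in> carrier (germs A)" "d \<in> carrier (germs A)" "e \<in> carrier (germs A)"
  obtains U s t u where "nbhd A U" "s \<in> sec U" "t \<in> sec U" "u \<in> sec U"
    "c = germ A U s" "d = germ A U t" "e = germ A U u"
proof -
  obtain U s t where U: "nbhd A U" "s \<in> sec U" "t \<in> sec U" "c = germ A U s" "d = germ A U t"
    by (rule germ_cases2[OF assms(1,2)])
  obtain V u where V: "nbhd A V" "u \<in> sec V" "e = germ A V u" by (rule germ_cases[OF assms(3)])
  have e: "c = germ A (U \<inter> V) (res F U (U \<inter> V) s)" "d = germ A (U \<inter> V) (res F U (U \<inter> V) t)"
    "e = germ A (U \<inter> V) (res F V (U \<inter> V) u)"
    using U V nbhd_Int[of A U V] by (auto simp: germ_res)
  have r: "res F U (U \<inter> V) s \<in> sec (U \<inter> V)" "res F U (U \<inter> V) t \<in> sec (U \<inter> V)"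
    "res F V (U \<inter> V) u \<in> sec (U \<inter> V)"
    using U V by (auto simp: nbhd_def intro!: res_closed)
  show thesis by (rule that[OF nbhd_Int[OF U(1) V(1)] r e])
qed

text \<open>One argument serves for addition and multiplication: an operation on sections that
  commutes with restriction descends to germs.\<close>

lemma germ_binop:
  assumes op: "\<And>U V s t. openin T U \<Longrightarrow> openin T V \<Longrightarrow> V \<subseteq> U \<Longrightarrow> s \<in> sec U \<Longrightarrow> t \<in> sec U \<Longrightarrow>
      op U s t \<in> sec U \<and> res F U V (op U s t) = op V (res F U V s) (res F U V t)"
    and U: "nbhd A U" "s \<in> sec U" "t \<in> sec U"
  shows "(\<Union>(V, s') \<in> germ A U s. \<Union>(W, t') \<in> germ A U t.
      germ A (V \<inter> W) (op (V \<inter> W) (res F V (V \<inter> W) s') (res F W (V \<inter> W) t'))) = germ A U (op U s t)"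
proof (rule germ_UN[OF U(1,2)], rule germ_UN[OF U(1,3)])
  fix V s' W t' assume V: "nbhd A V" "s' \<in> sec V" "germ A V s' = germ A U s"
    and W: "nbhd A W" "t' \<in> sec W" "germ A W t' = germ A U t"
  \<comment> \<open>On \<open>V'\<close> the representative \<open>s'\<close> agrees with
    \<open>s\<close>, and on the set \<open>W'\<close> obtained next \<open>t'\<close> agrees with
    \<open>t\<close>; the two results are compared on \<open>V' \<inter> W'\<close>.\<close>
  obtain V' where V': "nbhd A V'" "V' \<subseteq> V \<inter> U" "res F V V' s' = res F U V' s"
    using germ_eq_iff[OF V(1,2) U(1,2)] V(3) by auto
  obtain W' where W': "nbhd A W'" "W' \<subseteq> W \<inter> U" "res F W W' t' = res F U W' t"
    using germ_eq_iff[OF W(1,2) U(1,3)] W(3) by auto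
  note o = nbhd_open[OF U(1)] nbhd_open[OF V(1)] nbhd_open[OF W(1)] nbhd_open[OF V'(1)] nbhd_open[OF W'(1)]
  have o': "openin T (V \<inter> W)" "openin T (V' \<inter> W')" using o by auto
  have r: "res F V (V \<inter> W) s' \<in> sec (V \<inter> W)" "res F W (V \<inter> W) t' \<in> sec (V \<inter> W)"
    using o o' V W by (auto intro!: res_closed)
  have s: "res F V (V' \<inter> W') s' = res F U (V' \<inter> W') s"
    using arg_cong[OF V'(3), of "res F V' (V' \<inter> W')"] o o' V(2) V'(2) U(2) by (auto simp: res_res)
  have t: "res F W (V' \<inter> W') t' = res F U (V' \<inter> W') t"
    using arg_cong[OF W'(3), of "res F W' (V' \<inter> W')"] o o' W(2) W'(2) U(3) by (auto simp: res_res)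
  have sub: "V' \<inter> W' \<subseteq> V \<inter> W" using V' W' by auto
  show "germ A (V \<inter> W) (op (V \<inter> W) (res F V (V \<inter> W) s') (res F W (V \<inter> W) t')) = germ A U (op U s t)"
  proof (rule germ_eqI[of _ _ _ _ _ "V' \<inter> W'"])
    have "res F (V \<inter> W) (V' \<inter> W') (op (V \<inter> W) (res F V (V \<inter> W) s') (res F W (V \<inter> W) t')) =
       op (V' \<inter> W') (res F V (V' \<inter> W') s') (res F W (V' \<inter> W') t')"
      using op[OF o'(1,2) sub r] o o' V(2) W(2) sub by (simp add: res_res)
    then show "res F (V \<inter> W) (V' \<inter> W') (op (V \<inter> W) (res F V (V \<inter> W) s') (res F W (V \<inter> W) t')) =
       res F U (V' \<inter> W') (op U s t)"
      unfolding s t using op[OF o(1) o'(2) _ U(2,3)] V'(2) by (metis Int_subset_iff le_infI1)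
  qed (use U V W V' W' nbhd_Int op[OF o(1) o(1) _ U(2,3)] op[OF o'(1) o'(1) _ r] in auto)
qed

lemma germ_mult:
  assumes "nbhd A U" "s \<in> sec U" "t \<in> sec U"
  shows "germ A U s \<otimes>\<^bsub>germs A\<^esub> germ A U t = germ A U (s \<otimes>\<^bsub>sections F U\<^esub> t)"
  unfolding germ_ring_def monoid.simps
  by (rule germ_binop[where op = "\<lambda>U s t. s \<otimes>\<^bsub>sections F U\<^esub> t"])
    (use assms in \<open>auto intro!: ring_hom_mult[OF res_hom] ring.ring_simprules cring.axioms(1) sections_cring\<close>)

lemma germ_add:
  assumes "nbhd A U" "s \<in> sec U" "t \<in> sec U"
  shows "germ A U s \<oplus>\<^bsub>germs A\<^esub> germ A U t = germ A U (s \<oplus>\<^bsub>sections F U\<^esub> t)"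
  unfolding germ_ring_def ring_record_simps
  by (rule germ_binop[where op = "\<lambda>U s t. s \<oplus>\<^bsub>sections F U\<^esub> t"])
    (use assms in \<open>auto intro!: ring_hom_add[OF res_hom] ring.ring_simprules cring.axioms(1) sections_cring\<close>)

lemma germ_one:
  assumes "nbhd A U"
  shows "germ A U \<one>\<^bsub>sections F U\<^esub> = \<one>\<^bsub>germs A\<^esub>"
proof -
  have o: "openin T U" "openin T (topspace T)" "U \<subseteq> topspace T" "A \<subseteq> topspace T"
    using assms openin_subset[of T U] by (auto simp: nbhd_def)
  interpret X: cring "sections F (topspace T)" by (rule sections_cring) simp
  have "germ A U (res F (topspace T) U \<one>\<^bsub>sections F (topspace T)\<^esub>) = \<one>\<^bsub>germs A\<^esub>"
    using o assms by (simp add: germ_res nbhd_def germ_ring_def)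
  then show ?thesis using ring_hom_one[OF res_hom[OF o(2,1,3)]] by simp
qed

lemma germ_zero:
  assumes "nbhd A U"
  shows "germ A U \<zero>\<^bsub>sections F U\<^esub> = \<zero>\<^bsub>germs A\<^esub>"
proof -
  have o: "openin T U" "openin T (topspace T)" "U \<subseteq> topspace T" "A \<subseteq> topspace T"
    using assms openin_subset[of T U] by (auto simp: nbhd_def)
  interpret X: cring "sections F (topspace T)" by (rule sections_cring) simp
  interpret U: cring "sections F U" by (rule sections_cring) (use o in simp)
  have "germ A U (res F (topspace T) U \<zero>\<^bsub>sections F (topspace T)\<^esub>) = \<zero>\<^bsub>germs A\<^esub>"
    using o assms by (simp add: germ_res nbhd_def germ_ring_def)
  then show ?thesis using ring_hom_zero[OF res_hom[OF o(2,1,3)] X.ring_axioms U.ring_axioms] by simp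
qed

text \<open>Each axiom involves at most three germs. They have representatives over a common
  neighbourhood, where the axiom is one of the ring of sections.\<close>

lemma germ_ring_cring:
  assumes A: "A \<subseteq> topspace T"
  shows "cring (germs A)"
proof -
  note cr = sections_cring[OF nbhd_open]
  note r = cring.axioms(1)[OF cr]
  have X: "nbhd A (topspace T)" using A by (rule nbhd_topspace)
  have one: "\<one>\<^bsub>germs A\<^esub> \<in> carrier (germs A)"
    using germ_closed[OF X ring.ring_simprules(6)[OF r[OF X]]] germ_one[OF X] by simp
  have zero: "\<zero>\<^bsub>germs A\<^esub> \<in> carrier (germs A)"
    using germ_closed[OF X ring.ring_simprules(2)[OF r[OF X]]] germ_zero[OF X] by simp
  have add_closed: "x \<oplus>\<^bsub>germs A\<^esub> y \<in> carrier (germs A)" if "x \<in> carrier (germs A)" "y \<in> carrier (germs A)" for x y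
    using that by (rule germ_cases2) (simp add: germ_add germ_closed ring.ring_simprules(1)[OF r])
  have mult_closed: "x \<otimes>\<^bsub>germs A\<^esub> y \<in> carrier (germs A)" if "x \<in> carrier (germs A)" "y \<in> carrier (germs A)" for x y
    using that by (rule germ_cases2) (simp add: germ_mult germ_closed ring.ring_simprules(5)[OF r])
  show ?thesis
  proof (rule cringI)
    show "abelian_group (germs A)"
    proof (rule abelian_groupI)
      fix x y z assume x: "x \<in> carrier (germs A)" and y: "y \<in> carrier (germs A)" and z: "z \<in> carrier (germs A)"
      show "x \<oplus>\<^bsub>germs A\<^esub> y \<oplus>\<^bsub>germs A\<^esub> z = x \<oplus>\<^bsub>germs A\<^esub> (y \<oplus>\<^bsub>germs A\<^esub> z)"
        using x y z by (rule germ_cases3) (simp add: germ_add ring.ring_simprules(1,7)[OF r])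
    next
      fix x y assume x: "x \<in> carrier (germs A)" and y: "y \<in> carrier (germs A)"
      show "x \<oplus>\<^bsub>germs A\<^esub> y = y \<oplus>\<^bsub>germs A\<^esub> x"
        using x y by (rule germ_cases2) (simp add: germ_add ring.ring_simprules(10)[OF r])
    next
      fix x assume "x \<in> carrier (germs A)"
      then obtain U s where U: "nbhd A U" "s \<in> sec U" "x = germ A U s" by (rule germ_cases)
      show "\<zero>\<^bsub>germs A\<^esub> \<oplus>\<^bsub>germs A\<^esub> x = x"
        using U ring.ring_simprules(2,8)[OF r[OF U(1)]]
        by (simp add: germ_add flip: germ_zero[OF U(1)])
      have "germ A U (\<ominus>\<^bsub>sections F U\<^esub> s) \<oplus>\<^bsub>germs A\<^esub> x = \<zero>\<^bsub>germs A\<^esub>"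
        using U ring.ring_simprules(2,3,9)[OF r[OF U(1)]]
        by (simp add: germ_add flip: germ_zero[OF U(1)])
      then show "\<exists>y\<in>carrier (germs A). y \<oplus>\<^bsub>germs A\<^esub> x = \<zero>\<^bsub>germs A\<^esub>"
        using germ_closed[OF U(1) ring.ring_simprules(3)[OF r[OF U(1)] U(2)]] by blast
    qed (use add_closed zero in auto)
    show "comm_monoid (germs A)"
    proof (rule comm_monoidI)
      fix x y z assume x: "x \<in> carrier (germs A)" and y: "y \<in> carrier (germs A)" and z: "z \<in> carrier (germs A)"
      show "x \<otimes>\<^bsub>germs A\<^esub> y \<otimes>\<^bsub>germs A\<^esub> z = x \<otimes>\<^bsub>germs A\<^esub> (y \<otimes>\<^bsub>germs A\<^esub> z)"
        using x y z by (rule germ_cases3) (simp add: germ_mult ring.ring_simprules(5,11)[OF r])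
    next
      fix x y assume x: "x \<in> carrier (germs A)" and y: "y \<in> carrier (germs A)"
      show "x \<otimes>\<^bsub>germs A\<^esub> y = y \<otimes>\<^bsub>germs A\<^esub> x"
        using x y by (rule germ_cases2) (simp add: germ_mult cring.cring_simprules(14)[OF cr])
    next
      fix x assume "x \<in> carrier (germs A)"
      then obtain U s where U: "nbhd A U" "s \<in> sec U" "x = germ A U s" by (rule germ_cases)
      show "\<one>\<^bsub>germs A\<^esub> \<otimes>\<^bsub>germs A\<^esub> x = x"
        using U ring.ring_simprules(6,12)[OF r[OF U(1)]]
        by (simp add: germ_mult flip: germ_one[OF U(1)])
    qed (use mult_closed one in auto)
    fix x y z assume x: "x \<in> carrier (germs A)" and y: "y \<in> carrier (germs A)" and z: "z \<in> carrier (germs A)"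
    show "(x \<oplus>\<^bsub>germs A\<^esub> y) \<otimes>\<^bsub>germs A\<^esub> z = x \<otimes>\<^bsub>germs A\<^esub> z \<oplus>\<^bsub>germs A\<^esub> y \<otimes>\<^bsub>germs A\<^esub> z"
      using x y z by (rule germ_cases3)
        (simp add: germ_mult germ_add ring.ring_simprules(1,5,13)[OF r])
  qed
qed

lemma germ_hom: "nbhd A U \<Longrightarrow> germ A U \<in> ring_hom (sections F U) (germs A)"
  by (rule ring_hom_memI) (simp_all add: germ_closed germ_mult germ_add germ_one)

text \<open>For maps that are already given, such as those defined by unions over representatives:
  it is enough that on each neighbourhood a homomorphism computes them.\<close>

lemma germ_ring_homI:
  assumes A: "A \<subseteq> topspace T"
    and \<phi>: "\<And>U. nbhd A U \<Longrightarrow> \<phi> U \<in> ring_hom (sections F U) D"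
    and h: "\<And>U s. nbhd A U \<Longrightarrow> s \<in> sec U \<Longrightarrow> h (germ A U s) = \<phi> U s"
  shows "h \<in> ring_hom (germs A) D"
proof (rule ring_hom_memI)
  note r = cring.axioms(1)[OF sections_cring[OF nbhd_open]]
  fix x assume "x \<in> carrier (germs A)"
  then show "h x \<in> carrier D" by (rule germ_cases) (simp add: h ring_hom_closed[OF \<phi>])
next
  note r = cring.axioms(1)[OF sections_cring[OF nbhd_open]]
  fix x y assume xy: "x \<in> carrier (germs A)" "y \<in> carrier (germs A)"
  show "h (x \<otimes>\<^bsub>germs A\<^esub> y) = h x \<otimes>\<^bsub>D\<^esub> h y"
    using xy by (rule germ_cases2) (simp add: h germ_mult ring.ring_simprules(5)[OF r] ring_hom_mult[OF \<phi>])
  show "h (x \<oplus>\<^bsub>germs A\<^esub> y) = h x \<oplus>\<^bsub>D\<^esub> h y"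
    using xy by (rule germ_cases2) (simp add: h germ_add ring.ring_simprules(1)[OF r] ring_hom_add[OF \<phi>])
next
  note r = cring.axioms(1)[OF sections_cring[OF nbhd_open]]
  note X = nbhd_topspace[OF A]
  show "h \<one>\<^bsub>germs A\<^esub> = \<one>\<^bsub>D\<^esub>"
    using h[OF X ring.ring_simprules(6)[OF r[OF X]]] ring_hom_one[OF \<phi>[OF X]] germ_one[OF X] by simp
qed

text \<open>The universal property of the colimit. The target is an arbitrary ring, whose elements
  need not be sets, so the value is taken at a chosen representative instead of as a union;
  compatibility with restriction makes it independent of the choice.\<close>

lemma germ_lift_exists:
  assumes A: "A \<subseteq> topspace T"
    and \<phi>: "\<And>U. nbhd A U \<Longrightarrow> \<phi> U \<in> ring_hom (sections F U) D"
    and compat: "\<And>U V s. nbhd A U \<Longrightarrow> nbhd A V \<Longrightarrow> V \<subseteq> U \<Longrightarrow> s \<in> sec U \<Longrightarrow> \<phi> V (res F U V s) = \<phi> U s"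
  shows "\<exists>h \<in> ring_hom (germs A) D. \<forall>U s. nbhd A U \<longrightarrow> s \<in> sec U \<longrightarrow> h (germ A U s) = \<phi> U s"
proof -
  define h where "h c = (let p = SOME p. p \<in> c in \<phi> (fst p) (snd p))" for c
  have h: "h (germ A U s) = \<phi> U s" if U: "nbhd A U" "s \<in> sec U" for U s
  proof -
    obtain V t where p: "(SOME p. p \<in> germ A U s) = (V, t)" by (cases "SOME p. p \<in> germ A U s")
    then have "(V, t) \<in> germ A U s" using germ_self[OF U] by (metis someI)
    then have V: "nbhd A V" "t \<in> sec V" "germ A V t = germ A U s" using germ_mem_iff[OF U] by auto
    then obtain W where W: "nbhd A W" "W \<subseteq> V \<inter> U" "res F V W t = res F U W s"
      using germ_eq_iff[OF V(1,2) U] by blast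
    then have "\<phi> V t = \<phi> U s" using compat[OF V(1) W(1) _ V(2)] compat[OF U(1) W(1) _ U(2)] by auto
    then show ?thesis by (simp add: h_def p)
  qed
  then show ?thesis using germ_ring_homI[OF A \<phi> h] by blast
qed

end

section \<open>Sheaves of functions and sheafification\<close>

lemma pointwise_ring_simps [simp]:
  "carrier (pointwise_ring U R C) = C"
  "s \<otimes>\<^bsub>pointwise_ring U R C\<^esub> t = (\<lambda>x\<in>U. s x \<otimes>\<^bsub>R x\<^esub> t x)"
  "s \<oplus>\<^bsub>pointwise_ring U R C\<^esub> t = (\<lambda>x\<in>U. s x \<oplus>\<^bsub>R x\<^esub> t x)"
  "\<one>\<^bsub>pointwise_ring U R C\<^esub> = (\<lambda>x\<in>U. \<one>\<^bsub>R x\<^esub>)"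
  "\<zero>\<^bsub>pointwise_ring U R C\<^esub> = (\<lambda>x\<in>U. \<zero>\<^bsub>R x\<^esub>)"
  by (simp_all add: pointwise_ring_def)

lemma pointwise_ring_cring:
  assumes R: "\<And>x. x \<in> U \<Longrightarrow> cring (R x)"
    and C: "C \<subseteq> (\<Pi>\<^sub>E x\<in>U. carrier (R x))"
    and one: "(\<lambda>x\<in>U. \<one>\<^bsub>R x\<^esub>) \<in> C"
    and add: "\<And>s t. s \<in> C \<Longrightarrow> t \<in> C \<Longrightarrow> (\<lambda>x\<in>U. s x \<oplus>\<^bsub>R x\<^esub> t x) \<in> C"
    and mult: "\<And>s t. s \<in> C \<Longrightarrow> t \<in> C \<Longrightarrow> (\<lambda>x\<in>U. s x \<otimes>\<^bsub>R x\<^esub> t x) \<in> C"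
    and uminus: "\<And>s. s \<in> C \<Longrightarrow> (\<lambda>x\<in>U. \<ominus>\<^bsub>R x\<^esub> s x) \<in> C"
  shows "cring (pointwise_ring U R C)"
proof -
  have c: "s x \<in> carrier (R x)" if "s \<in> C" "x \<in> U" for s x using C that by blast
  have e: "s \<in> extensional U" if "s \<in> C" for s using C that by (auto simp: PiE_def)
  note r = cring.cring_simprules[OF R]
  have zero: "(\<lambda>x\<in>U. \<zero>\<^bsub>R x\<^esub>) \<in> C"
  proof -
    \<comment> \<open>Membership of zero is obtained as 1 + (-1).\<close>
    have "(\<lambda>x\<in>U. (\<lambda>x\<in>U. \<one>\<^bsub>R x\<^esub>) x \<oplus>\<^bsub>R x\<^esub> (\<lambda>x\<in>U. \<ominus>\<^bsub>R x\<^esub> (\<lambda>x\<in>U. \<one>\<^bsub>R x\<^esub>) x) x) \<in> C"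
      by (intro add one uminus)
    also have "(\<lambda>x\<in>U. (\<lambda>x\<in>U. \<one>\<^bsub>R x\<^esub>) x \<oplus>\<^bsub>R x\<^esub> (\<lambda>x\<in>U. \<ominus>\<^bsub>R x\<^esub> (\<lambda>x\<in>U. \<one>\<^bsub>R x\<^esub>) x) x) = (\<lambda>x\<in>U. \<zero>\<^bsub>R x\<^esub>)"
      by (rule restrict_ext) (simp add: r)
    finally show ?thesis .
  qed
  show ?thesis
  proof (rule cringI)
    show "abelian_group (pointwise_ring U R C)"
    proof (rule abelian_groupI)
      fix s assume s: "s \<in> carrier (pointwise_ring U R C)"
      show "\<zero>\<^bsub>pointwise_ring U R C\<^esub> \<oplus>\<^bsub>pointwise_ring U R C\<^esub> s = s"
        using s e by (auto intro!: extensionalityI[of _ U] simp: r c)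
      show "\<exists>t\<in>carrier (pointwise_ring U R C). t \<oplus>\<^bsub>pointwise_ring U R C\<^esub> s = \<zero>\<^bsub>pointwise_ring U R C\<^esub>"
        using s by (intro bexI[of _ "\<lambda>x\<in>U. \<ominus>\<^bsub>R x\<^esub> s x"]) (auto intro!: restrict_ext uminus simp: r c)
    qed (auto simp: zero add intro!: restrict_ext simp: r c)
    show "comm_monoid (pointwise_ring U R C)"
    proof (rule comm_monoidI)
      fix s assume s: "s \<in> carrier (pointwise_ring U R C)"
      show "\<one>\<^bsub>pointwise_ring U R C\<^esub> \<otimes>\<^bsub>pointwise_ring U R C\<^esub> s = s"
        using s e by (auto intro!: extensionalityI[of _ U] simp: r(12) c)
    next
      fix s t assume "s \<in> carrier (pointwise_ring U R C)" "t \<in> carrier (pointwise_ring U R C)"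
      then show "s \<otimes>\<^bsub>pointwise_ring U R C\<^esub> t = t \<otimes>\<^bsub>pointwise_ring U R C\<^esub> s"
        by (auto intro!: restrict_ext r(14) simp: c)
    qed (auto simp: one mult intro!: restrict_ext simp: r c)
  qed (auto intro!: restrict_ext simp: r c)
qed

text \<open>Functions with values in given rings glue uniquely; what is asked of the condition
  \<open>C\<close> is that it is local and stable under restriction and the ring operations.
  Sheafifications and the structure sheaf of the spectrum of a field have this form.\<close>

lemma local_function_sheaf:
  assumes R: "\<And>x. x \<in> topspace T \<Longrightarrow> cring (R x)"
    and C: "\<And>U. openin T U \<Longrightarrow> C U \<subseteq> (\<Pi>\<^sub>E x\<in>U. carrier (R x))"
    and restr: "\<And>U V s. openin T U \<Longrightarrow> openin T V \<Longrightarrow> V \<subseteq> U \<Longrightarrow> s \<in> C U \<Longrightarrow> restrict s V \<in> C V"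
    and locality: "\<And>U s. openin T U \<Longrightarrow> s \<in> (\<Pi>\<^sub>E x\<in>U. carrier (R x)) \<Longrightarrow>
       (\<And>x. x \<in> U \<Longrightarrow> \<exists>V. openin T V \<and> x \<in> V \<and> V \<subseteq> U \<and> restrict s V \<in> C V) \<Longrightarrow> s \<in> C U"
    and one: "\<And>U. openin T U \<Longrightarrow> (\<lambda>x\<in>U. \<one>\<^bsub>R x\<^esub>) \<in> C U"
    and add: "\<And>U s t. openin T U \<Longrightarrow> s \<in> C U \<Longrightarrow> t \<in> C U \<Longrightarrow> (\<lambda>x\<in>U. s x \<oplus>\<^bsub>R x\<^esub> t x) \<in> C U"
    and mult: "\<And>U s t. openin T U \<Longrightarrow> s \<in> C U \<Longrightarrow> t \<in> C U \<Longrightarrow> (\<lambda>x\<in>U. s x \<otimes>\<^bsub>R x\<^esub> t x) \<in> C U"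
    and uminus: "\<And>U s. openin T U \<Longrightarrow> s \<in> C U \<Longrightarrow> (\<lambda>x\<in>U. \<ominus>\<^bsub>R x\<^esub> s x) \<in> C U"
  shows "is_sheaf T \<lparr>sections = (\<lambda>U. pointwise_ring U R (C U)), res = (\<lambda>U V s. restrict s V)\<rparr>"
    (is "is_sheaf T ?F")
proof -
  have sub: "U \<subseteq> topspace T" if "openin T U" for U using that by (rule openin_subset)
  have e: "s \<in> extensional U" if "openin T U" "s \<in> C U" for s U using C that by (auto simp: PiE_def)
  have pre: "is_presheaf T ?F"
    unfolding is_presheaf_def presheaf.simps
  proof (intro conjI allI impI ballI)
    show "cring (pointwise_ring U R (C U))" if "openin T U" for U
      using sub[OF that] by (intro pointwise_ring_cring R C one add mult uminus that) auto
  next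
    fix U V assume "openin T U \<and> openin T V \<and> V \<subseteq> U"
    then show "(\<lambda>s. restrict s V) \<in> ring_hom (pointwise_ring U R (C U)) (pointwise_ring V R (C V))"
      by (intro ring_hom_memI) (auto intro!: restr restrict_ext simp: subset_iff)
  next
    fix U s assume "openin T U" "s \<in> carrier (pointwise_ring U R (C U))"
    then show "restrict s U = s" using e by (simp add: extensional_restrict)
  next
    fix U V W s assume "openin T U \<and> openin T V \<and> openin T W \<and> W \<subseteq> V \<and> V \<subseteq> U"
    then show "restrict (restrict s V) W = restrict s W" by (simp add: Int_absorb1)
  qed
  show ?thesis
    unfolding is_sheaf_def
  proof (intro conjI allI impI pre ballI)
    fix \<C> s t assume \<C>: "\<forall>V\<in>\<C>. openin T V"
      and s: "s \<in> carrier (sections ?F (\<Union>\<C>))" and t: "t \<in> carrier (sections ?F (\<Union>\<C>))"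
      and eq: "\<forall>V\<in>\<C>. res ?F (\<Union>\<C>) V s = res ?F (\<Union>\<C>) V t"
    have o: "openin T (\<Union>\<C>)" using \<C> by blast
    show "s = t"
    proof (rule extensionalityI[of _ "\<Union>\<C>"])
      fix x assume "x \<in> \<Union>\<C>"
      then obtain V where V: "x \<in> V" "V \<in> \<C>" by blast
      then have "restrict s V x = restrict t V x" using eq by simp
      then show "s x = t x" using V by simp
    qed (use s t e[OF o] in simp_all)
  next
    fix \<C> s assume \<C>: "\<forall>V\<in>\<C>. openin T V"
      and st: "(\<forall>V\<in>\<C>. s V \<in> carrier (sections ?F V)) \<and>
        (\<forall>V\<in>\<C>. \<forall>W\<in>\<C>. res ?F V (V \<inter> W) (s V) = res ?F W (V \<inter> W) (s W))"
    have s: "s V \<in> C V" if "V \<in> \<C>" for V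
      using st that by simp
    have eq: "restrict (s V) (V \<inter> W) = restrict (s W) (V \<inter> W)" if "V \<in> \<C>" "W \<in> \<C>" for V W
      using conjunct2[OF st] that unfolding presheaf.simps by blast
    have eqx: "s V x = s W x" if "V \<in> \<C>" "W \<in> \<C>" "x \<in> V" "x \<in> W" for V W x
      using fun_cong[OF eq[OF that(1,2)], of x] that by simp
    have o: "openin T (\<Union>\<C>)" using \<C> by blast
    \<comment> \<open>At each point an arbitrary member of the cover is chosen; \<open>eqx\<close>
      makes the value independent of it.\<close>
    define t where "t = (\<lambda>x\<in>\<Union>\<C>. s (SOME V. V \<in> \<C> \<and> x \<in> V) x)"
    have t: "t x = s V x" if "V \<in> \<C>" "x \<in> V" for V x
    proof -
      have "(SOME V. V \<in> \<C> \<and> x \<in> V) \<in> \<C> \<and> x \<in> (SOME V. V \<in> \<C> \<and> x \<in> V)"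
        using that by (intro someI[of "\<lambda>V. V \<in> \<C> \<and> x \<in> V" V]) simp
      then have "s (SOME V. V \<in> \<C> \<and> x \<in> V) x = s V x" using that by (intro eqx) simp_all
      moreover have "x \<in> \<Union>\<C>" using that by blast
      ultimately show ?thesis unfolding t_def by simp
    qed
    have tV: "restrict t V = s V" if "V \<in> \<C>" for V
      by (rule extensionalityI[of _ V]) (use that t e[OF _ s] \<C> in auto)
    have "t \<in> C (\<Union>\<C>)"
    proof (rule locality[OF o])
      show "t \<in> (\<Pi>\<^sub>E x\<in>\<Union>\<C>. carrier (R x))"
      proof (rule PiE_I)
        fix x assume "x \<in> \<Union>\<C>"
        then obtain V where V: "x \<in> V" "V \<in> \<C>" by blast
        then have "s V x \<in> carrier (R x)" using C[of V] \<C> s[of V] by blast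
        then show "t x \<in> carrier (R x)" using t V by simp
      next
        fix x assume "x \<notin> \<Union>\<C>"
        then show "t x = undefined" by (simp add: t_def del: Union_iff)
      qed
      fix x assume "x \<in> \<Union>\<C>"
      then obtain V where V: "x \<in> V" "V \<in> \<C>" by blast
      then show "\<exists>V. openin T V \<and> x \<in> V \<and> V \<subseteq> \<Union>\<C> \<and> restrict t V \<in> C V"
        using \<C> s tV by (intro exI[of _ V]) auto
    qed
    then show "\<exists>t\<in>carrier (sections ?F (\<Union>\<C>)). \<forall>V\<in>\<C>. res ?F (\<Union>\<C>) V t = s V"
      using tV by (intro bexI[of _ t]) auto
  qed
qed

text \<open>Comaps are extensional, so they coincide with the natural formula on the carrier only;
  this carries the homomorphism property over to them.\<close>

lemma ring_hom_cong:
  assumes "f \<in> ring_hom R S" "ring R" "\<And>x. x \<in> carrier R \<Longrightarrow> g x = f x"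
  shows "g \<in> ring_hom R S"
proof -
  interpret ring R by fact
  show ?thesis by (rule ring_hom_memI)
    (use assms(3) ring_hom_memE[OF assms(1)] in simp_all)
qed

lemma ring_hom_comp:
  assumes "f \<in> ring_hom R S" "g \<in> ring_hom S T"
  shows "(\<lambda>x. g (f x)) \<in> ring_hom R T"
  using ring_hom_trans[OF assms] by (simp add: comp_def)

lemma ring_hom_uminus:
  assumes "ring R" "ring S" "h \<in> ring_hom R S" "a \<in> carrier R"
  shows "h (\<ominus>\<^bsub>R\<^esub> a) = \<ominus>\<^bsub>S\<^esub> h a"
proof -
  interpret ring_hom_ring R S h by (rule ring_hom_ringI2) (use assms in auto)
  show ?thesis using assms by simp
qed

section \<open>Sheafification as a sheaf of functions into germ rings\<close>

context presheaf_on
begin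

lemma sections_ring: "openin T U \<Longrightarrow> ring (sections F U)"
  by (rule cring.axioms(1)[OF sections_cring])

lemma germ_uminus:
  assumes "nbhd A U" "s \<in> sec U"
  shows "germ A U (\<ominus>\<^bsub>sections F U\<^esub> s) = \<ominus>\<^bsub>germs A\<^esub> germ A U s"
proof (rule ring_hom_uminus[OF _ _ germ_hom])
  have "A \<subseteq> topspace T" using assms(1) openin_subset by (fastforce simp: nbhd_def)
  then show "ring (germs A)" by (rule cring.axioms(1)[OF germ_ring_cring])
qed (use assms in \<open>simp_all add: sections_ring nbhd_open\<close>)

lemma nbhd_singleton [simp]: "nbhd {x} U \<longleftrightarrow> openin T U \<and> x \<in> U"
  by (simp add: nbhd_def)

lemma germ_cases_point:
  assumes "c \<in> carrier (germs {x})"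
  obtains U s where "openin T U" "x \<in> U" "s \<in> sec U" "c = germ {x} U s"
  using assms by (rule germ_cases) (use that in auto)

abbreviation "sf \<equiv> sheafify T F"
abbreviation "unit \<equiv> sheafify_unit T F"

lemma unit_res:
  assumes "openin T U" "openin T V" "V \<subseteq> U" "s \<in> sec U"
  shows "restrict (unit U s) V = unit V (res F U V s)"
  unfolding sheafify_unit_def using assms
  by (intro extensionalityI[of _ V]) (auto simp: subset_iff germ_res)

lemma sheafify_res [simp]: "res sf U V s = restrict s V"
  by (simp add: sheafify_def)

lemma sheafify_simps [simp]:
  "s \<otimes>\<^bsub>sections sf U\<^esub> t = (\<lambda>x\<in>U. s x \<otimes>\<^bsub>germs {x}\<^esub> t x)"
  "s \<oplus>\<^bsub>sections sf U\<^esub> t = (\<lambda>x\<in>U. s x \<oplus>\<^bsub>germs {x}\<^esub> t x)"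
  "\<one>\<^bsub>sections sf U\<^esub> = (\<lambda>x\<in>U. \<one>\<^bsub>germs {x}\<^esub>)"
  "\<zero>\<^bsub>sections sf U\<^esub> = (\<lambda>x\<in>U. \<zero>\<^bsub>germs {x}\<^esub>)"
  by (simp_all add: sheafify_def)

text \<open>The local condition is restated as an equation between functions,
  \<open>restrict s V = unit V t\<close>, which can be restricted further. It forces the values into
  the germ rings, so that of the product set only extensionality remains to be stated.\<close>

lemma sheafify_carrier_iff:
  assumes "openin T U"
  shows "s \<in> carrier (sections sf U) \<longleftrightarrow> s \<in> extensional U \<and>
    (\<forall>x\<in>U. \<exists>V t. openin T V \<and> x \<in> V \<and> V \<subseteq> U \<and> t \<in> sec V \<and> restrict s V = unit V t)"
    (is "?l \<longleftrightarrow> ?r")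
proof
  assume ?l
  then have s: "s \<in> (\<Pi>\<^sub>E x\<in>U. carrier (germs {x}))"
    "\<forall>x\<in>U. \<exists>V. openin T V \<and> x \<in> V \<and> V \<subseteq> U \<and> (\<exists>t\<in>sec V. \<forall>y\<in>V. s y = germ {y} V t)"
    by (auto simp: sheafify_def)
  show ?r
  proof (intro conjI ballI)
    show "s \<in> extensional U" using s(1) by (simp add: PiE_def)
    fix x assume "x \<in> U"
    then obtain V t where "openin T V" "x \<in> V" "V \<subseteq> U" "t \<in> sec V" "\<forall>y\<in>V. s y = germ {y} V t"
      using s(2) by meson
    moreover from this(5) have "restrict s V = unit V t"
      unfolding sheafify_unit_def by (intro restrict_ext) simp
    ultimately show "\<exists>V t. openin T V \<and> x \<in> V \<and> V \<subseteq> U \<and> t \<in> sec V \<and> restrict s V = unit V t" by meson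
  qed
next
  assume r: ?r
  have loc: "\<exists>V. openin T V \<and> x \<in> V \<and> V \<subseteq> U \<and> (\<exists>t\<in>sec V. \<forall>y\<in>V. s y = germ {y} V t)" if "x \<in> U" for x
  proof -
    obtain V t where V: "openin T V" "x \<in> V" "V \<subseteq> U" "t \<in> sec V" "restrict s V = unit V t"
      using r \<open>x \<in> U\<close> by meson
    have "s y = germ {y} V t" if "y \<in> V" for y
      using fun_cong[OF V(5), of y] that by (simp add: sheafify_unit_def)
    then show ?thesis using V(1-4) by meson
  qed
  have "s \<in> (\<Pi>\<^sub>E x\<in>U. carrier (germs {x}))"
  proof (rule PiE_I)
    fix x assume "x \<in> U"
    then show "s x \<in> carrier (germs {x})" using loc[of x] germ_closed[of "{x}"] by auto
  next
    fix x assume "x \<notin> U"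
    then show "s x = undefined" using r by (auto simp: extensional_def)
  qed
  then show ?l using loc by (simp add: sheafify_def)
qed

lemma sheafify_rep:
  assumes "openin T U" "s \<in> carrier (sections sf U)" "x \<in> U"
  obtains V t where "openin T V" "x \<in> V" "V \<subseteq> U" "t \<in> sec V" "restrict s V = unit V t"
  using assms sheafify_carrier_iff by meson

lemma unit_restrict_eq:
  assumes "openin T V" "openin T W" "W \<subseteq> V" "t \<in> sec V" "restrict s V = unit V t"
  shows "restrict s W = unit W (res F V W t)"
proof -
  have "restrict s W = restrict (restrict s V) W" using assms(3) by (simp add: Int_absorb1)
  then show ?thesis using assms by (simp add: unit_res)
qed

lemma sheafify_rep2:
  assumes "openin T U" "s \<in> carrier (sections sf U)" "t \<in> carrier (sections sf U)" "x \<in> U"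
  obtains V a b where "openin T V" "x \<in> V" "V \<subseteq> U" "a \<in> sec V" "restrict s V = unit V a"
    "b \<in> sec V" "restrict t V = unit V b"
proof -
  obtain V a where V: "openin T V" "x \<in> V" "V \<subseteq> U" "a \<in> sec V" "restrict s V = unit V a"
    by (rule sheafify_rep[OF assms(1,2,4)])
  obtain W b where W: "openin T W" "x \<in> W" "W \<subseteq> U" "b \<in> sec W" "restrict t W = unit W b"
    by (rule sheafify_rep[OF assms(1,3,4)])
  show thesis
  proof (rule that[of "V \<inter> W"])
    show "restrict s (V \<inter> W) = unit (V \<inter> W) (res F V (V \<inter> W) a)"
      using V W by (intro unit_restrict_eq) auto
    show "restrict t (V \<inter> W) = unit (V \<inter> W) (res F W (V \<inter> W) b)"
      using V W by (intro unit_restrict_eq) auto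
  qed (use V W in \<open>auto intro!: res_closed\<close>)
qed

lemma unit_closed:
  assumes "openin T U" "s \<in> sec U"
  shows "unit U s \<in> carrier (sections sf U)"
  unfolding sheafify_carrier_iff[OF assms(1)]
proof (intro conjI ballI)
  show "unit U s \<in> extensional U" by (simp add: sheafify_unit_def)
  fix x assume "x \<in> U"
  moreover have "restrict (unit U s) U = unit U s" by (simp add: sheafify_unit_def)
  ultimately show "\<exists>V t. openin T V \<and> x \<in> V \<and> V \<subseteq> U \<and> t \<in> sec V \<and> restrict (unit U s) V = unit V t"
    using assms by blast
qed

lemma unit_germ: "x \<in> U \<Longrightarrow> unit U s x = germ {x} U s"
  by (simp add: sheafify_unit_def)

lemma restrict_eq_unitD: "restrict s V = unit V a \<Longrightarrow> y \<in> V \<Longrightarrow> s y = germ {y} V a"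
  by (metis restrict_apply' unit_germ)

lemma sheafify_sheaf: "is_sheaf T sf"
proof -
  have U: "U \<subseteq> topspace T" if "openin T U" for U using that by (rule openin_subset)
  have sub: "carrier (sections sf U) \<subseteq> (\<Pi>\<^sub>E x\<in>U. carrier (germs {x}))" for U
    by (auto simp: sheafify_def)
  have ext: "(\<lambda>x\<in>U. f x) \<in> carrier (sections sf U)"
    if o: "openin T U" and ex: "\<And>x. x \<in> U \<Longrightarrow> \<exists>V t. openin T V \<and> x \<in> V \<and> V \<subseteq> U \<and> t \<in> sec V \<and> (\<forall>y\<in>V. f y = germ {y} V t)"
    for f U
    unfolding sheafify_carrier_iff[OF o]
  proof (intro conjI ballI)
    fix x assume "x \<in> U"
    then obtain V t where V: "openin T V" "x \<in> V" "V \<subseteq> U" "t \<in> sec V" "\<forall>y\<in>V. f y = germ {y} V t"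
      using ex by meson
    then have "restrict (\<lambda>x\<in>U. f x) V = unit V t"
      by (auto simp: sheafify_unit_def restrict_def fun_eq_iff)
    then show "\<exists>V t. openin T V \<and> x \<in> V \<and> V \<subseteq> U \<and> t \<in> sec V \<and> restrict (\<lambda>x\<in>U. f x) V = unit V t"
      using V by meson
  qed simp
  have "is_sheaf T \<lparr>sections = (\<lambda>U. pointwise_ring U (\<lambda>x. germs {x}) (carrier (sections sf U))),
    res = (\<lambda>U V s. restrict s V)\<rparr>"
  proof (rule local_function_sheaf)
    show "cring (germs {x})" if "x \<in> topspace T" for x
      using that by (intro germ_ring_cring) simp
    fix U assume o: "openin T U"
    show "carrier (sections sf U) \<subseteq> (\<Pi>\<^sub>E x\<in>U. carrier (germs {x}))" by (rule sub)
    show "(\<lambda>x\<in>U. \<one>\<^bsub>germs {x}\<^esub>) \<in> carrier (sections sf U)"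
      by (rule ext[OF o])
        (use o in \<open>auto intro!: exI[of _ U] exI[of _ "\<one>\<^bsub>sections F U\<^esub>"] ring.ring_simprules sections_ring simp: germ_one\<close>)
    fix s assume s: "s \<in> carrier (sections sf U)"
    show "(\<lambda>x\<in>U. \<ominus>\<^bsub>germs {x}\<^esub> s x) \<in> carrier (sections sf U)"
    proof (rule ext[OF o])
      fix x assume "x \<in> U"
      then obtain V a where V: "openin T V" "x \<in> V" "V \<subseteq> U" "a \<in> sec V" "restrict s V = unit V a"
        using sheafify_rep[OF o s] by blast
      then have "\<forall>y\<in>V. \<ominus>\<^bsub>germs {y}\<^esub> s y = germ {y} V (\<ominus>\<^bsub>sections F V\<^esub> a)"
        by (simp add: germ_uminus restrict_eq_unitD[OF V(5)])
      then show "\<exists>V t. openin T V \<and> x \<in> V \<and> V \<subseteq> U \<and> t \<in> sec V \<and> (\<forall>y\<in>V. \<ominus>\<^bsub>germs {y}\<^esub> s y = germ {y} V t)"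
        using V by (intro exI[of _ V] exI[of _ "\<ominus>\<^bsub>sections F V\<^esub> a"])
          (auto intro!: ring.ring_simprules sections_ring)
    qed
    show "restrict s V \<in> carrier (sections sf V)" if V: "openin T V" "V \<subseteq> U" for V
    proof (rule ext[OF V(1)])
      fix x assume x: "x \<in> V"
      obtain W a where W: "openin T W" "x \<in> W" "W \<subseteq> U" "a \<in> sec W" "restrict s W = unit W a"
        using sheafify_rep[OF o s] x V by blast
      have "openin T (V \<inter> W)" using V W by auto
      moreover from this have "restrict s (V \<inter> W) = unit (V \<inter> W) (res F W (V \<inter> W) a)"
        using V W by (intro unit_restrict_eq) auto
      ultimately show "\<exists>W t. openin T W \<and> x \<in> W \<and> W \<subseteq> V \<and> t \<in> sec W \<and> (\<forall>y\<in>W. s y = germ {y} W t)"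
        using V W x by (intro exI[of _ "V \<inter> W"] exI[of _ "res F W (V \<inter> W) a"])
          (auto intro!: res_closed restrict_eq_unitD)
    qed
    fix t assume t: "t \<in> carrier (sections sf U)"
    \<comment> \<open>An operation on stalks that is induced by one on sections preserves the
      property of being locally given by a section; addition and multiplication are the two
      instances.\<close>
    have binop: "(\<lambda>x\<in>U. f x (s x) (t x)) \<in> carrier (sections sf U)"
      if f: "\<And>V a b y. openin T V \<Longrightarrow> y \<in> V \<Longrightarrow> a \<in> sec V \<Longrightarrow> b \<in> sec V \<Longrightarrow>
        g V a b \<in> sec V \<and> f y (germ {y} V a) (germ {y} V b) = germ {y} V (g V a b)" for f g
    proof (rule ext[OF o])
      fix x assume x: "x \<in> U"
      obtain V a b where V: "openin T V" "x \<in> V" "V \<subseteq> U" "a \<in> sec V" "restrict s V = unit V a"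
        "b \<in> sec V" "restrict t V = unit V b" by (rule sheafify_rep2[OF o s t x])
      then have "\<forall>y\<in>V. f y (s y) (t y) = germ {y} V (g V a b)"
        using f[OF V(1) _ V(4,6)] by (simp add: restrict_eq_unitD[OF V(5)] restrict_eq_unitD[OF V(7)])
      then show "\<exists>V c. openin T V \<and> x \<in> V \<and> V \<subseteq> U \<and> c \<in> sec V \<and> (\<forall>y\<in>V. f y (s y) (t y) = germ {y} V c)"
        using V f[OF V(1,2,4,6)] by blast
    qed
    show "(\<lambda>x\<in>U. s x \<oplus>\<^bsub>germs {x}\<^esub> t x) \<in> carrier (sections sf U)"
      by (rule binop[of "\<lambda>V a b. a \<oplus>\<^bsub>sections F V\<^esub> b"]) (simp add: germ_add sections_ring ring.ring_simprules)
    show "(\<lambda>x\<in>U. s x \<otimes>\<^bsub>germs {x}\<^esub> t x) \<in> carrier (sections sf U)"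
      by (rule binop[of "\<lambda>V a b. a \<otimes>\<^bsub>sections F V\<^esub> b"]) (simp add: germ_mult sections_ring ring.ring_simprules)
  next
    fix U s assume o: "openin T U" and s: "s \<in> (\<Pi>\<^sub>E x\<in>U. carrier (germs {x}))"
      and loc: "\<And>x. x \<in> U \<Longrightarrow> \<exists>V. openin T V \<and> x \<in> V \<and> V \<subseteq> U \<and> restrict s V \<in> carrier (sections sf V)"
    have "restrict s U \<in> carrier (sections sf U)"
    proof (rule ext[OF o])
      fix x assume "x \<in> U"
      then obtain V where V: "openin T V" "x \<in> V" "V \<subseteq> U" "restrict s V \<in> carrier (sections sf V)"
        using loc by blast
      obtain W a where W: "openin T W" "x \<in> W" "W \<subseteq> V" "a \<in> sec W" "restrict (restrict s V) W = unit W a"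
        by (rule sheafify_rep[OF V(1,4,2)])
      have "\<forall>y\<in>W. s y = germ {y} W a"
      proof
        fix y assume "y \<in> W"
        moreover from this have "y \<in> V" using W(3) by blast
        ultimately show "s y = germ {y} W a" using restrict_eq_unitD[OF W(5), of y] by simp
      qed
      then show "\<exists>V t. openin T V \<and> x \<in> V \<and> V \<subseteq> U \<and> t \<in> sec V \<and> (\<forall>y\<in>V. s y = germ {y} V t)"
        using V W by (intro exI[of _ W] exI[of _ a]) auto
    qed
    then show "s \<in> carrier (sections sf U)" using s by (simp add: PiE_restrict)
  qed
  also have "\<lparr>sections = (\<lambda>U. pointwise_ring U (\<lambda>x. germs {x}) (carrier (sections sf U))),
    res = (\<lambda>U V s. restrict s V)\<rparr> = sf"
    by (simp add: sheafify_def)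
  finally show ?thesis .
qed

lemma unit_hom: 
  assumes "openin T U"
  shows "unit U \<in> ring_hom (sections F U) (sections sf U)"
  by (rule ring_hom_memI)
    (use assms in \<open>simp add: unit_closed, auto simp: sheafify_unit_def germ_mult germ_add germ_one
      intro!: restrict_ext\<close>)

lemma eval_hom:
  assumes "openin T U" "x \<in> U"
  shows "(\<lambda>s. s x) \<in> ring_hom (sections sf U) (germs {x})"
  by (rule ring_hom_memI) (use assms in \<open>auto simp: sheafify_def\<close>)

end

section \<open>Sections of a sheaf and their germs\<close>

locale sheaf_on = presheaf_on +
  assumes sheaf: "is_sheaf T F"

lemma sheaf_onI: "is_sheaf T F \<Longrightarrow> sheaf_on T F"
  by unfold_locales (auto simp: is_sheaf_def)

context sheaf_on
begin

lemma sheaf_unique: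
  assumes "\<forall>V\<in>\<C>. openin T V" "s \<in> sec (\<Union>\<C>)" "t \<in> sec (\<Union>\<C>)" "\<forall>V\<in>\<C>. res F (\<Union>\<C>) V s = res F (\<Union>\<C>) V t"
  shows "s = t"
  by (rule mp[OF bspec[OF bspec[OF conjunct1[OF mp[OF spec[OF
    conjunct2[OF sheaf[unfolded is_sheaf_def]]] assms(1)]] assms(2)] assms(3)] assms(4)])

lemma sheaf_glue:
  assumes "\<forall>V\<in>\<C>. openin T V" "\<forall>V\<in>\<C>. s V \<in> sec V"
    "\<forall>V\<in>\<C>. \<forall>W\<in>\<C>. res F V (V \<inter> W) (s V) = res F W (V \<inter> W) (s W)"
  shows "\<exists>t\<in>sec (\<Union>\<C>). \<forall>V\<in>\<C>. res F (\<Union>\<C>) V t = s V"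
  by (rule mp[OF spec[OF conjunct2[OF mp[OF spec[OF
    conjunct2[OF sheaf[unfolded is_sheaf_def]]] assms(1)]], of s] conjI[OF assms(2,3)]])

lemma sheaf_eqI:
  assumes U: "openin T U" and st: "s \<in> sec U" "t \<in> sec U"
    and loc: "\<And>x. x \<in> U \<Longrightarrow> \<exists>V. openin T V \<and> x \<in> V \<and> V \<subseteq> U \<and> res F U V s = res F U V t"
  shows "s = t"
proof -
  let ?\<C> = "{V. openin T V \<and> V \<subseteq> U \<and> res F U V s = res F U V t}"
  have un: "\<Union>?\<C> = U" using loc by blast
  show ?thesis by (rule sheaf_unique[of ?\<C>]) (use st in \<open>simp_all only: un mem_Collect_eq, simp_all\<close>)
qed

lemma sheaf_germ_eqI:
  assumes U: "openin T U" and st: "s \<in> sec U" "t \<in> sec U"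
    and eq: "\<And>x. x \<in> U \<Longrightarrow> germ {x} U s = germ {x} U t"
  shows "s = t"
proof (rule sheaf_eqI[OF assms(1-3)])
  fix x assume "x \<in> U"
  then show "\<exists>V. openin T V \<and> x \<in> V \<and> V \<subseteq> U \<and> res F U V s = res F U V t"
    using eq[of x] germ_eq_iff[of "{x}" U s U t] U st by auto
qed

text \<open>The sections to be glued are prescribed by their germs alone. They agree on overlaps
  because sections of a sheaf with equal germs are equal.\<close>

lemma sheaf_glue_germs:
  assumes U: "openin T U"
    and loc: "\<And>x. x \<in> U \<Longrightarrow> \<exists>V r. openin T V \<and> x \<in> V \<and> V \<subseteq> U \<and> r \<in> sec V \<and> (\<forall>y\<in>V. germ {y} V r = \<gamma> y)"
  shows "\<exists>r\<in>sec U. \<forall>y\<in>U. germ {y} U r = \<gamma> y"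
proof -
  let ?P = "\<lambda>V r. r \<in> sec V \<and> (\<forall>y\<in>V. germ {y} V r = \<gamma> y)"
  \<comment> \<open>The cover consists of all open subsets that carry a section with the prescribed
    germs; one such section is chosen over each.\<close>
  let ?\<C> = "{V. openin T V \<and> V \<subseteq> U \<and> (\<exists>r. ?P V r)}"
  have un: "\<Union>?\<C> = U"
  proof (rule equalityI[OF _ subsetI])
    fix x assume "x \<in> U"
    from loc[OF this] obtain V r where "openin T V \<and> V \<subseteq> U \<and> ?P V r" and "x \<in> V" by metis
    then have "V \<in> ?\<C>" by blast
    then show "x \<in> \<Union>?\<C>" using \<open>x \<in> V\<close> by (rule UnionI)
  qed blast
  define r where "r V = (SOME r. ?P V r)" for V
  have r: "?P V (r V)" if "V \<in> ?\<C>" for V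
    unfolding r_def by (rule someI_ex[of "?P V"]) (use that in simp)
  have agree: "res F V (V \<inter> W) (r V) = res F W (V \<inter> W) (r W)" if VW: "V \<in> ?\<C>" "W \<in> ?\<C>" for V W
  proof (rule sheaf_germ_eqI[of "V \<inter> W"])
    have o: "openin T V" "openin T W" "openin T (V \<inter> W)" using VW by auto
    then show "openin T (V \<inter> W)" "res F V (V \<inter> W) (r V) \<in> sec (V \<inter> W)" "res F W (V \<inter> W) (r W) \<in> sec (V \<inter> W)"
      using r[OF VW(1)] r[OF VW(2)] by (auto intro!: res_closed)
    fix x assume "x \<in> V \<inter> W"
    then show "germ {x} (V \<inter> W) (res F V (V \<inter> W) (r V)) = germ {x} (V \<inter> W) (res F W (V \<inter> W) (r W))"
      using r[OF VW(1)] r[OF VW(2)] o by (simp add: germ_res)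
  qed
  have "\<exists>t\<in>sec (\<Union>?\<C>). \<forall>V\<in>?\<C>. res F (\<Union>?\<C>) V t = r V"
  proof (rule sheaf_glue)
    show "\<forall>V\<in>?\<C>. \<forall>W\<in>?\<C>. res F V (V \<inter> W) (r V) = res F W (V \<inter> W) (r W)"
      by (intro ballI) (rule agree)
    show "\<forall>V\<in>?\<C>. r V \<in> sec V" by (intro ballI conjunct1[OF r])
    show "\<forall>V\<in>?\<C>. openin T V" by simp
  qed
  then obtain t where t: "t \<in> sec U" "\<And>V. V \<in> ?\<C> \<Longrightarrow> res F U V t = r V" unfolding un by auto
  have "germ {y} U t = \<gamma> y" if y: "y \<in> U" for y
  proof -
    have "y \<in> \<Union>?\<C>" unfolding un by (rule y)
    then obtain V where V: "V \<in> ?\<C>" "y \<in> V" by (rule UnionE)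
    then have "germ {y} V (res F U V t) = \<gamma> y" using t(2)[OF V(1)] r[OF V(1)] by simp
    then show ?thesis using V U t(1) by (simp add: germ_res y)
  qed
  then show ?thesis using t(1) by blast
qed

end

section \<open>Inverse images\<close>

context presheaf_on
begin

text \<open>Keeping the representative maps germs along \<open>A\<close> to germs along a smaller
  set. With \<open>A\<close> and \<open>B\<close> images of open sets this is the restriction of the
  inverse image presheaf.\<close>

lemma germ_restrict:
  assumes "nbhd A U" "s \<in> sec U" "B \<subseteq> A"
  shows "(\<Union>(V, t) \<in> germ A U s. germ B V t) = germ B U s"
proof (rule germ_UN[OF assms(1,2)])
  fix V t assume V: "nbhd A V" "t \<in> sec V" "germ A V t = germ A U s"
  then obtain W where "nbhd A W" "W \<subseteq> V \<inter> U" "res F V W t = res F U W s"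
    using germ_eq_iff[OF V(1,2) assms(1,2)] by blast
  then show "germ B V t = germ B U s"
    using V assms by (intro germ_eqI[of _ _ _ _ _ W]) (auto intro: nbhd_mono)
qed

lemma germ_restrict_hom:
  assumes "A \<subseteq> topspace T" "B \<subseteq> A"
  shows "(\<lambda>c. \<Union>(V, t) \<in> c. germ B V t) \<in> ring_hom (germs A) (germs B)"
  by (rule germ_ring_homI[OF assms(1), where \<phi> = "germ B"])
    (use assms in \<open>simp_all add: germ_hom germ_restrict nbhd_mono\<close>)

lemma inverse_image_simps [simp]:
  "sections (inverse_image_presheaf f T F) U = germs (f ` U)"
  "res (inverse_image_presheaf f T F) U V c = (\<Union>(W, s) \<in> c. germ (f ` V) W s)"
  by (simp_all add: inverse_image_presheaf_def)

lemma inverse_image_is_presheaf: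
  assumes f: "f \<in> topspace Z \<rightarrow> topspace T"
  shows "is_presheaf Z (inverse_image_presheaf f T F)"
proof -
  have sub: "f ` U \<subseteq> topspace T" if "openin Z U" for U
    using f openin_subset[OF that] by auto
  show ?thesis
    unfolding is_presheaf_def
  proof (intro conjI allI impI ballI)
    show "cring (sections (inverse_image_presheaf f T F) U)" if "openin Z U" for U
      using sub[OF that] by (simp add: germ_ring_cring)
  next
    fix U V assume UV: "openin Z U \<and> openin Z V \<and> V \<subseteq> U"
    have "res (inverse_image_presheaf f T F) U V = (\<lambda>c. \<Union>(W, s) \<in> c. germ (f ` V) W s)"
      by (rule ext) simp
    then show "res (inverse_image_presheaf f T F) U V \<in>
        ring_hom (sections (inverse_image_presheaf f T F) U) (sections (inverse_image_presheaf f T F) V)"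
      using germ_restrict_hom[OF sub, of U "f ` V"] UV by (simp add: image_mono)
  next
    fix U c assume "openin Z U" "c \<in> carrier (sections (inverse_image_presheaf f T F) U)"
    then show "res (inverse_image_presheaf f T F) U U c = c"
      by (simp, elim germ_cases) (simp add: germ_restrict)
  next
    fix U V W c assume UVW: "openin Z U \<and> openin Z V \<and> openin Z W \<and> W \<subseteq> V \<and> V \<subseteq> U"
      and c: "c \<in> carrier (sections (inverse_image_presheaf f T F) U)"
    obtain N s where N: "nbhd (f ` U) N" "s \<in> sec N" "c = germ (f ` U) N s"
      using c by (auto elim: germ_cases)
    have im: "f ` V \<subseteq> f ` U" "f ` W \<subseteq> f ` V" "f ` W \<subseteq> f ` U" using UVW by auto
    show "res (inverse_image_presheaf f T F) V W (res (inverse_image_presheaf f T F) U V c) =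
       res (inverse_image_presheaf f T F) U W c"
      using N im nbhd_mono[OF N(1) im(1)] by (simp add: germ_restrict)
  qed
qed

text \<open>The canonical map from the stalk at \<open>z\<close> of the inverse image presheaf to
  the stalk of \<open>F\<close> at \<open>f z\<close>: an element is a germ at \<open>z\<close> of
  germs along image sets, and these are restricted to the point.\<close>

definition collapse :: "('b \<Rightarrow> 'a) \<Rightarrow> 'b \<Rightarrow> ('b, ('a, 'r) germ) germ \<Rightarrow> ('a, 'r) germ" where
  "collapse f z c = (\<Union>(V, d) \<in> c. \<Union>(W, s) \<in> d. germ {f z} W s)"

text \<open>Two representatives of the germ at \<open>z\<close> agree as germs along the image of a
  smaller neighbourhood \<open>N\<close>, and hence as germs at \<open>f z\<close>.\<close>

lemma collapse_germ:
  assumes f: "f \<in> topspace Z \<rightarrow> topspace T" and V: "openin Z V" "z \<in> V"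
    and W: "nbhd (f ` V) W" "s \<in> sec W"
  shows "collapse f z (germ_of Z (inverse_image_presheaf f T F) {z} V (germ (f ` V) W s)) = germ {f z} W s"
proof -
  interpret I: presheaf_on Z "inverse_image_presheaf f T F"
    by unfold_locales (rule inverse_image_is_presheaf[OF f])
  have "(\<Union>(V', d) \<in> germ_of Z (inverse_image_presheaf f T F) {z} V (germ (f ` V) W s).
      \<Union>(W, s) \<in> d. germ {f z} W s) = germ {f z} W s"
  proof (rule I.germ_UN)
    fix V' d assume V': "I.nbhd {z} V'" "d \<in> I.sec V'" and eq: "I.germ {z} V' d = I.germ {z} V (germ (f ` V) W s)"
    have "I.nbhd {z} V" "germ (f ` V) W s \<in> I.sec V" using V W by (auto simp: germ_closed)
    then obtain N where N: "I.nbhd {z} N" "N \<subseteq> V' \<inter> V"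
      "res (inverse_image_presheaf f T F) V' N d = res (inverse_image_presheaf f T F) V N (germ (f ` V) W s)"
      using I.germ_eq_iff[OF V'] eq by blast
    obtain W' s' where W': "nbhd (f ` V') W'" "s' \<in> sec W'" "d = germ (f ` V') W' s'"
      using V'(2) by (auto elim: germ_cases)
    have im: "f ` N \<subseteq> f ` V" "f ` N \<subseteq> f ` V'" "{f z} \<subseteq> f ` N" "{f z} \<subseteq> f ` V'" using N V' by auto
    have "germ (f ` N) W' s' = germ (f ` N) W s"
      using N(3) W W' im by (simp add: germ_restrict)
    then have "(\<Union>(V, t)\<in>germ (f ` N) W' s'. germ {f z} V t) = (\<Union>(V, t)\<in>germ (f ` N) W s. germ {f z} V t)"
      by simp
    then have "germ {f z} W' s' = germ {f z} W s"
      using W W' im nbhd_mono by (subst (asm) (1 2) germ_restrict) auto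
    then show "(\<Union>(W, s)\<in>d. germ {f z} W s) = germ {f z} W s"
      using W' im by (simp add: germ_restrict)
  qed (use V W in \<open>auto simp: germ_closed\<close>)
  then show ?thesis by (simp add: collapse_def)
qed

lemma collapse_hom:
  assumes f: "f \<in> topspace Z \<rightarrow> topspace T" and z: "z \<in> topspace Z"
  shows "collapse f z \<in> ring_hom (germ_ring Z (inverse_image_presheaf f T F) {z}) (germs {f z})"
proof -
  interpret I: presheaf_on Z "inverse_image_presheaf f T F"
    by unfold_locales (rule inverse_image_is_presheaf[OF f])
  show ?thesis
  proof (rule I.germ_ring_homI[where \<phi> = "\<lambda>V d. \<Union>(W, s) \<in> d. germ {f z} W s"])
    fix V assume "I.nbhd {z} V"
    then show "(\<lambda>d. \<Union>(W, s) \<in> d. germ {f z} W s) \<in> ring_hom (sections (inverse_image_presheaf f T F) V) (germs {f z})"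
      using f openin_subset[of Z V] by (auto intro!: germ_restrict_hom)
  next
    fix V d assume V: "I.nbhd {z} V" and d: "d \<in> I.sec V"
    obtain W s where W: "nbhd (f ` V) W" "s \<in> sec W" "d = germ (f ` V) W s"
      using d by (auto elim: germ_cases)
    then show "collapse f z (I.germ {z} V d) = (\<Union>(W, s) \<in> d. germ {f z} W s)"
      using V f by (simp add: collapse_germ germ_restrict)
  qed (use z in simp)
qed

text \<open>The section over \<open>U\<close> of the inverse image sheaf that is induced by a
  section over \<open>W\<close>, when \<open>f\<close> maps \<open>U\<close> into \<open>W\<close>.
  For \<open>U\<close> the preimage of \<open>W\<close> this is the unit of the adjunction between
  inverse and direct image.\<close>

definition pull ::
  "('b \<Rightarrow> 'a) \<Rightarrow> 'b topology \<Rightarrow> 'b set \<Rightarrow> 'a set \<Rightarrow> 'r \<Rightarrow> 'b \<Rightarrow> ('b, ('a, 'r) germ) germ" where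
  "pull f Z U W s = sheafify_unit Z (inverse_image_presheaf f T F) U (germ (f ` U) W s)"

context
  fixes f :: "'b \<Rightarrow> 'a" and Z :: "'b topology"
  assumes f: "f \<in> topspace Z \<rightarrow> topspace T"
begin

interpretation I: presheaf_on Z "inverse_image_presheaf f T F"
  by unfold_locales (rule inverse_image_is_presheaf[OF f])

lemma pull_hom:
  assumes "openin Z U" "nbhd (f ` U) W"
  shows "pull f Z U W \<in> ring_hom (sections F W) (sections I.sf U)"
proof -
  have "pull f Z U W = (\<lambda>s. I.unit U (germ (f ` U) W s))" by (rule ext) (rule pull_def)
  then show ?thesis
    using ring_hom_comp[OF germ_hom[OF assms(2)] I.unit_hom[OF assms(1), unfolded inverse_image_simps]]
    by (simp only:)
qed

lemma pull_closed:
  "openin Z U \<Longrightarrow> nbhd (f ` U) W \<Longrightarrow> s \<in> sec W \<Longrightarrow> pull f Z U W s \<in> carrier (sections I.sf U)"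
  using pull_hom ring_hom_closed by fast

lemma pull_restrict:
  assumes "openin Z U" "openin Z V" "V \<subseteq> U" "nbhd (f ` U) W" "s \<in> sec W"
  shows "restrict (pull f Z U W s) V = pull f Z V W s"
  unfolding pull_def using assms
  by (subst I.unit_res) (simp_all add: germ_closed germ_restrict image_mono)

lemma pull_res:
  assumes "openin T W" "openin T V" "V \<subseteq> W" "f ` U \<subseteq> V" "s \<in> sec W"
  shows "pull f Z U V (res F W V s) = pull f Z U W s"
  unfolding pull_def using assms by (subst germ_res) (auto simp: nbhd_def)

text \<open>Sections of a sheafification are locally sections of the presheaf, and those of the
  inverse image presheaf are germs represented by sections over open sets of \<open>T\<close>. Local
  questions about the inverse image thus become questions about pullbacks.\<close>

lemma pull_rep:
  assumes "openin Z V" "a \<in> carrier (sections I.sf V)" "z \<in> V"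
  obtains U W s where "openin Z U" "z \<in> U" "U \<subseteq> V" "openin T W" "f ` U \<subseteq> W" "s \<in> sec W"
    "restrict a U = pull f Z U W s"
proof -
  obtain U d where U: "openin Z U" "z \<in> U" "U \<subseteq> V" "d \<in> I.sec U" "restrict a U = I.unit U d"
    by (rule I.sheafify_rep[OF assms])
  have "d \<in> carrier (germs (f ` U))" using U(4) by simp
  then obtain W s where "nbhd (f ` U) W" "s \<in> sec W" "d = germ (f ` U) W s" by (rule germ_cases)
  then show thesis using U by (intro that[of U W s]) (auto simp: nbhd_def pull_def)
qed

lemma collapse_pull:
  assumes "openin Z U" "z \<in> U" "nbhd (f ` U) W" "s \<in> sec W"
  shows "collapse f z (pull f Z U W s z) = germ {f z} W s"
  using collapse_germ[OF f assms] assms(2) by (simp add: pull_def I.unit_germ)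

end

end

section \<open>Morphisms of sheafifications\<close>

context
  fixes T :: "'a topology" and F :: "('a, 'r) presheaf" and G :: "('a, 's) presheaf" and \<phi>
  assumes F: "is_presheaf T F" and G: "is_presheaf T G"
    and \<phi>: "\<And>U. openin T U \<Longrightarrow> \<phi> U \<in> carrier (sections F U) \<rightarrow> carrier (sections G U)"
    and nat: "\<And>U V s. openin T U \<Longrightarrow> openin T V \<Longrightarrow> V \<subseteq> U \<Longrightarrow> s \<in> carrier (sections F U) \<Longrightarrow>
      \<phi> V (res F U V s) = res G U V (\<phi> U s)"
begin

interpretation F: presheaf_on T F by unfold_locales (rule F)
interpretation G: presheaf_on T G by unfold_locales (rule G)

text \<open>Naturality of \<open>\<phi>\<close> makes the germ of \<open>\<phi> W u\<close> the same
  for all representatives, so the union in \<open>sheafify_map\<close> is a single germ.\<close>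

lemma sheafify_map_germ:
  assumes "openin T V" "x \<in> V" "t \<in> F.sec V" 
  shows "(\<Union>(W, u) \<in> F.germ {x} V t. G.germ {x} W (\<phi> W u)) = G.germ {x} V (\<phi> V t)"
proof (rule F.germ_UN)
  fix W u assume W: "F.nbhd {x} W" "u \<in> F.sec W" and eq: "F.germ {x} W u = F.germ {x} V t"
  have V: "F.nbhd {x} V" using assms by simp
  obtain N where N: "F.nbhd {x} N" "N \<subseteq> W \<inter> V" "res F W N u = res F V N t"
    using F.germ_eq_iff[OF W V assms(3)] eq by blast
  show "G.germ {x} W (\<phi> W u) = G.germ {x} V (\<phi> V t)"
  proof (rule G.germ_eqI[of _ _ _ _ _ N])
    show "res G W N (\<phi> W u) = res G V N (\<phi> V t)"
      using N W assms nat[of W N u] nat[of V N t] by simp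
  qed (use assms W N \<phi> in auto)
qed (use assms in auto)

lemma sheafify_map_apply:
  assumes "openin T V" "t \<in> F.sec V" "restrict s V = F.unit V t" "x \<in> V" "x \<in> U"
  shows "sheafify_map T G \<phi> U s x = G.germ {x} V (\<phi> V t)"
  using F.restrict_eq_unitD[OF assms(3,4)] sheafify_map_germ[OF assms(1,4,2)] assms(5)
  by (simp add: sheafify_map_def)

lemma sheafify_map_closed:
  assumes U: "openin T U"
  shows "sheafify_map T G \<phi> U \<in> carrier (sections F.sf U) \<rightarrow> carrier (sections G.sf U)"
proof
  fix s assume s: "s \<in> carrier (sections F.sf U)"
  show "sheafify_map T G \<phi> U s \<in> carrier (sections G.sf U)"
    unfolding G.sheafify_carrier_iff[OF U]
  proof (intro conjI ballI)
    show "sheafify_map T G \<phi> U s \<in> extensional U" by (simp add: sheafify_map_def)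
    fix x assume x: "x \<in> U"
    obtain V t where V: "openin T V" "x \<in> V" "V \<subseteq> U" "t \<in> F.sec V" "restrict s V = F.unit V t"
      by (rule F.sheafify_rep[OF U s x])
    have "restrict (sheafify_map T G \<phi> U s) V = G.unit V (\<phi> V t)"
    proof (rule extensionalityI[of _ V])
      fix y assume "y \<in> V"
      then show "restrict (sheafify_map T G \<phi> U s) V y = G.unit V (\<phi> V t) y"
        using sheafify_map_apply[OF V(1,4,5)] V(3) by (auto simp: G.unit_germ)
    qed (auto simp: sheafify_unit_def)
    then show "\<exists>V t. openin T V \<and> x \<in> V \<and> V \<subseteq> U \<and> t \<in> G.sec V \<and>
        restrict (sheafify_map T G \<phi> U s) V = G.unit V t"
      using V \<phi>[OF V(1)] by blast
  qed
qed

end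

lemma sheafify_map_res:
  "V \<subseteq> U \<Longrightarrow> sheafify_map T G \<phi> V (restrict s V) = restrict (sheafify_map T G \<phi> U s) V"
  by (rule extensionalityI[of _ V]) (auto simp: sheafify_map_def)

section \<open>Morphisms of ringed spaces\<close>

lemma rs_sheaf_on: "is_ringed_space X \<Longrightarrow> sheaf_on (rs_top X) (rs_sheaf X)"
  by (simp add: is_ringed_space_def sheaf_onI)

lemma rs_presheaf_on: "is_ringed_space X \<Longrightarrow> presheaf_on (rs_top X) (rs_sheaf X)"
  by (rule sheaf_on.axioms(1)[OF rs_sheaf_on])

lemma lrs_ringed: "is_locally_ringed_space X \<Longrightarrow> is_ringed_space X"
  by (simp add: is_locally_ringed_space_def)

lemma stalk_local: "is_locally_ringed_space X \<Longrightarrow> x \<in> rs_points X \<Longrightarrow> is_local_ring (stalk X x)"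
  by (simp add: is_locally_ringed_space_def)

lemma lrs_hom_rs_hom: "f \<in> lrs_hom X Y \<Longrightarrow> f \<in> rs_hom X Y"
  by (simp add: lrs_hom_def)

lemma lrs_hom_max_ideal: "f \<in> lrs_hom X Y \<Longrightarrow> x \<in> rs_points X \<Longrightarrow> c \<in> max_ideal (stalk Y (rs_map f x)) \<Longrightarrow>
    stalk_map X f x c \<in> max_ideal (stalk X x)"
  by (auto simp: lrs_hom_def)

context
  fixes X :: "('a, 'r) ringed_space" and Y :: "('b, 's) ringed_space" and f
  assumes f: "f \<in> rs_hom X Y"
begin

lemma rs_map_closed: "x \<in> rs_points X \<Longrightarrow> rs_map f x \<in> rs_points Y"
  using f by (auto simp: rs_hom_def continuous_map_def)

lemma rs_preimage_open: "openin (rs_top Y) V \<Longrightarrow> openin (rs_top X) (rs_preimage X f V)"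
  using f by (auto simp: rs_hom_def continuous_map_def rs_preimage_def)

lemma rs_comap_hom: "openin (rs_top Y) V \<Longrightarrow>
    rs_comap f V \<in> ring_hom (rs_sections Y V) (rs_sections X (rs_preimage X f V))"
  using f by (simp add: rs_hom_def)

lemma rs_comap_closed: "openin (rs_top Y) V \<Longrightarrow> s \<in> carrier (rs_sections Y V) \<Longrightarrow>
    rs_comap f V s \<in> carrier (rs_sections X (rs_preimage X f V))"
  using ring_hom_closed[OF rs_comap_hom] by blast

lemma rs_comap_res: "openin (rs_top Y) U \<Longrightarrow> openin (rs_top Y) V \<Longrightarrow> V \<subseteq> U \<Longrightarrow> s \<in> carrier (rs_sections Y U) \<Longrightarrow>
    rs_comap f V (res (rs_sheaf Y) U V s) =
    res (rs_sheaf X) (rs_preimage X f U) (rs_preimage X f V) (rs_comap f U s)"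
  using f unfolding rs_hom_def by blast

lemma rs_map_extensional: "rs_map f \<in> extensional (rs_points X)"
  using f by (simp add: rs_hom_def)

lemma rs_comap_extensional: "rs_comap f \<in> extensional {V. openin (rs_top Y) V}"
  using f by (simp add: rs_hom_def)

lemma rs_comap_extensional2: "openin (rs_top Y) V \<Longrightarrow> rs_comap f V \<in> extensional (carrier (rs_sections Y V))"
  using f by (simp add: rs_hom_def)

lemma rs_continuous: "continuous_map (rs_top X) (rs_top Y) (rs_map f)"
  using f by (simp add: rs_hom_def)

end

lemma rs_preimage_mono: "U \<subseteq> V \<Longrightarrow> rs_preimage X f U \<subseteq> rs_preimage X f V"
  by (auto simp: rs_preimage_def)

lemma rs_hom_eqI:
  assumes f: "f \<in> rs_hom X Y" and g: "g \<in> rs_hom X Y"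
    and map: "\<And>x. x \<in> rs_points X \<Longrightarrow> rs_map f x = rs_map g x"
    and comap: "\<And>V s. openin (rs_top Y) V \<Longrightarrow> s \<in> carrier (rs_sections Y V) \<Longrightarrow> rs_comap f V s = rs_comap g V s"
  shows "f = g"
proof (rule rs_morphism.equality)
  show "rs_map f = rs_map g"
    by (rule extensionalityI[OF rs_map_extensional[OF f] rs_map_extensional[OF g] map])
  show "rs_comap f = rs_comap g"
  proof (rule extensionalityI[OF rs_comap_extensional[OF f] rs_comap_extensional[OF g]])
    fix V assume "V \<in> {V. openin (rs_top Y) V}"
    then have V: "openin (rs_top Y) V" by simp
    show "rs_comap f V = rs_comap g V"
      by (rule extensionalityI[OF rs_comap_extensional2[OF f V] rs_comap_extensional2[OF g V] comap[OF V]])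
  qed
qed simp

section \<open>Stalk maps of a morphism\<close>

context
  fixes X :: "('a, 'r) ringed_space" and Y :: "('b, 's) ringed_space" and f
  assumes X: "is_presheaf (rs_top X) (rs_sheaf X)" and Y: "is_presheaf (rs_top Y) (rs_sheaf Y)"
    and f: "f \<in> rs_hom X Y"
begin

interpretation X: presheaf_on "rs_top X" "rs_sheaf X" by unfold_locales (rule X)
interpretation Y: presheaf_on "rs_top Y" "rs_sheaf Y" by unfold_locales (rule Y)

lemma germ_map_germ:
  assumes A: "A \<subseteq> rs_points X" and V: "Y.nbhd (rs_map f ` A) V" "s \<in> Y.sec V"
  shows "germ_map X f A (Y.germ (rs_map f ` A) V s) = X.germ A (rs_preimage X f V) (rs_comap f V s)"
  unfolding germ_map_def
proof (rule Y.germ_UN[OF V])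
  have n: "X.nbhd A (rs_preimage X f W)" if "Y.nbhd (rs_map f ` A) W" for W
    using that A rs_preimage_open[OF f] by (auto simp: X.nbhd_def Y.nbhd_def rs_preimage_def)
  fix W t assume W: "Y.nbhd (rs_map f ` A) W" "t \<in> Y.sec W"
    and eq: "Y.germ (rs_map f ` A) W t = Y.germ (rs_map f ` A) V s"
  obtain N where N: "Y.nbhd (rs_map f ` A) N" "N \<subseteq> W \<inter> V" "res (rs_sheaf Y) W N t = res (rs_sheaf Y) V N s"
    using Y.germ_eq_iff[OF W V] eq by blast
  note o = Y.nbhd_open[OF V(1)] Y.nbhd_open[OF W(1)] Y.nbhd_open[OF N(1)]
  show "X.germ A (rs_preimage X f W) (rs_comap f W t) = X.germ A (rs_preimage X f V) (rs_comap f V s)"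
  proof (rule X.germ_eqI[of _ _ _ _ _ "rs_preimage X f N"])
    show "res (rs_sheaf X) (rs_preimage X f W) (rs_preimage X f N) (rs_comap f W t) =
        res (rs_sheaf X) (rs_preimage X f V) (rs_preimage X f N) (rs_comap f V s)"
      using rs_comap_res[OF f o(2,3) _ W(2)] rs_comap_res[OF f o(1,3) _ V(2)] N by simp
  qed (use n V W N o in \<open>auto intro!: rs_comap_closed[OF f] rs_preimage_mono\<close>)
qed

lemma germ_map_hom:
  assumes A: "A \<subseteq> rs_points X"
  shows "germ_map X f A \<in> ring_hom (Y.germs (rs_map f ` A)) (X.germs A)"
proof (rule Y.germ_ring_homI)
  show "rs_map f ` A \<subseteq> rs_points Y" using A rs_map_closed[OF f] by auto
  fix V assume V: "Y.nbhd (rs_map f ` A) V"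
  then have "X.nbhd A (rs_preimage X f V)"
    using A rs_preimage_open[OF f] by (auto simp: X.nbhd_def Y.nbhd_def rs_preimage_def)
  then show "(\<lambda>s. X.germ A (rs_preimage X f V) (rs_comap f V s)) \<in> ring_hom (rs_sections Y V) (X.germs A)"
    using V by (intro ring_hom_comp[OF rs_comap_hom[OF f] X.germ_hom]) (auto simp: Y.nbhd_def)
qed (rule germ_map_germ[OF A])

text \<open>Naturality of \<open>germ_map\<close> in the set along which germs are taken. For images
  of open sets it says that the maps out of the inverse image of the sheaf of \<open>Y\<close>
  commute with restriction.\<close>

lemma germ_map_restrict:
  assumes A: "A \<subseteq> rs_points X" and B: "B \<subseteq> A" and c: "c \<in> carrier (Y.germs (rs_map f ` A))"
  shows "germ_map X f B (\<Union>(V, s) \<in> c. Y.germ (rs_map f ` B) V s) = (\<Union>(V, s) \<in> germ_map X f A c. X.germ B V s)"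
proof -
  obtain V s where V: "Y.nbhd (rs_map f ` A) V" "s \<in> Y.sec V" "c = Y.germ (rs_map f ` A) V s"
    using c by (rule Y.germ_cases)
  have V': "Y.nbhd (rs_map f ` B) V" using V(1) B by (auto intro: Y.nbhd_mono)
  have n: "X.nbhd A (rs_preimage X f V)"
    using V(1) A rs_preimage_open[OF f] by (auto simp: X.nbhd_def Y.nbhd_def rs_preimage_def)
  show ?thesis
    using V V' A B n rs_comap_closed[OF f Y.nbhd_open[OF V(1)] V(2)]
    by (simp add: Y.germ_restrict image_mono germ_map_germ X.germ_restrict)
qed

lemma stalk_map_germ:
  assumes "x \<in> rs_points X" "openin (rs_top Y) V" "rs_map f x \<in> V" "s \<in> Y.sec V"
  shows "stalk_map X f x (Y.germ {rs_map f x} V s) = X.germ {x} (rs_preimage X f V) (rs_comap f V s)"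
  using germ_map_germ[of "{x}" V s] assms by (simp add: stalk_map_def)

lemma stalk_map_hom:
  assumes "x \<in> rs_points X"
  shows "stalk_map X f x \<in> ring_hom (stalk Y (rs_map f x)) (stalk X x)"
  using germ_map_hom[of "{x}"] assms by (simp add: stalk_map_def stalk_def)

end

lemma rs_is_presheaf: "is_ringed_space X \<Longrightarrow> is_presheaf (rs_top X) (rs_sheaf X)"
  by (simp add: is_ringed_space_def is_sheaf_def)

lemma stalk_cring: "is_ringed_space X \<Longrightarrow> x \<in> rs_points X \<Longrightarrow> cring (stalk X x)"
  unfolding stalk_def by (rule presheaf_on.germ_ring_cring[OF rs_presheaf_on]) auto

section \<open>Identities and composites\<close>

lemma rs_comp_simps:
  "x \<in> rs_points X \<Longrightarrow> rs_map (rs_comp X Y Z g f) x = rs_map g (rs_map f x)"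
  "openin (rs_top Z) W \<Longrightarrow> s \<in> carrier (rs_sections Z W) \<Longrightarrow>
    rs_comap (rs_comp X Y Z g f) W s = rs_comap f (rs_preimage Y g W) (rs_comap g W s)"
  by (simp_all add: rs_comp_def)

lemma rs_preimage_comp:
  assumes "f \<in> rs_hom X Y"
  shows "rs_preimage X (rs_comp X Y Z g f) W = rs_preimage X f (rs_preimage Y g W)"
  using rs_map_closed[OF assms] by (auto simp: rs_preimage_def rs_comp_def)

lemma rs_comp_closed:
  assumes X: "is_ringed_space X" and Z: "is_ringed_space Z" and f: "f \<in> rs_hom X Y" and g: "g \<in> rs_hom Y Z"
  shows "rs_comp X Y Z g f \<in> rs_hom X Z"
proof -
  interpret Z: presheaf_on "rs_top Z" "rs_sheaf Z" by (rule rs_presheaf_on[OF Z])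
  have hom: "(\<lambda>s. rs_comap f (rs_preimage Y g W) (rs_comap g W s)) \<in>
      ring_hom (rs_sections Z W) (rs_sections X (rs_preimage X f (rs_preimage Y g W)))"
    if "openin (rs_top Z) W" for W
    by (rule ring_hom_comp[OF rs_comap_hom[OF g that] rs_comap_hom[OF f rs_preimage_open[OF g that]]])
  have cont: "continuous_map (rs_top X) (rs_top Z) (rs_map g \<circ> rs_map f)"
    by (rule continuous_map_compose[OF rs_continuous[OF f] rs_continuous[OF g]])
  show ?thesis
    unfolding rs_hom_def mem_Collect_eq
  proof (intro conjI allI impI ballI)
    show "continuous_map (rs_top X) (rs_top Z) (rs_map (rs_comp X Y Z g f))"
      by (rule continuous_map_eq[OF cont]) (simp add: rs_comp_def)
  next
    fix W assume W: "openin (rs_top Z) W"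
    show "rs_comap (rs_comp X Y Z g f) W \<in>
        ring_hom (rs_sections Z W) (rs_sections X (rs_preimage X (rs_comp X Y Z g f) W))"
      unfolding rs_preimage_comp[OF f]
      by (rule ring_hom_cong[OF hom[OF W] Z.sections_ring[OF W]]) (simp add: rs_comp_simps W)
  next
    fix U V s assume UV: "openin (rs_top Z) U \<and> openin (rs_top Z) V \<and> V \<subseteq> U" and s: "s \<in> Z.sec U"
    have "res (rs_sheaf Z) U V s \<in> Z.sec V" using UV s by (auto intro: Z.res_closed)
    then show "rs_comap (rs_comp X Y Z g f) V (res (rs_sheaf Z) U V s) =
        res (rs_sheaf X) (rs_preimage X (rs_comp X Y Z g f) U) (rs_preimage X (rs_comp X Y Z g f) V)
          (rs_comap (rs_comp X Y Z g f) U s)"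
      unfolding rs_preimage_comp[OF f] using UV s
      by (simp add: rs_comp_simps rs_comap_res[OF g] rs_comap_res[OF f] rs_preimage_open[OF g]
          rs_preimage_mono rs_comap_closed[OF g])
  qed (auto simp: rs_comp_def)
qed

lemma rs_comp_assoc:
  assumes "f \<in> rs_hom X Y" "g \<in> rs_hom Y Z" "h \<in> rs_hom Z W"
  shows "rs_comp X Z W h (rs_comp X Y Z g f) = rs_comp X Y W (rs_comp Y Z W h g) f"
proof -
  have "rs_comap (rs_comp X Y Z g f) (rs_preimage Z h U) (rs_comap h U s) =
    rs_comap f (rs_preimage Y g (rs_preimage Z h U)) (rs_comap g (rs_preimage Z h U) (rs_comap h U s))"
    if "openin (rs_top W) U" "s \<in> carrier (rs_sections W U)" for U s
    by (rule rs_comp_simps(2)) (use that in \<open>auto intro: rs_preimage_open[OF assms(3)] rs_comap_closed[OF assms(3)]\<close>)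
  then show ?thesis
    using rs_map_closed[OF assms(1)]
    unfolding rs_comp_def[of X Z W] rs_comp_def[of X Y W]
    by (auto simp: rs_comp_simps rs_preimage_comp[OF assms(2)] intro!: restrict_ext)
qed

lemma rs_preimage_id: "openin (rs_top X) V \<Longrightarrow> rs_preimage X (rs_id X) V = V"
  using openin_subset[of "rs_top X" V] by (auto simp: rs_preimage_def rs_id_def)

lemma rs_id_closed:
  assumes "is_ringed_space X"
  shows "rs_id X \<in> rs_hom X X"
proof -
  interpret X: presheaf_on "rs_top X" "rs_sheaf X" by (rule rs_presheaf_on[OF assms])
  have pre: "rs_preimage X (rs_id X) V = V" if "openin (rs_top X) V" for V
    using openin_subset[OF that] by (auto simp: rs_preimage_def rs_id_def)
  have m: "rs_map (rs_id X) = restrict id (rs_points X)" by (auto simp: rs_id_def)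
  have hom: "(\<lambda>s. s) \<in> ring_hom (rs_sections X V) (rs_sections X V)" for V
    by (rule ring_hom_memI) auto
  show ?thesis
    unfolding rs_hom_def mem_Collect_eq
  proof (intro conjI allI impI ballI)
    show "continuous_map (rs_top X) (rs_top X) (rs_map (rs_id X))"
      by (rule continuous_map_eq[OF continuous_map_id]) (simp add: rs_id_def)
    fix V assume V: "openin (rs_top X) V"
    show "rs_comap (rs_id X) V \<in> ring_hom (rs_sections X V) (rs_sections X (rs_preimage X (rs_id X) V))"
      unfolding pre[OF V]
      by (rule ring_hom_cong[OF hom X.sections_ring[OF V]]) (simp add: rs_id_def V)
  qed (auto simp: pre X.res_closed, auto simp: rs_id_def X.res_closed)
qed

lemma stalk_map_id:
  assumes X: "is_ringed_space X" and x: "x \<in> rs_points X" and c: "c \<in> carrier (stalk X x)"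
  shows "stalk_map X (rs_id X) x c = c"
proof -
  interpret X: presheaf_on "rs_top X" "rs_sheaf X" by (rule rs_presheaf_on[OF X])
  obtain V s where V: "openin (rs_top X) V" "x \<in> V" "s \<in> X.sec V" "c = X.germ {x} V s"
    by (rule X.germ_cases_point[OF c[unfolded stalk_def]])
  have "rs_map (rs_id X) x = x" "rs_comap (rs_id X) V s = s" using x V by (simp_all add: rs_id_def)
  then show ?thesis
    using stalk_map_germ[OF rs_is_presheaf[OF X] rs_is_presheaf[OF X] rs_id_closed[OF X] x V(1) _ V(3)]
      V rs_preimage_id[OF V(1)] by simp
qed

lemma rs_id_lrs:
  assumes "is_locally_ringed_space X"
  shows "rs_id X \<in> lrs_hom X X"
proof -
  have "rs_map (rs_id X) x = x" if "x \<in> rs_points X" for x using that by (simp add: rs_id_def)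
  moreover have "stalk_map X (rs_id X) x c = c" if "x \<in> rs_points X" "c \<in> max_ideal (stalk X x)" for x c
    using stalk_map_id[OF lrs_ringed[OF assms] that(1)] max_ideal_subset[OF stalk_local[OF assms that(1)]] that(2)
    by blast
  ultimately show ?thesis
    using rs_id_closed[OF lrs_ringed[OF assms]] by (auto simp: lrs_hom_def)
qed

lemma rs_comp_id:
  assumes "is_ringed_space X" "is_ringed_space Y" "f \<in> rs_hom X Y"
  shows "rs_comp X X Y f (rs_id X) = f" "rs_comp X Y Y (rs_id Y) f = f"
proof -
  show "rs_comp X X Y f (rs_id X) = f"
    by (rule rs_hom_eqI[OF rs_comp_closed[OF assms(1,2) rs_id_closed[OF assms(1)] assms(3)] assms(3)])
      (simp_all add: rs_comp_simps rs_id_def rs_preimage_open[OF assms(3)] rs_comap_closed[OF assms(3)])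
  show "rs_comp X Y Y (rs_id Y) f = f"
    by (rule rs_hom_eqI[OF rs_comp_closed[OF assms(1,2,3) rs_id_closed[OF assms(2)]] assms(3)])
      (simp_all add: rs_comp_simps rs_preimage_id, simp_all add: rs_id_def rs_map_closed[OF assms(3)])
qed

lemma stalk_map_comp:
  assumes X: "is_ringed_space X" and Y: "is_ringed_space Y" and Z: "is_ringed_space Z"
    and f: "f \<in> rs_hom X Y" and g: "g \<in> rs_hom Y Z" and x: "x \<in> rs_points X"
    and c: "c \<in> carrier (stalk Z (rs_map g (rs_map f x)))"
  shows "stalk_map X (rs_comp X Y Z g f) x c = stalk_map X f x (stalk_map Y g (rs_map f x) c)"
proof -
  interpret Z: presheaf_on "rs_top Z" "rs_sheaf Z" by (rule rs_presheaf_on[OF Z])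
  note p = rs_is_presheaf[OF X] rs_is_presheaf[OF Y] rs_is_presheaf[OF Z]
  obtain W s where W: "openin (rs_top Z) W" "rs_map g (rs_map f x) \<in> W" "s \<in> Z.sec W"
    "c = Z.germ {rs_map g (rs_map f x)} W s"
    by (rule Z.germ_cases_point[OF c[unfolded stalk_def]])
  have fx: "rs_map f x \<in> rs_preimage Y g W" using W(2) rs_map_closed[OF f x] by (simp add: rs_preimage_def)
  have "stalk_map X (rs_comp X Y Z g f) x c =
      germ_of (rs_top X) (rs_sheaf X) {x} (rs_preimage X f (rs_preimage Y g W))
        (rs_comap f (rs_preimage Y g W) (rs_comap g W s))"
    using stalk_map_germ[OF p(1,3) rs_comp_closed[OF X Z f g] x W(1) _ W(3)] W x
    by (simp add: rs_comp_simps rs_preimage_comp[OF f])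
  then show ?thesis
    using stalk_map_germ[OF p(2,3) g rs_map_closed[OF f x] W(1-3)]
      stalk_map_germ[OF p(1,2) f x rs_preimage_open[OF g W(1)] fx rs_comap_closed[OF g W(1,3)]] W(4)
    by simp
qed

lemma lrs_comp_closed:
  assumes X: "is_ringed_space X" and Y: "is_ringed_space Y" and Z: "is_locally_ringed_space Z"
    and f: "f \<in> lrs_hom X Y" and g: "g \<in> lrs_hom Y Z"
  shows "rs_comp X Y Z g f \<in> lrs_hom X Z"
  unfolding lrs_hom_def mem_Collect_eq
proof (intro conjI ballI subsetI)
  note fg = lrs_hom_rs_hom[OF f] lrs_hom_rs_hom[OF g] and Z' = lrs_ringed[OF Z]
  show "rs_comp X Y Z g f \<in> rs_hom X Z" by (rule rs_comp_closed[OF X Z' fg])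
  fix x d assume x: "x \<in> rs_points X"
    and "d \<in> stalk_map X (rs_comp X Y Z g f) x ` max_ideal (stalk Z (rs_map (rs_comp X Y Z g f) x))"
  then obtain c where c: "c \<in> max_ideal (stalk Z (rs_map g (rs_map f x)))"
    "d = stalk_map X (rs_comp X Y Z g f) x c"
    by (auto simp: rs_comp_simps)
  have fx: "rs_map f x \<in> rs_points Y" by (rule rs_map_closed[OF fg(1) x])
  have "c \<in> carrier (stalk Z (rs_map g (rs_map f x)))"
    using c(1) max_ideal_subset[OF stalk_local[OF Z rs_map_closed[OF fg(2) fx]]] by blast
  then have "d = stalk_map X f x (stalk_map Y g (rs_map f x) c)"
    unfolding c(2) by (rule stalk_map_comp[OF X Y Z' fg x])
  then show "d \<in> max_ideal (stalk X x)"
    using lrs_hom_max_ideal[OF f x lrs_hom_max_ideal[OF g fx c(1)]] by simp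
qed

text \<open>Sections of a sheaf are determined by their germs, and the stalk maps give the germs of
  a pulled back section.\<close>

lemma rs_hom_stalk_eqI:
  assumes X: "is_ringed_space X" and Y: "is_ringed_space Y" and f: "f \<in> rs_hom X Y" and g: "g \<in> rs_hom X Y"
    and map: "\<And>x. x \<in> rs_points X \<Longrightarrow> rs_map f x = rs_map g x"
    and stalk: "\<And>x c. x \<in> rs_points X \<Longrightarrow> c \<in> carrier (stalk Y (rs_map f x)) \<Longrightarrow>
      stalk_map X f x c = stalk_map X g x c"
  shows "f = g"
proof (rule rs_hom_eqI[OF f g map])
  interpret X: sheaf_on "rs_top X" "rs_sheaf X" by (rule rs_sheaf_on[OF X])
  interpret Y: sheaf_on "rs_top Y" "rs_sheaf Y" by (rule rs_sheaf_on[OF Y])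
  fix V s assume V: "openin (rs_top Y) V" and s: "s \<in> Y.sec V"
  have pre: "rs_preimage X g V = rs_preimage X f V" using map by (auto simp: rs_preimage_def)
  show "rs_comap f V s = rs_comap g V s"
  proof (rule X.sheaf_germ_eqI[OF rs_preimage_open[OF f V] rs_comap_closed[OF f V s]
        rs_comap_closed[OF g V s, unfolded pre]])
    fix x assume "x \<in> rs_preimage X f V"
    then have x: "x \<in> rs_points X" "rs_map f x \<in> V" by (auto simp: rs_preimage_def)
    have c: "Y.germ {rs_map f x} V s \<in> carrier (stalk Y (rs_map f x))"
      unfolding stalk_def using V x s by (simp add: Y.germ_closed)
    show "X.germ {x} (rs_preimage X f V) (rs_comap f V s) = X.germ {x} (rs_preimage X f V) (rs_comap g V s)"
      using stalk[OF x(1) c] stalk_map_germ[OF X.presheaf Y.presheaf f x(1) V x(2) s]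
        stalk_map_germ[OF X.presheaf Y.presheaf g x(1) V _ s] x by (simp add: map pre)
  qed
qed

section \<open>Morphisms assembled from a continuous map and stalk maps\<close>

context
  fixes X :: "('a, 'r) ringed_space" and Y :: "('b, 's) ringed_space" and h :: "'a \<Rightarrow> 'b"
    and \<tau> :: "'a \<Rightarrow> ('b, 's) germ \<Rightarrow> ('a, 'r) germ"
  assumes X: "is_ringed_space X" and Y: "is_ringed_space Y"
    and h: "continuous_map (rs_top X) (rs_top Y) h"
    and \<tau>: "\<And>x. x \<in> rs_points X \<Longrightarrow> \<tau> x \<in> ring_hom (stalk Y (h x)) (stalk X x)"
begin

interpretation X: sheaf_on "rs_top X" "rs_sheaf X" by (rule rs_sheaf_on[OF X])
interpretation Y: sheaf_on "rs_top Y" "rs_sheaf Y" by (rule rs_sheaf_on[OF Y])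

private abbreviation (input) "pre V \<equiv> {x \<in> rs_points X. h x \<in> V}"

text \<open>\<open>r\<close> is the section that a morphism with map \<open>h\<close> and stalk maps
  \<open>\<tau>\<close> has to assign to \<open>s\<close>. As \<open>X\<close> carries a sheaf,
  there is at most one.\<close>

definition lifts :: "'b set \<Rightarrow> 's \<Rightarrow> 'r \<Rightarrow> bool" where
  "lifts V s r \<longleftrightarrow> openin (rs_top Y) V \<and> s \<in> Y.sec V \<and> r \<in> X.sec (pre V) \<and>
    (\<forall>x \<in> pre V. X.germ {x} (pre V) r = \<tau> x (Y.germ {h x} V s))"

text \<open>A condition on germs rather than on sections, so that it can be checked on the generators of a
  stalk.\<close>

definition liftable :: "'b \<Rightarrow> ('b, 's) germ \<Rightarrow> bool" where
  "liftable z c \<longleftrightarrow> (\<exists>V s r. lifts V s r \<and> z \<in> V \<and> c = Y.germ {z} V s)"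

private lemma pre_open: "openin (rs_top Y) V \<Longrightarrow> openin (rs_top X) (pre V)"
  using h by (simp add: continuous_map_def)

private lemma \<tau>_germ: "x \<in> rs_points X \<Longrightarrow> \<tau> x \<in> ring_hom (Y.germs {h x}) (X.germs {x})"
  using \<tau> by (simp add: stalk_def)

lemma lifts_res:
  assumes "lifts V s r" and W: "openin (rs_top Y) W" "W \<subseteq> V"
  shows "lifts W (res (rs_sheaf Y) V W s) (res (rs_sheaf X) (pre V) (pre W) r)"
proof -
  have V: "openin (rs_top Y) V" and s: "s \<in> Y.sec V" and r: "r \<in> X.sec (pre V)"
    and eq: "\<And>x. x \<in> pre V \<Longrightarrow> X.germ {x} (pre V) r = \<tau> x (Y.germ {h x} V s)"
    using assms(1) by (auto simp: lifts_def)
  have sub: "pre W \<subseteq> pre V" using W(2) by auto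
  show ?thesis
    unfolding lifts_def
  proof (intro conjI ballI)
    fix x assume x: "x \<in> pre W"
    then have "X.germ {x} (pre W) (res (rs_sheaf X) (pre V) (pre W) r) = X.germ {x} (pre V) r"
      using pre_open[OF V] pre_open[OF W(1)] r sub by (intro X.germ_res) auto
    moreover have "Y.germ {h x} W (res (rs_sheaf Y) V W s) = Y.germ {h x} V s"
      using x V W s by (intro Y.germ_res) auto
    ultimately show "X.germ {x} (pre W) (res (rs_sheaf X) (pre V) (pre W) r) =
        \<tau> x (Y.germ {h x} W (res (rs_sheaf Y) V W s))"
      using eq sub x by auto
  qed (use V W s r sub in \<open>auto intro!: Y.res_closed X.res_closed pre_open\<close>)
qed

lemma lifts_ops:
  assumes s: "lifts V s r" and t: "lifts V t u"
  shows "lifts V (s \<oplus>\<^bsub>rs_sections Y V\<^esub> t) (r \<oplus>\<^bsub>rs_sections X (pre V)\<^esub> u)"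
    and "lifts V (s \<otimes>\<^bsub>rs_sections Y V\<^esub> t) (r \<otimes>\<^bsub>rs_sections X (pre V)\<^esub> u)"
    and "lifts V (\<ominus>\<^bsub>rs_sections Y V\<^esub> s) (\<ominus>\<^bsub>rs_sections X (pre V)\<^esub> r)"
    and "lifts V \<one>\<^bsub>rs_sections Y V\<^esub> \<one>\<^bsub>rs_sections X (pre V)\<^esub>"
proof -
  have o: "openin (rs_top Y) V" and sec: "s \<in> Y.sec V" "t \<in> Y.sec V" "r \<in> X.sec (pre V)" "u \<in> X.sec (pre V)"
    and eq: "\<And>x. x \<in> pre V \<Longrightarrow> X.germ {x} (pre V) r = \<tau> x (Y.germ {h x} V s)"
      "\<And>x. x \<in> pre V \<Longrightarrow> X.germ {x} (pre V) u = \<tau> x (Y.germ {h x} V t)"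
    using s t by (auto simp: lifts_def)
  have n: "X.nbhd {x} (pre V)" "Y.nbhd {h x} V" "x \<in> rs_points X" if "x \<in> pre V" for x
    using that pre_open[OF o] o by auto
  have Rx: "ring (Y.germs {h x})" "ring (X.germs {x})" if "x \<in> pre V" for x
    using that o openin_subset by (auto intro!: cring.axioms(1) X.germ_ring_cring Y.germ_ring_cring)
  note R = Y.sections_ring[OF o] X.sections_ring[OF pre_open[OF o]]
  note gc = Y.germ_closed[OF _ sec(1)] Y.germ_closed[OF _ sec(2)]
  show "lifts V (s \<oplus>\<^bsub>rs_sections Y V\<^esub> t) (r \<oplus>\<^bsub>rs_sections X (pre V)\<^esub> u)"
    unfolding lifts_def
  proof (intro conjI ballI o ring.ring_simprules(1) R sec)
    fix x assume x: "x \<in> pre V"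
    show "X.germ {x} (pre V) (r \<oplus>\<^bsub>rs_sections X (pre V)\<^esub> u) = \<tau> x (Y.germ {h x} V (s \<oplus>\<^bsub>rs_sections Y V\<^esub> t))"
      unfolding X.germ_add[OF n(1)[OF x] sec(3,4), symmetric] Y.germ_add[OF n(2)[OF x] sec(1,2), symmetric]
        ring_hom_add[OF \<tau>_germ[OF n(3)[OF x]] gc[OF n(2)[OF x]]] eq[OF x] ..
  qed
  show "lifts V (s \<otimes>\<^bsub>rs_sections Y V\<^esub> t) (r \<otimes>\<^bsub>rs_sections X (pre V)\<^esub> u)"
    unfolding lifts_def
  proof (intro conjI ballI o ring.ring_simprules(5) R sec)
    fix x assume x: "x \<in> pre V"
    show "X.germ {x} (pre V) (r \<otimes>\<^bsub>rs_sections X (pre V)\<^esub> u) = \<tau> x (Y.germ {h x} V (s \<otimes>\<^bsub>rs_sections Y V\<^esub> t))"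
      unfolding X.germ_mult[OF n(1)[OF x] sec(3,4), symmetric] Y.germ_mult[OF n(2)[OF x] sec(1,2), symmetric]
        ring_hom_mult[OF \<tau>_germ[OF n(3)[OF x]] gc[OF n(2)[OF x]]] eq[OF x] ..
  qed
  show "lifts V (\<ominus>\<^bsub>rs_sections Y V\<^esub> s) (\<ominus>\<^bsub>rs_sections X (pre V)\<^esub> r)"
    unfolding lifts_def
  proof (intro conjI ballI o ring.ring_simprules(3) R sec)
    fix x assume x: "x \<in> pre V"
    show "X.germ {x} (pre V) (\<ominus>\<^bsub>rs_sections X (pre V)\<^esub> r) = \<tau> x (Y.germ {h x} V (\<ominus>\<^bsub>rs_sections Y V\<^esub> s))"
      unfolding X.germ_uminus[OF n(1)[OF x] sec(3)] Y.germ_uminus[OF n(2)[OF x] sec(1)]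
        ring_hom_uminus[OF Rx[OF x] \<tau>_germ[OF n(3)[OF x]] gc(1)[OF n(2)[OF x]]] eq(1)[OF x] ..
  qed
  show "lifts V \<one>\<^bsub>rs_sections Y V\<^esub> \<one>\<^bsub>rs_sections X (pre V)\<^esub>"
    unfolding lifts_def
  proof (intro conjI ballI o ring.ring_simprules(6) R)
    fix x assume x: "x \<in> pre V"
    show "X.germ {x} (pre V) \<one>\<^bsub>rs_sections X (pre V)\<^esub> = \<tau> x (Y.germ {h x} V \<one>\<^bsub>rs_sections Y V\<^esub>)"
      unfolding X.germ_one[OF n(1)[OF x]] Y.germ_one[OF n(2)[OF x]] ring_hom_one[OF \<tau>_germ[OF n(3)[OF x]]] ..
  qed
qed

lemma lifts_unique:
  assumes "lifts V s r" "lifts V s u"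
  shows "r = u"
  by (rule X.sheaf_germ_eqI[of "pre V"]) (use assms pre_open in \<open>auto simp: lifts_def\<close>)

text \<open>Two lifts are restricted to a common open set, where they can be combined because each
  \<open>\<tau> x\<close> is a ring homomorphism. This is the closure that an induction over
  generators of a stalk asks for.\<close>

lemma liftable_ops:
  assumes "liftable z c" "liftable z d"
  shows "liftable z (c \<oplus>\<^bsub>stalk Y z\<^esub> d)" "liftable z (c \<otimes>\<^bsub>stalk Y z\<^esub> d)" "liftable z (\<ominus>\<^bsub>stalk Y z\<^esub> c)"
proof -
  obtain V1 s1 r1 where 1: "lifts V1 s1 r1" "z \<in> V1" "c = Y.germ {z} V1 s1"
    using assms(1) by (auto simp: liftable_def)
  obtain V2 s2 r2 where 2: "lifts V2 s2 r2" "z \<in> V2" "d = Y.germ {z} V2 s2"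
    using assms(2) by (auto simp: liftable_def)
  let ?V = "V1 \<inter> V2"
  let ?s = "res (rs_sheaf Y) V1 ?V s1" and ?t = "res (rs_sheaf Y) V2 ?V s2"
  have o: "openin (rs_top Y) ?V" using 1(1) 2(1) by (auto simp: lifts_def)
  note st = lifts_res[OF 1(1) o Int_lower1] lifts_res[OF 2(1) o Int_lower2]
  have c: "c = Y.germ {z} ?V ?s" and d: "d = Y.germ {z} ?V ?t"
    using Y.germ_res[of "{z}" V1 s1 ?V] Y.germ_res[of "{z}" V2 s2 ?V] 1 2 o
    by (simp_all add: lifts_def)
  have zV: "z \<in> ?V" and n: "Y.nbhd {z} ?V" using 1(2) 2(2) o by simp_all
  have sec: "?s \<in> Y.sec ?V" "?t \<in> Y.sec ?V" using st unfolding lifts_def by blast+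
  show "liftable z (c \<oplus>\<^bsub>stalk Y z\<^esub> d)" "liftable z (c \<otimes>\<^bsub>stalk Y z\<^esub> d)" "liftable z (\<ominus>\<^bsub>stalk Y z\<^esub> c)"
    unfolding liftable_def stalk_def c d Y.germ_add[OF n sec] Y.germ_mult[OF n sec]
      Y.germ_uminus[OF n sec(1), symmetric]
    using lifts_ops[OF st] zV by blast+
qed

text \<open>Pulling a section of \<open>W\<close> back along \<open>q\<close> gives a lift of its
  pullback along \<open>p\<close>, since \<open>q\<close> is \<open>p\<close> composed with
  \<open>h\<close> on points and with \<open>\<tau>\<close> on stalks. Applied to the two
  projections, this covers the generators of the stalks of the fibered product.\<close>

lemma liftable_stalk_map:
  assumes W: "is_ringed_space W" and p: "p \<in> rs_hom Y W" and q: "q \<in> rs_hom X W"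
    and map: "\<And>x. x \<in> rs_points X \<Longrightarrow> rs_map p (h x) = rs_map q x"
    and stalk: "\<And>x c. x \<in> rs_points X \<Longrightarrow> c \<in> carrier (stalk W (rs_map q x)) \<Longrightarrow>
      \<tau> x (stalk_map Y p (h x) c) = stalk_map X q x c"
    and z: "z \<in> rs_points Y" and c: "c \<in> carrier (stalk W (rs_map p z))"
  shows "liftable z (stalk_map Y p z c)"
proof -
  interpret W: presheaf_on "rs_top W" "rs_sheaf W" by (rule rs_presheaf_on[OF W])
  obtain U a where U: "openin (rs_top W) U" "rs_map p z \<in> U" "a \<in> W.sec U" "c = W.germ {rs_map p z} U a"
    by (rule W.germ_cases_point[OF c[unfolded stalk_def]])
  let ?V = "rs_preimage Y p U"
  have hx: "h x \<in> rs_points Y" if "x \<in> rs_points X" for x using h that by (auto simp: continuous_map_def)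
  have pre: "pre ?V = rs_preimage X q U" using map hx by (auto simp: rs_preimage_def)
  have "lifts ?V (rs_comap p U a) (rs_comap q U a)"
    unfolding lifts_def pre
  proof (intro conjI ballI rs_preimage_open[OF p] rs_comap_closed[OF p] rs_comap_closed[OF q] U)
    fix x assume "x \<in> rs_preimage X q U"
    then have x: "x \<in> rs_points X" "rs_map q x \<in> U" by (auto simp: rs_preimage_def)
    have "W.germ {rs_map q x} U a \<in> carrier (stalk W (rs_map q x))"
      unfolding stalk_def using U x by (simp add: W.germ_closed)
    from stalk[OF x(1) this]
    show "X.germ {x} (rs_preimage X q U) (rs_comap q U a) = \<tau> x (Y.germ {h x} ?V (rs_comap p U a))"
      using stalk_map_germ[OF X.presheaf W.presheaf q x(1) U(1) x(2) U(3)]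
        stalk_map_germ[OF Y.presheaf W.presheaf p hx[OF x(1)] U(1) _ U(3)] x by (simp add: map)
  qed
  moreover have "z \<in> ?V" using z U(2) by (simp add: rs_preimage_def)
  ultimately show ?thesis
    unfolding liftable_def using stalk_map_germ[OF Y.presheaf W.presheaf p z U(1,2,3)] U(4) by blast
qed

text \<open>Local lifts exist by assumption and have prescribed germs, so they glue on
  \<open>X\<close>. Uniqueness of lifts then yields the laws of a morphism: sums, products and
  restrictions of lifts are lifts of sums, products and restrictions.\<close>

lemma rs_hom_of_stalk_maps:
  assumes liftable: "\<And>x c. x \<in> rs_points X \<Longrightarrow> c \<in> carrier (stalk Y (h x)) \<Longrightarrow> liftable (h x) c"
  shows "\<exists>f \<in> rs_hom X Y. \<forall>x \<in> rs_points X. rs_map f x = h x \<and>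
    (\<forall>c \<in> carrier (stalk Y (h x)). stalk_map X f x c = \<tau> x c)"
proof -
  have "\<exists>r. lifts V s r" if V: "openin (rs_top Y) V" and s: "s \<in> Y.sec V" for V s
  proof -
    have "\<exists>r \<in> X.sec (pre V). \<forall>x \<in> pre V. X.germ {x} (pre V) r = \<tau> x (Y.germ {h x} V s)"
    proof (rule X.sheaf_glue_germs[OF pre_open[OF V]])
      fix x assume x: "x \<in> pre V"
      have "Y.germ {h x} V s \<in> carrier (stalk Y (h x))"
        unfolding stalk_def using V x s by (simp add: Y.germ_closed)
      then obtain V' s' r' where V': "lifts V' s' r'" "h x \<in> V'" "Y.germ {h x} V s = Y.germ {h x} V' s'"
        using liftable x unfolding liftable_def by blast
      \<comment> \<open>The lift belongs to another representative \<open>s'\<close> of the germ of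
        \<open>s\<close>; on \<open>W\<close> the two coincide.\<close>
      then obtain W where W: "openin (rs_top Y) W" "h x \<in> W" "W \<subseteq> V" "W \<subseteq> V'"
          "res (rs_sheaf Y) V W s = res (rs_sheaf Y) V' W s'"
        using Y.germ_eq_iff[of "{h x}" V s V' s'] V s x by (auto simp: lifts_def)
      let ?r = "res (rs_sheaf X) (pre V') (pre W) r'"
      have l: "lifts W (res (rs_sheaf Y) V W s) ?r" unfolding W(5) by (rule lifts_res[OF V'(1) W(1,4)])
      have "X.germ {y} (pre W) ?r = \<tau> y (Y.germ {h y} V s)" if y: "y \<in> pre W" for y
      proof -
        have "Y.germ {h y} W (res (rs_sheaf Y) V W s) = Y.germ {h y} V s"
          by (rule Y.germ_res) (use y V s W(1,3) in auto)
        moreover have "X.germ {y} (pre W) ?r = \<tau> y (Y.germ {h y} W (res (rs_sheaf Y) V W s))"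
          using l y unfolding lifts_def by blast
        ultimately show ?thesis by simp
      qed
      then show "\<exists>U r. openin (rs_top X) U \<and> x \<in> U \<and> U \<subseteq> pre V \<and> r \<in> X.sec U \<and>
          (\<forall>y\<in>U. X.germ {y} U r = \<tau> y (Y.germ {h y} V s))"
        using l W x pre_open[OF W(1)] by (intro exI[of _ "pre W"] exI[of _ ?r]) (auto simp: lifts_def)
    qed
    then show ?thesis using V s unfolding lifts_def by blast
  qed
  then obtain \<rho> where \<rho>: "\<And>V s. openin (rs_top Y) V \<Longrightarrow> s \<in> Y.sec V \<Longrightarrow> lifts V s (\<rho> V s)" by metis
  note \<rho>_eqI = lifts_unique[OF \<rho>]
  define f where "f = \<lparr>rs_map = (\<lambda>x \<in> rs_points X. h x),
    rs_comap = (\<lambda>V \<in> {V. openin (rs_top Y) V}. \<lambda>s \<in> Y.sec V. \<rho> V s)\<rparr>"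
  have pre: "rs_preimage X f V = pre V" for V by (auto simp: rs_preimage_def f_def)
  have f: "f \<in> rs_hom X Y"
    unfolding rs_hom_def mem_Collect_eq pre
  proof (intro conjI allI impI ballI)
    show "continuous_map (rs_top X) (rs_top Y) (rs_map f)"
      by (rule continuous_map_eq[OF h]) (simp add: f_def)
  next
    fix V assume V: "openin (rs_top Y) V"
    note S = Y.sections_ring[OF V]
    have "\<rho> V \<in> ring_hom (rs_sections Y V) (rs_sections X (pre V))"
    proof (rule ring_hom_memI)
      fix s t assume s: "s \<in> Y.sec V" and t: "t \<in> Y.sec V"
      show "\<rho> V s \<in> X.sec (pre V)" using \<rho>[OF V s] by (simp add: lifts_def)
      note l = lifts_ops[OF \<rho>[OF V s] \<rho>[OF V t]]
      show "\<rho> V (s \<otimes>\<^bsub>rs_sections Y V\<^esub> t) = \<rho> V s \<otimes>\<^bsub>rs_sections X (pre V)\<^esub> \<rho> V t"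
        by (rule \<rho>_eqI[OF V ring.ring_simprules(5)[OF S s t] l(2)])
      show "\<rho> V (s \<oplus>\<^bsub>rs_sections Y V\<^esub> t) = \<rho> V s \<oplus>\<^bsub>rs_sections X (pre V)\<^esub> \<rho> V t"
        by (rule \<rho>_eqI[OF V ring.ring_simprules(1)[OF S s t] l(1)])
    next
      note one = ring.ring_simprules(6)[OF S]
      show "\<rho> V \<one>\<^bsub>rs_sections Y V\<^esub> = \<one>\<^bsub>rs_sections X (pre V)\<^esub>"
        by (rule \<rho>_eqI[OF V one lifts_ops(4)[OF \<rho>[OF V one] \<rho>[OF V one]]])
    qed
    then show "rs_comap f V \<in> ring_hom (rs_sections Y V) (rs_sections X (pre V))"
      by (rule ring_hom_cong[OF _ S]) (simp add: f_def V)
  next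
    fix U V s assume UV: "openin (rs_top Y) U \<and> openin (rs_top Y) V \<and> V \<subseteq> U" and s: "s \<in> Y.sec U"
    have l: "lifts V (res (rs_sheaf Y) U V s) (res (rs_sheaf X) (pre U) (pre V) (\<rho> U s))"
      by (rule lifts_res[OF \<rho>]) (use UV s in auto)
    then have "\<rho> V (res (rs_sheaf Y) U V s) = res (rs_sheaf X) (pre U) (pre V) (\<rho> U s)"
      using UV by (intro \<rho>_eqI) (simp_all add: lifts_def)
    then show "rs_comap f V (res (rs_sheaf Y) U V s) = res (rs_sheaf X) (pre U) (pre V) (rs_comap f U s)"
      using UV s l by (simp add: f_def lifts_def)
  qed (simp_all add: f_def)
  moreover have "rs_map f x = h x \<and> (\<forall>c \<in> carrier (stalk Y (h x)). stalk_map X f x c = \<tau> x c)"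
    if x: "x \<in> rs_points X" for x
  proof (intro conjI ballI)
    show fx: "rs_map f x = h x" using x by (simp add: f_def)
    fix c assume "c \<in> carrier (stalk Y (h x))"
    then obtain V s where V: "openin (rs_top Y) V" "h x \<in> V" "s \<in> Y.sec V" "c = Y.germ {h x} V s"
      unfolding stalk_def by (rule Y.germ_cases_point)
    then show "stalk_map X f x c = \<tau> x c"
      using stalk_map_germ[OF X.presheaf Y.presheaf f x V(1) _ V(3)] \<rho>[OF V(1,3)] x fx
      by (simp add: pre lifts_def) (simp add: f_def)
  qed
  ultimately show ?thesis by blast
qed

end

section \<open>The tensor product presheaf\<close>

context
  fixes T :: "'a topology" and H :: "('a, 'q) presheaf" and F :: "('a, 'r) presheaf" and G :: "('a, 's) presheaf"
    and \<alpha> \<beta>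
  assumes F: "is_presheaf T F" and G: "is_presheaf T G"
    and Hres: "\<And>U V. openin T U \<Longrightarrow> openin T V \<Longrightarrow> V \<subseteq> U \<Longrightarrow>
      res H U V \<in> carrier (sections H U) \<rightarrow> carrier (sections H V)"
    and \<alpha>: "\<And>U. openin T U \<Longrightarrow> \<alpha> U \<in> carrier (sections H U) \<rightarrow> carrier (sections F U)"
    and \<beta>: "\<And>U. openin T U \<Longrightarrow> \<beta> U \<in> carrier (sections H U) \<rightarrow> carrier (sections G U)"
    and \<alpha>_res: "\<And>U V c. openin T U \<Longrightarrow> openin T V \<Longrightarrow> V \<subseteq> U \<Longrightarrow> c \<in> carrier (sections H U) \<Longrightarrow>
      \<alpha> V (res H U V c) = res F U V (\<alpha> U c)"
    and \<beta>_res: "\<And>U V c. openin T U \<Longrightarrow> openin T V \<Longrightarrow> V \<subseteq> U \<Longrightarrow> c \<in> carrier (sections H U) \<Longrightarrow>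
      \<beta> V (res H U V c) = res G U V (\<beta> U c)"
begin

interpretation F: presheaf_on T F by unfold_locales (rule F)
interpretation G: presheaf_on T G by unfold_locales (rule G)

abbreviation (input) "TRg U \<equiv> tensor_ring (sections H U) (sections F U) (sections G U) (\<alpha> U) (\<beta> U)"
abbreviation (input) "ptg U \<equiv> pure_tensor (sections H U) (sections F U) (sections G U) (\<alpha> U) (\<beta> U)"
abbreviation (input) "TPg \<equiv> tensor_presheaf H F G \<alpha> \<beta>"

lemmas tensor_rules = F.sections_cring G.sections_cring \<alpha> \<beta>

lemma tensor_presheaf_sections: "sections TPg U = TRg U"
  by (simp add: tensor_presheaf_def)

text \<open>The restriction of the tensor presheaf is given by a formula on formal sums. It is
  identified with the homomorphism \<open>h\<close> that the universal property provides, so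
  independence of the representative and the homomorphism laws are inherited from
  \<open>h\<close>.\<close>

lemma
  assumes U: "openin T U" and V: "openin T V" and sub: "V \<subseteq> U"
  shows tensor_res_hom: "res TPg U V \<in> ring_hom (TRg U) (TRg V)"
    and tensor_res_pure: "a \<in> F.sec U \<Longrightarrow> b \<in> G.sec U \<Longrightarrow> res TPg U V (ptg U a b) = ptg V (res F U V a) (res G U V b)"
proof -
  let ?PU = "pair_ring (sections F U) (sections G U)" and ?PV = "pair_ring (sections F V) (sections G V)"
  let ?p = "\<lambda>x. tensor_ideal (sections H U) (sections F U) (sections G U) (\<alpha> U) (\<beta> U) +>\<^bsub>?PU\<^esub> x"
  let ?q = "\<lambda>x. tensor_ideal (sections H V) (sections F V) (sections G V) (\<alpha> V) (\<beta> V) +>\<^bsub>?PV\<^esub> x"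
  note rU = tensor_rules[OF U] and rV = tensor_rules[OF V]
  note cF = F.res_closed[OF U V sub] and cG = G.res_closed[OF U V sub]
  interpret TU: cring "TRg U" by (rule tensor_ring_cring[OF rU])
  interpret TV: cring "TRg V" by (rule tensor_ring_cring[OF rV])
  have one: "\<one>\<^bsub>sections F V\<^esub> \<in> F.sec V" "\<one>\<^bsub>sections G V\<^esub> \<in> G.sec V"
    using F.sections_ring[OF V] G.sections_ring[OF V] by (auto intro: ring.ring_simprules)
  let ?f = "\<lambda>a. ptg V (res F U V a) \<one>\<^bsub>sections G V\<^esub>" and ?g = "\<lambda>b. ptg V \<one>\<^bsub>sections F V\<^esub> (res G U V b)"
  have "\<exists>h \<in> ring_hom (TRg U) (TRg V). \<forall>a\<in>F.sec U. \<forall>b\<in>G.sec U. h (ptg U a b) = ?f a \<otimes>\<^bsub>TRg V\<^esub> ?g b"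
  proof (rule tensor_lift_exists[OF rU TV.is_cring])
    show "?f \<in> ring_hom (sections F U) (TRg V)"
      by (rule ring_hom_comp[OF F.res_hom[OF U V sub] pure_tensor_hom1[OF rV]])
    show "?g \<in> ring_hom (sections G U) (TRg V)"
      by (rule ring_hom_comp[OF G.res_hom[OF U V sub] pure_tensor_hom2[OF rV]])
    fix c assume c: "c \<in> carrier (sections H U)"
    then have d: "res H U V c \<in> carrier (sections H V)" using Hres[OF U V sub] by blast
    have m: "\<alpha> V (res H U V c) \<in> F.sec V" "\<beta> V (res H U V c) \<in> G.sec V" using rV(3,4) d by auto
    show "?f (\<alpha> U c) = ?g (\<beta> U c)"
      using pure_tensor_base[OF rV d one] monoid.r_one[OF ring.is_monoid[OF F.sections_ring[OF V]] m(1)]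
        monoid.r_one[OF ring.is_monoid[OF G.sections_ring[OF V]] m(2)]
      by (simp add: \<alpha>_res[OF U V sub c] \<beta>_res[OF U V sub c])
  qed
  then obtain h where h: "h \<in> ring_hom (TRg U) (TRg V)"
    and h_pure: "\<And>a b. a \<in> F.sec U \<Longrightarrow> b \<in> G.sec U \<Longrightarrow> h (ptg U a b) = ?f a \<otimes>\<^bsub>TRg V\<^esub> ?g b" by blast
  interpret h: ring_hom_ring "TRg U" "TRg V" h by (rule ring_hom_ringI2[OF TU.ring_axioms TV.ring_axioms h])
  have h_pt: "h (ptg U a b) = ptg V (res F U V a) (res G U V b)" if "a \<in> F.sec U" "b \<in> G.sec U" for a b
    using pure_tensor_split[OF rV cF[OF that(1)] cG[OF that(2)]] h_pure[OF that] by simp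
  define e where "e = frag_extend (\<lambda>(a, b). frag_of (res F U V a, res G U V b))"
  \<comment> \<open>\<open>e\<close> is the formula on formal sums; it represents \<open>h\<close>
    because both are additive and agree on pairs.\<close>
  have he: "e x \<in> carrier ?PV \<and> h (?p x) = ?q (e x)" if "x \<in> carrier ?PU" for x
    using that
  proof (induction rule: pair_ring_induct)
    case zero
    show ?case by (simp add: e_def cls_zero[OF rU] cls_zero[OF rV] pair_ring_carrier)
  next
    case (of a b)
    then show ?case using h_pt[OF of] cF cG by (simp add: e_def pure_tensor_def)
  next
    case (diff x y)
    have "e (x - y) = e x - e y" by (simp add: e_def frag_extend_diff)
    moreover have "?p x \<in> carrier (TRg U)" "?p y \<in> carrier (TRg U)"
      using diff(1,2) ring_hom_closed[OF cls_hom[OF rU]] by auto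
    ultimately show ?case
      using diff by (simp add: cls_diff[OF rU] cls_diff[OF rV] pair_ring_diff_closed TU.minus_eq TV.minus_eq)
  qed
  interpret I: ideal "tensor_ideal (sections H U) (sections F U) (sections G U) (\<alpha> U) (\<beta> U)" ?PU
    by (rule tensor_ideal_ideal[OF rU])
  \<comment> \<open>All elements of the class \<open>c\<close> are sent by \<open>e\<close> into one
    class, so the union in the definition of the restriction is that class.\<close>
  have res: "res TPg U V c = h c" if "c \<in> carrier (TRg U)" for c
  proof -
    obtain x0 where x0: "x0 \<in> carrier ?PU" "c = ?p x0" using \<open>c \<in> _\<close> unfolding tensor_ring_carrier[OF rU] by blast
    have "?q (e x) = h c" if x: "x \<in> c" for x
    proof -
      have "x \<in> carrier ?PU" using x x0 I.a_r_coset_subset_G[OF I.a_subset] by blast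
      moreover have "?p x = c" using I.a_repr_independence'[of x x0] x x0 by simp
      ultimately show ?thesis using he by auto
    qed
    moreover have "x0 \<in> c" unfolding x0(2) by (rule I.a_rcos_self[OF x0(1)])
    ultimately show ?thesis by (auto simp: tensor_presheaf_def e_def)
  qed
  show "res TPg U V \<in> ring_hom (TRg U) (TRg V)"
    by (rule ring_hom_cong[OF h TU.ring_axioms res])
  show "res TPg U V (ptg U a b) = ptg V (res F U V a) (res G U V b)" if "a \<in> F.sec U" "b \<in> G.sec U"
    using res[OF pure_tensor_closed[OF rU that]] h_pt[OF that] by simp
qed

text \<open>The uniqueness half of the universal property: pure tensors generate additively. The
  identity and composition laws of the presheaf follow from it, as both sides are homomorphisms that
  agree on pure tensors.\<close>

lemma tensor_homs_eqI:
  assumes U: "openin T U" and D: "ring D"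
    and h: "h \<in> ring_hom (TRg U) D" and k: "k \<in> ring_hom (TRg U) D"
    and eq: "\<And>a b. a \<in> F.sec U \<Longrightarrow> b \<in> G.sec U \<Longrightarrow> h (ptg U a b) = k (ptg U a b)"
    and t: "t \<in> carrier (TRg U)"
  shows "h t = k t"
  using t
proof (induction rule: tensor_induct[OF tensor_rules[OF U], consumes 1, case_names pure add uminus])
  case (pure a b)
  then show ?case by (rule eq)
next
  case (add s t)
  then show ?case by (simp add: ring_hom_add[OF h] ring_hom_add[OF k])
next
  case (uminus s)
  then show ?case
    using cring.axioms(1)[OF tensor_ring_cring[OF tensor_rules[OF U]]] D
    by (simp add: ring_hom_uminus[OF _ _ h] ring_hom_uminus[OF _ _ k])
qed

lemma tensor_is_presheaf: "is_presheaf T TPg"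
proof -
  have cr: "cring (TRg U)" if "openin T U" for U by (rule tensor_ring_cring[OF tensor_rules[OF that]])
  note r = cring.axioms(1)[OF cr]
  show ?thesis
    unfolding is_presheaf_def tensor_presheaf_sections
  proof (intro conjI allI impI ballI cr)
    fix U V assume "openin T U \<and> openin T V \<and> V \<subseteq> U"
    then show "res TPg U V \<in> ring_hom (TRg U) (TRg V)" by (intro tensor_res_hom) auto
  next
    fix U t assume U: "openin T U" and t: "t \<in> carrier (TRg U)"
    have id: "(\<lambda>t. t) \<in> ring_hom (TRg U) (TRg U)" by (rule ring_hom_memI) auto
    show "res TPg U U t = t"
      by (rule tensor_homs_eqI[OF U r[OF U] tensor_res_hom[OF U U subset_refl] id _ t])
        (simp add: tensor_res_pure[OF U U subset_refl] F.res_id[OF U] G.res_id[OF U])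
  next
    fix U V W t assume "openin T U \<and> openin T V \<and> openin T W \<and> W \<subseteq> V \<and> V \<subseteq> U" and t: "t \<in> carrier (TRg U)"
    then have UVW: "openin T U" "openin T V" "openin T W" "W \<subseteq> V" "V \<subseteq> U" "W \<subseteq> U" by auto
    note h = tensor_res_hom[OF UVW(1,2,5)] tensor_res_hom[OF UVW(2,3,4)] tensor_res_hom[OF UVW(1,3,6)]
    show "res TPg V W (res TPg U V t) = res TPg U W t"
      by (rule tensor_homs_eqI[OF UVW(1) r[OF UVW(3)] ring_hom_comp[OF h(1,2)] h(3) _ t])
        (use UVW in \<open>simp add: tensor_res_pure F.res_closed G.res_closed F.res_res G.res_res\<close>)
  qed simp
qed

end

section \<open>The fibered product of ringed spaces\<close>

locale rs_cospan =
  fixes X1 :: "('a, 'r) ringed_space" and X2 :: "('b, 's) ringed_space"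
    and Y :: "('c, 't) ringed_space"
    and f1 :: "('a, 'r, 'c, 't) rs_morphism" and f2 :: "('b, 's, 'c, 't) rs_morphism"
  assumes X1: "is_ringed_space X1" and X2: "is_ringed_space X2" and Y: "is_ringed_space Y"
    and f1: "f1 \<in> rs_hom X1 Y" and f2: "f2 \<in> rs_hom X2 Y"
begin

sublocale X1: sheaf_on "rs_top X1" "rs_sheaf X1" by (rule rs_sheaf_on[OF X1])
sublocale X2: sheaf_on "rs_top X2" "rs_sheaf X2" by (rule rs_sheaf_on[OF X2])
sublocale Y: sheaf_on "rs_top Y" "rs_sheaf Y" by (rule rs_sheaf_on[OF Y])

abbreviation "Z \<equiv> fp_top X1 X2 f1 f2"
abbreviation "inv1 \<equiv> inverse_image_presheaf fst (rs_top X1) (rs_sheaf X1) :: ('a \<times> 'b, ('a, 'r) germ) presheaf"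
abbreviation "inv2 \<equiv> inverse_image_presheaf snd (rs_top X2) (rs_sheaf X2) :: ('a \<times> 'b, ('b, 's) germ) presheaf"
abbreviation "invY \<equiv> inverse_image_presheaf (rs_map f1 \<circ> fst) (rs_top Y) (rs_sheaf Y) :: ('a \<times> 'b, ('c, 't) germ) presheaf"

lemma fp_topspace: "topspace Z = {(x1, x2). x1 \<in> rs_points X1 \<and> x2 \<in> rs_points X2 \<and> rs_map f1 x1 = rs_map f2 x2}"
  by (auto simp: fp_top_def)

lemma fp_open_map: "openin Z U \<Longrightarrow> z \<in> U \<Longrightarrow> rs_map f1 (fst z) = rs_map f2 (snd z)"
  using openin_subset[of Z U] by (auto simp: fp_topspace)

lemma fst_closed: "fst \<in> topspace Z \<rightarrow> rs_points X1" and snd_closed: "snd \<in> topspace Z \<rightarrow> rs_points X2"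
  and base_closed: "rs_map f1 \<circ> fst \<in> topspace Z \<rightarrow> rs_points Y"
  by (auto simp: fp_topspace intro: rs_map_closed[OF f1, simplified] rs_map_closed[OF f2])

lemma continuous_fst: "continuous_map Z (rs_top X1) fst" and continuous_snd: "continuous_map Z (rs_top X2) snd"
  unfolding fp_top_def by (auto intro: continuous_map_from_subtopology continuous_map_fst continuous_map_snd)

sublocale I1: presheaf_on Z inv1 by unfold_locales (rule X1.inverse_image_is_presheaf[OF fst_closed])
sublocale I2: presheaf_on Z inv2 by unfold_locales (rule X2.inverse_image_is_presheaf[OF snd_closed])
sublocale IY: presheaf_on Z invY by unfold_locales (rule Y.inverse_image_is_presheaf[OF base_closed])

lemma fp_sheaf_eqs:
  "fp_sheaf1 X1 X2 f1 f2 = sheafify Z inv1" "fp_sheaf2 X1 X2 f1 f2 = sheafify Z inv2"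
  "fp_sheafY X1 X2 Y f1 f2 = sheafify Z invY"
  by (simp_all add: fp_sheaf1_def fp_sheaf2_def fp_sheafY_def inverse_image_def)

abbreviation "F1 \<equiv> sheafify Z inv1"
abbreviation "F2 \<equiv> sheafify Z inv2"
abbreviation "FY \<equiv> sheafify Z invY"
abbreviation "b1 \<equiv> fp_base1 X1 X2 f1 f2"
abbreviation "b2 \<equiv> fp_base2 X1 X2 f1 f2"

sublocale F1: sheaf_on Z F1 by (rule sheaf_onI[OF I1.sheafify_sheaf])
sublocale F2: sheaf_on Z F2 by (rule sheaf_onI[OF I2.sheafify_sheaf])
sublocale FY: sheaf_on Z FY by (rule sheaf_onI[OF IY.sheafify_sheaf])

lemma fp_image1: "openin Z U \<Longrightarrow> fst ` U \<subseteq> rs_points X1"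
  and fp_image2: "openin Z U \<Longrightarrow> snd ` U \<subseteq> rs_points X2"
  using openin_subset[of Z U] by (auto simp: fp_topspace)

lemma fp_imageY: "(rs_map f1 \<circ> fst) ` U = rs_map f1 ` fst ` U"
  by auto

text \<open>On the fibered product the two maps to \<open>Y\<close> coincide, so a germ of
  \<open>Y\<close> along this image can be sent both to a germ of \<open>X1\<close> and to a germ of
  \<open>X2\<close>.\<close>

lemma fp_imageY2: "openin Z U \<Longrightarrow> (rs_map f1 \<circ> fst) ` U = rs_map f2 ` snd ` U"
  using fp_open_map[of U] by (force simp: image_iff)

lemma germ_map1: "openin Z U \<Longrightarrow> germ_map X1 f1 (fst ` U) \<in> IY.sec U \<rightarrow> I1.sec U"
  using germ_map_hom[OF X1.presheaf Y.presheaf f1 fp_image1, of U] fp_imageY[of U]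
  by (auto intro: ring_hom_closed)

lemma germ_map2: "openin Z U \<Longrightarrow> germ_map X2 f2 (snd ` U) \<in> IY.sec U \<rightarrow> I2.sec U"
  using germ_map_hom[OF X2.presheaf Y.presheaf f2 fp_image2, of U] fp_imageY2[of U]
  by (auto intro: ring_hom_closed)

lemma germ_map1_res:
  assumes U: "openin Z U" and V: "openin Z V" and sub: "V \<subseteq> U" and c: "c \<in> IY.sec U"
  shows "germ_map X1 f1 (fst ` V) (res invY U V c) = res inv1 U V (germ_map X1 f1 (fst ` U) c)"
proof -
  have "c \<in> carrier (Y.germs (rs_map f1 ` fst ` U))"
    using c unfolding Y.inverse_image_simps fp_imageY[of U] .
  then show ?thesis
    unfolding X1.inverse_image_simps Y.inverse_image_simps fp_imageY[of U] fp_imageY[of V]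
    by (rule germ_map_restrict[OF X1.presheaf Y.presheaf f1 fp_image1[OF U] image_mono[OF sub]])
qed

lemma germ_map2_res:
  assumes U: "openin Z U" and V: "openin Z V" and sub: "V \<subseteq> U" and c: "c \<in> IY.sec U"
  shows "germ_map X2 f2 (snd ` V) (res invY U V c) = res inv2 U V (germ_map X2 f2 (snd ` U) c)"
proof -
  have "c \<in> carrier (Y.germs (rs_map f2 ` snd ` U))"
    using c unfolding Y.inverse_image_simps fp_imageY2[OF U] .
  then show ?thesis
    unfolding X2.inverse_image_simps Y.inverse_image_simps fp_imageY2[OF U] fp_imageY2[OF V]
    by (rule germ_map_restrict[OF X2.presheaf Y.presheaf f2 fp_image2[OF U] image_mono[OF sub]])
qed

lemmas base1_facts = IY.presheaf I1.presheaf germ_map1 germ_map1_res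
lemmas base2_facts = IY.presheaf I2.presheaf germ_map2 germ_map2_res

lemma base1_closed: "openin Z U \<Longrightarrow> b1 U \<in> FY.sec U \<rightarrow> F1.sec U"
  unfolding fp_base1_def by (rule sheafify_map_closed[OF base1_facts])

lemma base2_closed: "openin Z U \<Longrightarrow> b2 U \<in> FY.sec U \<rightarrow> F2.sec U"
  unfolding fp_base2_def by (rule sheafify_map_closed[OF base2_facts])

abbreviation "TP \<equiv> tensor_presheaf FY F1 F2 b1 b2"
abbreviation "pt U \<equiv> pure_tensor (sections FY U) (sections F1 U) (sections F2 U) (b1 U) (b2 U)"
abbreviation "TR U \<equiv> tensor_ring (sections FY U) (sections F1 U) (sections F2 U) (b1 U) (b2 U)"

lemma base_facts:
  "is_presheaf Z F1" "is_presheaf Z F2"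
  "\<And>U V. openin Z U \<Longrightarrow> openin Z V \<Longrightarrow> V \<subseteq> U \<Longrightarrow> res FY U V \<in> FY.sec U \<rightarrow> FY.sec V"
  "\<And>U. openin Z U \<Longrightarrow> b1 U \<in> FY.sec U \<rightarrow> F1.sec U"
  "\<And>U. openin Z U \<Longrightarrow> b2 U \<in> FY.sec U \<rightarrow> F2.sec U"
  "\<And>U V c. openin Z U \<Longrightarrow> openin Z V \<Longrightarrow> V \<subseteq> U \<Longrightarrow> c \<in> FY.sec U \<Longrightarrow> b1 V (res FY U V c) = res F1 U V (b1 U c)"
  "\<And>U V c. openin Z U \<Longrightarrow> openin Z V \<Longrightarrow> V \<subseteq> U \<Longrightarrow> c \<in> FY.sec U \<Longrightarrow> b2 V (res FY U V c) = res F2 U V (b2 U c)"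
  using F1.presheaf F2.presheaf FY.res_closed base1_closed base2_closed
  by (auto simp: sheafify_map_res fp_base1_def fp_base2_def)

lemma fp_presheaf_eq: "fp_presheaf X1 X2 Y f1 f2 = TP"
  by (simp add: fp_presheaf_def fp_sheaf_eqs)

lemma fp_tensor_eq: "fp_tensor X1 X2 Y f1 f2 U = pt U"
  by (simp add: fp_tensor_def fp_sheaf_eqs)

lemma TP_sections: "sections TP U = TR U"
  by (simp add: tensor_presheaf_def)

sublocale TP: presheaf_on Z TP by unfold_locales (rule tensor_is_presheaf[where T = Z and H = FY and F = F1 and G = F2 and \<alpha> = b1 and \<beta> = b2, OF base_facts])

lemma TP_res_hom:
  "openin Z U \<Longrightarrow> openin Z V \<Longrightarrow> V \<subseteq> U \<Longrightarrow> res TP U V \<in> ring_hom (TR U) (TR V)"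
  by (rule tensor_res_hom[where T = Z and H = FY and F = F1 and G = F2 and \<alpha> = b1 and \<beta> = b2, OF base_facts])

lemma TP_res_pure:
  "openin Z U \<Longrightarrow> openin Z V \<Longrightarrow> V \<subseteq> U \<Longrightarrow> a \<in> F1.sec U \<Longrightarrow> b \<in> F2.sec U \<Longrightarrow>
    res TP U V (pt U a b) = pt V (res F1 U V a) (res F2 U V b)"
  by (rule tensor_res_pure[where T = Z and H = FY and F = F1 and G = F2 and \<alpha> = b1 and \<beta> = b2, OF base_facts])

lemma TP_homs_eqI:
  assumes "openin Z U" "ring D" "h \<in> ring_hom (TR U) D" "k \<in> ring_hom (TR U) D"
    and "\<And>a b. a \<in> F1.sec U \<Longrightarrow> b \<in> F2.sec U \<Longrightarrow> h (pt U a b) = k (pt U a b)" "t \<in> carrier (TR U)"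
  shows "h t = k t"
  by (rule tensor_homs_eqI[where T = Z and H = FY and F = F1 and G = F2 and \<alpha> = b1 and \<beta> = b2, OF base_facts]) (use assms in blast)+

lemmas TR_rules = F1.sections_cring F2.sections_cring base1_closed base2_closed

abbreviation "F \<equiv> rs_fibered_product X1 X2 Y f1 f2"

lemma F_simps [simp]: "rs_top F = Z" "rs_sheaf F = sheafify Z TP"
  by (simp_all add: rs_fibered_product_def fp_presheaf_eq)

lemma F_ringed: "is_ringed_space F"
  by (simp add: is_ringed_space_def TP.sheafify_sheaf)

sublocale F: sheaf_on Z "sheafify Z TP" by (rule sheaf_onI[OF TP.sheafify_sheaf])

end

lemma sheafify_map_unit:
  assumes "is_presheaf T F" "is_presheaf T G"
    and "\<And>U. openin T U \<Longrightarrow> \<phi> U \<in> carrier (sections F U) \<rightarrow> carrier (sections G U)"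
    and "\<And>U V s. openin T U \<Longrightarrow> openin T V \<Longrightarrow> V \<subseteq> U \<Longrightarrow> s \<in> carrier (sections F U) \<Longrightarrow>
      \<phi> V (res F U V s) = res G U V (\<phi> U s)"
    and U: "openin T U" "t \<in> carrier (sections F U)"
  shows "sheafify_map T G \<phi> U (sheafify_unit T F U t) = sheafify_unit T G U (\<phi> U t)"
proof (rule extensionalityI[of _ U])
  fix x assume "x \<in> U"
  moreover have "restrict (sheafify_unit T F U t) U = sheafify_unit T F U t"
    by (simp add: sheafify_unit_def)
  ultimately show "sheafify_map T G \<phi> U (sheafify_unit T F U t) x = sheafify_unit T G U (\<phi> U t) x"
    using sheafify_map_apply[OF assms, of "sheafify_unit T F U t" x U] by (simp add: sheafify_unit_def)
qed (simp_all add: sheafify_map_def sheafify_unit_def)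

section \<open>Projections from homomorphisms out of an inverse image sheaf\<close>

context
  fixes A :: "('b, 'g) ringed_space" and B :: "('a, 'r) ringed_space" and f :: "'b \<Rightarrow> 'a"
    and p :: "('b, 'g, 'a, 'r) rs_morphism"
    and j :: "'b set \<Rightarrow> ('b \<Rightarrow> ('b, ('a, 'r) germ) germ) \<Rightarrow> 'g"
  assumes A: "is_presheaf (rs_top A) (rs_sheaf A)" and B: "is_presheaf (rs_top B) (rs_sheaf B)"
    and f: "continuous_map (rs_top A) (rs_top B) f"
    and j_hom: "\<And>U. openin (rs_top A) U \<Longrightarrow>
      j U \<in> ring_hom (sections (inverse_image (rs_top A) f (rs_top B) (rs_sheaf B)) U) (rs_sections A U)"
    and j_res: "\<And>U V a. openin (rs_top A) U \<Longrightarrow> openin (rs_top A) V \<Longrightarrow> V \<subseteq> U \<Longrightarrow>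
      a \<in> carrier (sections (inverse_image (rs_top A) f (rs_top B) (rs_sheaf B)) U) \<Longrightarrow>
      res (rs_sheaf A) U V (j U a) = j V (restrict a V)"
    and map: "rs_map p = restrict f (rs_points A)"
    and comap: "rs_comap p = (\<lambda>W \<in> {W. openin (rs_top B) W}. \<lambda>s \<in> carrier (rs_sections B W).
      j {z \<in> rs_points A. f z \<in> W}
        (presheaf_on.pull (rs_top B) (rs_sheaf B) f (rs_top A) {z \<in> rs_points A. f z \<in> W} W s))"
begin

interpretation A: presheaf_on "rs_top A" "rs_sheaf A" by unfold_locales (rule A)
interpretation B: presheaf_on "rs_top B" "rs_sheaf B" by unfold_locales (rule B)

private abbreviation (input) "fpre W \<equiv> {z \<in> rs_points A. f z \<in> W}"
private abbreviation (input) "pl \<equiv> B.pull f (rs_top A)"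

private lemma fc: "f \<in> rs_points A \<rightarrow> rs_points B"
  using f by (auto simp: continuous_map_def)

private lemma fpre_open: "openin (rs_top B) W \<Longrightarrow> openin (rs_top A) (fpre W)"
  using f by (simp add: continuous_map_def)

private lemma fpre_nbhd: "openin (rs_top B) W \<Longrightarrow> B.nbhd (f ` fpre W) W"
  by (auto simp: B.nbhd_def)

private lemma preimage: "rs_preimage A p W = fpre W"
  by (auto simp: rs_preimage_def map)

private lemma comap_eq: "openin (rs_top B) W \<Longrightarrow> s \<in> B.sec W \<Longrightarrow> rs_comap p W s = j (fpre W) (pl (fpre W) W s)"
  by (simp add: comap)

private lemma pull_in: "openin (rs_top A) U \<Longrightarrow> B.nbhd (f ` U) W \<Longrightarrow> s \<in> B.sec W \<Longrightarrow>
    pl U W s \<in> carrier (sections (inverse_image (rs_top A) f (rs_top B) (rs_sheaf B)) U)"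
  unfolding inverse_image_def by (rule B.pull_closed[OF fc])

private lemma comap_res:
  assumes W: "openin (rs_top B) W" "s \<in> B.sec W" and V: "openin (rs_top A) V" "V \<subseteq> fpre W"
  shows "res (rs_sheaf A) (fpre W) V (rs_comap p W s) = j V (pl V W s)"
  unfolding comap_eq[OF W] j_res[OF fpre_open[OF W(1)] V pull_in[OF fpre_open[OF W(1)] fpre_nbhd[OF W(1)] W(2)]]
    B.pull_restrict[OF fc fpre_open[OF W(1)] V fpre_nbhd[OF W(1)] W(2)] ..

text \<open>This is the passage, by adjunction, from a map \<open>j\<close> of sheaves of rings out
  of the inverse image to a morphism of ringed spaces. The two projections are the cases
  \<open>a \<mapsto> a \<otimes> 1\<close> and \<open>b \<mapsto> 1 \<otimes> b\<close> of
  \<open>j\<close>.\<close>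

lemma pull_rs_hom: "p \<in> rs_hom A B"
  unfolding rs_hom_def mem_Collect_eq preimage
proof (intro conjI allI impI ballI)
  show "continuous_map (rs_top A) (rs_top B) (rs_map p)"
    by (rule continuous_map_eq[OF f]) (simp add: map)
  fix V assume V: "openin (rs_top B) V"
  have "(\<lambda>s. j (fpre V) (pl (fpre V) V s)) \<in> ring_hom (rs_sections B V) (rs_sections A (fpre V))"
    by (rule ring_hom_comp[OF B.pull_hom[OF fc fpre_open[OF V] fpre_nbhd[OF V]]
      j_hom[OF fpre_open[OF V], unfolded inverse_image_def]])
  then show "rs_comap p V \<in> ring_hom (rs_sections B V) (rs_sections A (fpre V))"
    by (rule ring_hom_cong[OF _ B.sections_ring[OF V]]) (rule comap_eq[OF V])
next
  fix U V s assume UV: "openin (rs_top B) U \<and> openin (rs_top B) V \<and> V \<subseteq> U" and s: "s \<in> B.sec U"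
  then have *: "openin (rs_top B) U" "openin (rs_top B) V" "V \<subseteq> U" by auto
  have "pl (fpre V) V (res (rs_sheaf B) U V s) = pl (fpre V) U s"
    by (rule B.pull_res[OF fc * _ s]) auto
  moreover have "res (rs_sheaf A) (fpre U) (fpre V) (rs_comap p U s) = j (fpre V) (pl (fpre V) U s)"
    by (rule comap_res[OF *(1) s fpre_open[OF *(2)]]) (use *(3) in auto)
  ultimately show "rs_comap p V (res (rs_sheaf B) U V s) = res (rs_sheaf A) (fpre U) (fpre V) (rs_comap p U s)"
    using comap_eq[OF *(2) B.res_closed[OF * s]] by simp
qed (simp_all add: map comap)

lemma pull_stalk_map:
  assumes W: "openin (rs_top B) W" "f z \<in> W" "s \<in> B.sec W" and z: "z \<in> rs_points A"
  shows "stalk_map A p z (B.germ {f z} W s) = A.germ {z} (fpre W) (j (fpre W) (pl (fpre W) W s))"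
  using stalk_map_germ[OF A B pull_rs_hom z W(1) _ W(3)] z W(2) by (simp add: map preimage comap_eq W)

text \<open>Near \<open>z\<close> the section \<open>a\<close> is pulled back from a section of
  \<open>B\<close>, and \<open>j\<close> of a pulled back section is a restriction of its image
  under \<open>p\<close>.\<close>

lemma pull_stalk_rep:
  assumes V: "openin (rs_top A) V" "z \<in> V"
    and a: "a \<in> carrier (sections (inverse_image (rs_top A) f (rs_top B) (rs_sheaf B)) V)"
  shows "\<exists>c \<in> carrier (stalk B (f z)). A.germ {z} V (j V a) = stalk_map A p z c"
proof -
  obtain U W s where U: "openin (rs_top A) U" "z \<in> U" "U \<subseteq> V" "openin (rs_top B) W" "f ` U \<subseteq> W" "s \<in> B.sec W"
    "restrict a U = pl U W s"
    by (rule B.pull_rep[OF fc V(1) a[unfolded inverse_image_def] V(2)])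
  have sub: "U \<subseteq> fpre W" using U(5) openin_subset[OF U(1)] by auto
  have zA: "z \<in> rs_points A" "f z \<in> W" using sub U(2) by auto
  note pc = rs_comap_closed[OF pull_rs_hom U(4,6), unfolded preimage]
  have "A.germ {z} V (j V a) = A.germ {z} U (res (rs_sheaf A) V U (j V a))"
    by (rule A.germ_res[symmetric]) (use V U a ring_hom_closed[OF j_hom] in auto)
  also have "\<dots> = A.germ {z} U (res (rs_sheaf A) (fpre W) U (rs_comap p W s))"
    unfolding j_res[OF V(1) U(1,3) a] U(7) comap_res[OF U(4,6,1) sub] ..
  also have "\<dots> = A.germ {z} (fpre W) (rs_comap p W s)"
    by (rule A.germ_res) (use fpre_open[OF U(4)] U zA sub pc in auto)
  also have "\<dots> = stalk_map A p z (B.germ {f z} W s)"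
    using pull_stalk_map[OF U(4) zA(2) U(6) zA(1)] comap_eq[OF U(4,6)] by simp
  finally show ?thesis
    using B.germ_closed[of "{f z}" W s] U(4,6) zA(2) by (auto simp: stalk_def)
qed

end

section \<open>The projections of the fibered product\<close>

context rs_cospan
begin

abbreviation "\<pi>1 \<equiv> rs_proj1 X1 X2 Y f1 f2"
abbreviation "\<pi>2 \<equiv> rs_proj2 X1 X2 Y f1 f2"
abbreviation "one1 U \<equiv> \<one>\<^bsub>sections F1 U\<^esub>"
abbreviation "one2 U \<equiv> \<one>\<^bsub>sections F2 U\<^esub>"
abbreviation "e1 \<equiv> X1.pull fst Z"
abbreviation "e2 \<equiv> X2.pull snd Z"
abbreviation "pre1 W \<equiv> {z \<in> topspace Z. fst z \<in> W}"
abbreviation "pre2 W \<equiv> {z \<in> topspace Z. snd z \<in> W}"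

lemma base1_apply:
  "openin Z V \<Longrightarrow> t \<in> IY.sec V \<Longrightarrow> restrict s V = IY.unit V t \<Longrightarrow> x \<in> V \<Longrightarrow> x \<in> U \<Longrightarrow>
    b1 U s x = I1.germ {x} V (germ_map X1 f1 (fst ` V) t)"
  unfolding fp_base1_def by (rule sheafify_map_apply[OF base1_facts])

lemma base1_unit:
  "openin Z U \<Longrightarrow> t \<in> IY.sec U \<Longrightarrow> b1 U (IY.unit U t) = I1.unit U (germ_map X1 f1 (fst ` U) t)"
  unfolding fp_base1_def by (rule sheafify_map_unit[OF base1_facts])

lemma base2_apply:
  "openin Z V \<Longrightarrow> t \<in> IY.sec V \<Longrightarrow> restrict s V = IY.unit V t \<Longrightarrow> x \<in> V \<Longrightarrow> x \<in> U \<Longrightarrow>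
    b2 U s x = I2.germ {x} V (germ_map X2 f2 (snd ` V) t)"
  unfolding fp_base2_def by (rule sheafify_map_apply[OF base2_facts])

lemma base2_unit:
  "openin Z U \<Longrightarrow> t \<in> IY.sec U \<Longrightarrow> b2 U (IY.unit U t) = I2.unit U (germ_map X2 f2 (snd ` U) t)"
  unfolding fp_base2_def by (rule sheafify_map_unit[OF base2_facts])

definition "j1 U a = TP.unit U (pt U a (one2 U))"
definition "j2 U b = TP.unit U (pt U (one1 U) b)"

lemma one1_closed: "openin Z U \<Longrightarrow> one1 U \<in> F1.sec U" and one2_closed: "openin Z U \<Longrightarrow> one2 U \<in> F2.sec U"
  using ring.ring_simprules(6)[OF F1.sections_ring] ring.ring_simprules(6)[OF F2.sections_ring] by blast+

lemma pt_closed: "openin Z U \<Longrightarrow> a \<in> F1.sec U \<Longrightarrow> b \<in> F2.sec U \<Longrightarrow> pt U a b \<in> carrier (TR U)"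
  by (rule pure_tensor_closed[OF TR_rules])

lemma unit_pt_restrict:
  assumes "openin Z U" "openin Z V" "V \<subseteq> U" "a \<in> F1.sec U" "b \<in> F2.sec U"
  shows "restrict (TP.unit U (pt U a b)) V = TP.unit V (pt V (res F1 U V a) (res F2 U V b))"
  using assms TP_res_pure[OF assms]
  by (simp add: TP.unit_res TP_sections pt_closed)

lemma j1_hom: "openin Z U \<Longrightarrow> j1 U \<in> ring_hom (sections F1 U) (sections (sheafify Z TP) U)"
  and j2_hom: "openin Z U \<Longrightarrow> j2 U \<in> ring_hom (sections F2 U) (sections (sheafify Z TP) U)"
  using ring_hom_comp[OF pure_tensor_hom1[OF TR_rules] TP.unit_hom[unfolded TP_sections], of U]
    ring_hom_comp[OF pure_tensor_hom2[OF TR_rules] TP.unit_hom[unfolded TP_sections], of U]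
  unfolding j1_def[abs_def] j2_def[abs_def] by blast+

lemma j1_res:
  assumes "openin Z U" "openin Z V" "V \<subseteq> U" "a \<in> F1.sec U"
  shows "res (sheafify Z TP) U V (j1 U a) = j1 V (restrict a V)"
  using unit_pt_restrict[OF assms one2_closed[OF assms(1)]] ring_hom_one[OF F2.res_hom[OF assms(1-3)]]
  by (simp add: j1_def del: I2.sheafify_simps I2.sheafify_res)

lemma j2_res:
  assumes "openin Z U" "openin Z V" "V \<subseteq> U" "b \<in> F2.sec U"
  shows "res (sheafify Z TP) U V (j2 U b) = j2 V (restrict b V)"
  using unit_pt_restrict[OF assms(1-3) one1_closed[OF assms(1)] assms(4)] ring_hom_one[OF F1.res_hom[OF assms(1-3)]]
  by (simp add: j2_def del: I1.sheafify_simps I1.sheafify_res)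

lemma proj1_map: "z \<in> topspace Z \<Longrightarrow> rs_map \<pi>1 z = fst z"
  and proj2_map: "z \<in> topspace Z \<Longrightarrow> rs_map \<pi>2 z = snd z"
  by (simp_all add: rs_proj1_def rs_proj2_def)

text \<open>The assumptions of the adjunction, in their order, with the comap of the projection
  rewritten as \<open>j1\<close> of a pullback.\<close>

lemma proj1_facts:
  "is_presheaf (rs_top F) (rs_sheaf F)" "is_presheaf (rs_top X1) (rs_sheaf X1)"
  "continuous_map (rs_top F) (rs_top X1) fst"
  "\<And>U. openin (rs_top F) U \<Longrightarrow> j1 U \<in> ring_hom (sections (inverse_image (rs_top F) fst (rs_top X1) (rs_sheaf X1)) U) (rs_sections F U)"
  "\<And>U V a. openin (rs_top F) U \<Longrightarrow> openin (rs_top F) V \<Longrightarrow> V \<subseteq> U \<Longrightarrow>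
    a \<in> carrier (sections (inverse_image (rs_top F) fst (rs_top X1) (rs_sheaf X1)) U) \<Longrightarrow>
    res (rs_sheaf F) U V (j1 U a) = j1 V (restrict a V)"
  "rs_map \<pi>1 = restrict fst (rs_points F)"
  "rs_comap \<pi>1 = (\<lambda>W \<in> {W. openin (rs_top X1) W}. \<lambda>s \<in> X1.sec W.
    j1 {z \<in> rs_points F. fst z \<in> W} (X1.pull fst (rs_top F) {z \<in> rs_points F. fst z \<in> W} W s))"
  unfolding F_simps inverse_image_def
  using TP.sheafify_sheaf X1.presheaf continuous_fst j1_hom j1_res
  by (auto simp: is_sheaf_def rs_proj1_def fp_presheaf_eq fp_tensor_eq fp_sheaf_eqs Let_def j1_def X1.pull_def
      simp del: I2.sheafify_simps TP.sheafify_res)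

lemma proj2_facts:
  "is_presheaf (rs_top F) (rs_sheaf F)" "is_presheaf (rs_top X2) (rs_sheaf X2)"
  "continuous_map (rs_top F) (rs_top X2) snd"
  "\<And>U. openin (rs_top F) U \<Longrightarrow> j2 U \<in> ring_hom (sections (inverse_image (rs_top F) snd (rs_top X2) (rs_sheaf X2)) U) (rs_sections F U)"
  "\<And>U V a. openin (rs_top F) U \<Longrightarrow> openin (rs_top F) V \<Longrightarrow> V \<subseteq> U \<Longrightarrow>
    a \<in> carrier (sections (inverse_image (rs_top F) snd (rs_top X2) (rs_sheaf X2)) U) \<Longrightarrow>
    res (rs_sheaf F) U V (j2 U a) = j2 V (restrict a V)"
  "rs_map \<pi>2 = restrict snd (rs_points F)"
  "rs_comap \<pi>2 = (\<lambda>W \<in> {W. openin (rs_top X2) W}. \<lambda>s \<in> X2.sec W.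
    j2 {z \<in> rs_points F. snd z \<in> W} (X2.pull snd (rs_top F) {z \<in> rs_points F. snd z \<in> W} W s))"
  unfolding F_simps inverse_image_def
  using TP.sheafify_sheaf X2.presheaf continuous_snd j2_hom j2_res
  by (auto simp: is_sheaf_def rs_proj2_def fp_presheaf_eq fp_tensor_eq fp_sheaf_eqs Let_def j2_def X2.pull_def
      simp del: I1.sheafify_simps TP.sheafify_res)

lemma proj1_comap: "openin (rs_top X1) W \<Longrightarrow> a \<in> X1.sec W \<Longrightarrow> rs_comap \<pi>1 W a = j1 (pre1 W) (e1 (pre1 W) W a)"
  and proj2_comap: "openin (rs_top X2) W' \<Longrightarrow> b \<in> X2.sec W' \<Longrightarrow> rs_comap \<pi>2 W' b = j2 (pre2 W') (e2 (pre2 W') W' b)"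
  by (simp_all add: proj1_facts(7) proj2_facts(7))

lemma proj1_hom: "\<pi>1 \<in> rs_hom F X1"
  by (rule pull_rs_hom[OF proj1_facts])

lemma proj2_hom: "\<pi>2 \<in> rs_hom F X2"
  by (rule pull_rs_hom[OF proj2_facts])

text \<open>A section of \<open>Y\<close> pulls back to a scalar \<open>?c\<close> in
  \<open>FY\<close>. The two composites send it to that scalar acting on the left and on the right
  factor of 1 \<otimes> 1, and the relations of the tensor product identify these.\<close>

lemma proj_commute: "rs_comp F X1 Y f1 \<pi>1 = rs_comp F X2 Y f2 \<pi>2"
proof (rule rs_hom_eqI[OF rs_comp_closed[OF F_ringed Y proj1_hom f1] rs_comp_closed[OF F_ringed Y proj2_hom f2]])
  fix z assume "z \<in> rs_points F"
  then show "rs_map (rs_comp F X1 Y f1 \<pi>1) z = rs_map (rs_comp F X2 Y f2 \<pi>2) z"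
    by (auto simp: rs_comp_simps proj1_map proj2_map fp_topspace)
next
  fix W s assume W: "openin (rs_top Y) W" "s \<in> Y.sec W"
  define U where "U = pre1 (rs_preimage X1 f1 W)"
  \<comment> \<open>Both comaps are taken over the same open set, because the preimages of
    \<open>W\<close> through \<open>X1\<close> and through \<open>X2\<close> coincide on the fibered
    product.\<close>
  have U2: "pre2 (rs_preimage X2 f2 W) = U"
    by (auto simp: U_def rs_preimage_def fp_topspace)
  note W1 = rs_preimage_open[OF f1 W(1)] and W2 = rs_preimage_open[OF f2 W(1)]
  note s1 = rs_comap_closed[OF f1 W] and s2 = rs_comap_closed[OF f2 W]
  have o: "openin Z U" unfolding U_def using continuous_fst W1 by (simp add: continuous_map_def)
  let ?c = "IY.unit U (Y.germ ((rs_map f1 \<circ> fst) ` U) W s)"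
  have n: "Y.nbhd ((rs_map f1 \<circ> fst) ` U) W" using W by (auto simp: Y.nbhd_def U_def rs_preimage_def)
  have g: "Y.germ ((rs_map f1 \<circ> fst) ` U) W s \<in> IY.sec U"
    using Y.germ_closed[OF n W(2)] by simp
  have c: "?c \<in> FY.sec U" by (rule IY.unit_closed[OF o g])
  have b1: "b1 U ?c = e1 U (rs_preimage X1 f1 W) (rs_comap f1 W s)"
    unfolding base1_unit[OF o g] X1.pull_def
    using germ_map_germ[OF X1.presheaf Y.presheaf f1 fp_image1[OF o], of W s] n W
    by (simp add: fp_imageY[of U, symmetric])
  have b2: "b2 U ?c = e2 U (rs_preimage X2 f2 W) (rs_comap f2 W s)"
    unfolding base2_unit[OF o g] X2.pull_def
    using germ_map_germ[OF X2.presheaf Y.presheaf f2 fp_image2[OF o], of W s] n W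
    by (simp add: fp_imageY2[OF o, symmetric])
  have c1: "b1 U ?c \<in> F1.sec U" and c2: "b2 U ?c \<in> F2.sec U"
    using base1_closed[OF o] base2_closed[OF o] c by auto
  have "b1 U ?c \<otimes>\<^bsub>sections F1 U\<^esub> one1 U = b1 U ?c" "b2 U ?c \<otimes>\<^bsub>sections F2 U\<^esub> one2 U = b2 U ?c"
    by (intro monoid.r_one[OF ring.is_monoid] F1.sections_ring F2.sections_ring c1 c2 o)+
  then have "pt U (b1 U ?c) (one2 U) = pt U (one1 U) (b2 U ?c)"
    using pure_tensor_base[OF TR_rules[OF o] c one1_closed[OF o] one2_closed[OF o]] by (simp only:)
  then show "rs_comap (rs_comp F X1 Y f1 \<pi>1) W s = rs_comap (rs_comp F X2 Y f2 \<pi>2) W s"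
    using W by (simp only: rs_comp_simps proj1_comap[OF W1 s1] proj2_comap[OF W2 s2] U2 U_def[symmetric] b1 b2 j1_def j2_def)
qed

section \<open>Stalks of the fibered product: generators, and extension of homomorphisms\<close>

lemma unit_hom: "openin Z V \<Longrightarrow> TP.unit V \<in> ring_hom (TR V) (sections (sheafify Z TP) V)"
  using TP.unit_hom[of V] by (simp add: TP_sections)

text \<open>A section of the sheafification is locally a tensor, pure tensors generate the tensors
  additively, and a pure tensor is the product of \<open>a \<otimes> 1\<close> and
  \<open>1 \<otimes> b\<close>, whose germs come from the two stalks by
  \<open>pull_stalk_rep\<close>.\<close>

lemma fp_stalk_induct [consumes 2, case_names proj1 proj2 add mult uminus]:
  assumes z: "z \<in> topspace Z" and c: "c \<in> carrier (stalk F z)"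
    and proj1: "\<And>a. a \<in> carrier (stalk X1 (fst z)) \<Longrightarrow> P (stalk_map F \<pi>1 z a)"
    and proj2: "\<And>b. b \<in> carrier (stalk X2 (snd z)) \<Longrightarrow> P (stalk_map F \<pi>2 z b)"
    and add: "\<And>c d. c \<in> carrier (stalk F z) \<Longrightarrow> d \<in> carrier (stalk F z) \<Longrightarrow> P c \<Longrightarrow> P d \<Longrightarrow> P (c \<oplus>\<^bsub>stalk F z\<^esub> d)"
    and mult: "\<And>c d. c \<in> carrier (stalk F z) \<Longrightarrow> d \<in> carrier (stalk F z) \<Longrightarrow> P c \<Longrightarrow> P d \<Longrightarrow> P (c \<otimes>\<^bsub>stalk F z\<^esub> d)"
    and uminus: "\<And>c. c \<in> carrier (stalk F z) \<Longrightarrow> P c \<Longrightarrow> P (\<ominus>\<^bsub>stalk F z\<^esub> c)"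
  shows "P c"
proof -
  note st = stalk_def[of F z, unfolded F_simps]
  obtain U s where U: "openin Z U" "z \<in> U" "s \<in> F.sec U" "c = F.germ {z} U s"
    by (rule F.germ_cases_point[OF c[unfolded st]])
  obtain V t where V: "openin Z V" "z \<in> V" "V \<subseteq> U" "t \<in> TP.sec V" "restrict s V = TP.unit V t"
    by (rule TP.sheafify_rep[OF U(1,3,2)])
  have cV: "c = F.germ {z} V (TP.unit V t)"
    using F.germ_res[of "{z}" U s V] U V by simp
  let ?g = "\<lambda>t. F.germ {z} V (TP.unit V t)"
  have g: "?g \<in> ring_hom (TR V) (stalk F z)"
    unfolding st by (rule ring_hom_comp[OF unit_hom[OF V(1)] F.germ_hom]) (use V in simp)
  note gc = ring_hom_closed[OF g]
  have "P (?g t)" using V(4)[unfolded TP_sections]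
  proof (induction rule: tensor_induct[OF TR_rules[OF V(1)], consumes 1, case_names pure add uminus])
    case (pure a b)
    note one = one1_closed[OF V(1)] one2_closed[OF V(1)]
    obtain x where "x \<in> carrier (stalk X1 (fst z))" "?g (pt V a (one2 V)) = stalk_map F \<pi>1 z x"
      using pull_stalk_rep[OF proj1_facts, of V z a] V(1,2) pure(1)
      by (auto simp: inverse_image_def j1_def simp del: I2.sheafify_simps)
    moreover obtain y where "y \<in> carrier (stalk X2 (snd z))" "?g (pt V (one1 V) b) = stalk_map F \<pi>2 z y"
      using pull_stalk_rep[OF proj2_facts, of V z b] V(1,2) pure(2)
      by (auto simp: inverse_image_def j2_def simp del: I1.sheafify_simps)
    ultimately show ?case
      unfolding pure_tensor_split[OF TR_rules[OF V(1)] pure]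
        ring_hom_mult[OF g pt_closed[OF V(1) pure(1) one(2)] pt_closed[OF V(1) one(1) pure(2)]]
      using mult[OF gc[OF pt_closed[OF V(1) pure(1) one(2)]] gc[OF pt_closed[OF V(1) one(1) pure(2)]]] proj1 proj2
      by simp
  next
    case (add s t)
    then show ?case unfolding ring_hom_add[OF g add(1,2)] by (intro assms(5) gc)
  next
    case (uminus s)
    have R: "ring (TR V)" "ring (stalk F z)"
      using tensor_ring_cring[OF TR_rules[OF V(1)]] stalk_cring[OF F_ringed, of z] z by (auto intro: cring.axioms(1))
    show ?case unfolding ring_hom_uminus[OF R g uminus(1)] by (intro assms(7) gc uminus)
  qed
  then show ?thesis by (simp add: cV)
qed

text \<open>Near \<open>z\<close> the scalar \<open>c\<close> is pulled back from a section
  \<open>s\<close> over an open set \<open>W\<close> of \<open>Y\<close>. One germ, that of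
  \<open>s\<close>, accounts for both sides, which turns compatibility on the stalk of
  \<open>Y\<close> into compatibility on \<open>FY\<close>.\<close>

lemma collapse_base:
  assumes V: "openin Z V" "z \<in> V" and c: "c \<in> FY.sec V"
  shows "\<exists>e \<in> carrier (stalk Y (rs_map f1 (fst z))).
    X1.collapse fst z (b1 V c z) = stalk_map X1 f1 (fst z) e \<and>
    X2.collapse snd z (b2 V c z) = stalk_map X2 f2 (snd z) e"
proof -
  obtain U d where U: "openin Z U" "z \<in> U" "U \<subseteq> V" "d \<in> IY.sec U" "restrict c U = IY.unit U d"
    by (rule IY.sheafify_rep[OF V(1) c V(2)])
  have "d \<in> carrier (Y.germs ((rs_map f1 \<circ> fst) ` U))" using U(4) by simp
  then obtain W s where W: "Y.nbhd ((rs_map f1 \<circ> fst) ` U) W" "s \<in> Y.sec W"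
      "d = Y.germ ((rs_map f1 \<circ> fst) ` U) W s" by (rule Y.germ_cases)
  note W1 = W[unfolded fp_imageY] and W2 = W[unfolded fp_imageY2[OF U(1)]]
  have oW: "openin (rs_top Y) W" using W(1) by (simp add: Y.nbhd_def)
  have zW: "rs_map f1 (fst z) \<in> W" using W(1) U(2) by (auto simp: Y.nbhd_def)
  have zz: "rs_map f1 (fst z) = rs_map f2 (snd z)" by (rule fp_open_map[OF V])
  have zZ: "z \<in> topspace Z" using V openin_subset by blast
  have p1: "fst z \<in> rs_points X1" and p2: "snd z \<in> rs_points X2" using zZ by (auto simp: fp_topspace)
  have n1: "X1.nbhd (fst ` U) (rs_preimage X1 f1 W)"
    using W1(1) fp_image1[OF U(1)] rs_preimage_open[OF f1 oW] by (auto simp: X1.nbhd_def Y.nbhd_def rs_preimage_def)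
  have n2: "X2.nbhd (snd ` U) (rs_preimage X2 f2 W)"
    using W2(1) fp_image2[OF U(1)] rs_preimage_open[OF f2 oW] by (auto simp: X2.nbhd_def Y.nbhd_def rs_preimage_def)
  have "b1 V c z = I1.germ {z} U (X1.germ (fst ` U) (rs_preimage X1 f1 W) (rs_comap f1 W s))"
    unfolding base1_apply[OF U(1,4,5,2) V(2)] W1(3)
    by (subst germ_map_germ[OF X1.presheaf Y.presheaf f1 fp_image1[OF U(1)] W1(1,2)]) (rule refl)
  then have 1: "X1.collapse fst z (b1 V c z) = X1.germ {fst z} (rs_preimage X1 f1 W) (rs_comap f1 W s)"
    using X1.collapse_germ[OF fst_closed U(1,2) n1 rs_comap_closed[OF f1 oW W(2)]] by simp
  have "b2 V c z = I2.germ {z} U (X2.germ (snd ` U) (rs_preimage X2 f2 W) (rs_comap f2 W s))"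
    unfolding base2_apply[OF U(1,4,5,2) V(2)] W2(3)
    by (subst germ_map_germ[OF X2.presheaf Y.presheaf f2 fp_image2[OF U(1)] W2(1,2)]) (rule refl)
  then have 2: "X2.collapse snd z (b2 V c z) = X2.germ {snd z} (rs_preimage X2 f2 W) (rs_comap f2 W s)"
    using X2.collapse_germ[OF snd_closed U(1,2) n2 rs_comap_closed[OF f2 oW W(2)]] by simp
  show ?thesis
  proof (intro bexI conjI)
    show "Y.germ {rs_map f1 (fst z)} W s \<in> carrier (stalk Y (rs_map f1 (fst z)))"
      unfolding stalk_def using oW zW W(2) by (intro Y.germ_closed) auto
    show "X1.collapse fst z (b1 V c z) = stalk_map X1 f1 (fst z) (Y.germ {rs_map f1 (fst z)} W s)"
      using 1 stalk_map_germ[OF X1.presheaf Y.presheaf f1 p1 oW zW W(2)] by simp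
    show "X2.collapse snd z (b2 V c z) = stalk_map X2 f2 (snd z) (Y.germ {rs_map f1 (fst z)} W s)"
      using 2 stalk_map_germ[OF X2.presheaf Y.presheaf f2 p2 oW _ W(2)] zW zz by simp
  qed
qed

text \<open>The existence part of the statement that the stalk of the fibered product is the tensor
  product of the stalks. Evaluating at \<open>z\<close> and collapsing turns \<open>a\<close> and
  \<open>b\<close> into homomorphisms on sections, the tensor product over each \<open>V\<close>
  combines them, and the colimit over \<open>V\<close> assembles them on the stalk.\<close>

lemma stalk_lift:
  assumes z: "z \<in> topspace Z" and D: "cring D"
    and a: "a \<in> ring_hom (stalk X1 (fst z)) D" and b: "b \<in> ring_hom (stalk X2 (snd z)) D"
    and ab: "\<And>c. c \<in> carrier (stalk Y (rs_map f1 (fst z))) \<Longrightarrow>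
      a (stalk_map X1 f1 (fst z) c) = b (stalk_map X2 f2 (snd z) c)"
  shows "\<exists>h \<in> ring_hom (stalk F z) D.
    (\<forall>c \<in> carrier (stalk X1 (fst z)). h (stalk_map F \<pi>1 z c) = a c) \<and>
    (\<forall>c \<in> carrier (stalk X2 (snd z)). h (stalk_map F \<pi>2 z c) = b c)"
proof -
  interpret D: cring D by (rule D)
  let ?f = "\<lambda>s. a (X1.collapse fst z (s z))" and ?g = "\<lambda>s. b (X2.collapse snd z (s z))"
  have f: "?f \<in> ring_hom (sections F1 V) D" if "openin Z V" "z \<in> V" for V
    by (rule ring_hom_comp[OF I1.eval_hom[OF that] ring_hom_comp[OF X1.collapse_hom[OF fst_closed z] a[unfolded stalk_def]]])
  have g: "?g \<in> ring_hom (sections F2 V) D" if "openin Z V" "z \<in> V" for V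
    by (rule ring_hom_comp[OF I2.eval_hom[OF that] ring_hom_comp[OF X2.collapse_hom[OF snd_closed z] b[unfolded stalk_def]]])
  have fg: "?f (b1 V c) = ?g (b2 V c)" if "openin Z V" "z \<in> V" "c \<in> FY.sec V" for V c
    using collapse_base[OF that] ab by auto
  \<comment> \<open>The condition on \<open>V\<close> stands under the quantifier so that one
    function \<open>\<phi>\<close> of all sets \<open>V\<close> can be chosen.\<close>
  have "\<exists>h. TP.nbhd {z} V \<longrightarrow> h \<in> ring_hom (TR V) D \<and>
      (\<forall>s\<in>F1.sec V. \<forall>t\<in>F2.sec V. h (pt V s t) = ?f s \<otimes>\<^bsub>D\<^esub> ?g t)" for V
  proof (cases "TP.nbhd {z} V")
    case True
    then have V: "openin Z V" "z \<in> V" by auto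
    have "\<exists>h\<in>ring_hom (TR V) D. \<forall>s\<in>F1.sec V. \<forall>t\<in>F2.sec V. h (pt V s t) = ?f s \<otimes>\<^bsub>D\<^esub> ?g t"
      by (rule tensor_lift_exists[OF TR_rules[OF V(1)] D f[OF V] g[OF V]]) (rule fg[OF V])
    then show ?thesis by blast
  next
    case False
    then show ?thesis by blast
  qed
  then obtain \<phi> where \<phi>: "\<And>V. TP.nbhd {z} V \<Longrightarrow> \<phi> V \<in> ring_hom (TR V) D"
    "\<And>V s t. TP.nbhd {z} V \<Longrightarrow> s \<in> F1.sec V \<Longrightarrow> t \<in> F2.sec V \<Longrightarrow> \<phi> V (pt V s t) = ?f s \<otimes>\<^bsub>D\<^esub> ?g t"
    by metis
  have "\<exists>h \<in> ring_hom (TP.germs {z}) D. \<forall>U s. TP.nbhd {z} U \<longrightarrow> s \<in> TP.sec U \<longrightarrow> h (TP.germ {z} U s) = \<phi> U s"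
  proof (rule TP.germ_lift_exists)
    fix U V s assume U: "TP.nbhd {z} U" and V: "TP.nbhd {z} V" and sub: "V \<subseteq> U" and s: "s \<in> TP.sec U"
    have o: "openin Z U" "openin Z V" "z \<in> V" using U V by auto
    \<comment> \<open>The homomorphisms \<open>\<phi> V\<close> were chosen independently. They are
      compatible because their values on pure tensors depend only on the values of the two sections
      at \<open>z\<close>.\<close>
    show "\<phi> V (res TP U V s) = \<phi> U s"
    proof (rule TP_homs_eqI[OF o(1) D.ring_axioms ring_hom_comp[OF TP_res_hom[OF o(1,2) sub] \<phi>(1)[OF V]] \<phi>(1)[OF U]])
      show "s \<in> carrier (TR U)" using s by (simp add: TP_sections)
      fix x y assume xy: "x \<in> F1.sec U" "y \<in> F2.sec U"
      show "\<phi> V (res TP U V (pt U x y)) = \<phi> U (pt U x y)"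
        unfolding TP_res_pure[OF o(1,2) sub xy]
        using \<phi>(2)[OF V F1.res_closed[OF o(1,2) sub xy(1)] F2.res_closed[OF o(1,2) sub xy(2)]]
          \<phi>(2)[OF U xy] o by simp
    qed
  qed (use z \<phi>(1) in \<open>auto simp: TP_sections\<close>)
  then obtain h1 where h1: "h1 \<in> ring_hom (TP.germs {z}) D"
    "\<And>U s. TP.nbhd {z} U \<Longrightarrow> s \<in> TP.sec U \<Longrightarrow> h1 (TP.germ {z} U s) = \<phi> U s" by blast
  \<comment> \<open>A section of the sheafification is a function into germs of the presheaf, so
    evaluation at \<open>z\<close> maps the stalk of the sheafification to that of the
    presheaf.\<close>
  have "\<exists>h \<in> ring_hom (F.germs {z}) (TP.germs {z}). \<forall>U s. F.nbhd {z} U \<longrightarrow> s \<in> F.sec U \<longrightarrow> h (F.germ {z} U s) = s z"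
    by (rule F.germ_lift_exists[where \<phi> = "\<lambda>U s. s z"]) (use z in \<open>auto intro: TP.eval_hom\<close>)
  then obtain h2 where h2: "h2 \<in> ring_hom (F.germs {z}) (TP.germs {z})"
    "\<And>U s. F.nbhd {z} U \<Longrightarrow> s \<in> F.sec U \<Longrightarrow> h2 (F.germ {z} U s) = s z" by blast
  have h12: "h1 (h2 (F.germ {z} U (TP.unit U (pt U s t)))) = ?f s \<otimes>\<^bsub>D\<^esub> ?g t"
    if U: "openin Z U" "z \<in> U" and st: "s \<in> F1.sec U" "t \<in> F2.sec U" for U s t
  proof -
    have "h2 (F.germ {z} U (TP.unit U (pt U s t))) = TP.germ {z} U (pt U s t)"
      using h2(2)[of U "TP.unit U (pt U s t)"] U ring_hom_closed[OF unit_hom[OF U(1)] pt_closed[OF U(1) st]]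
      by (simp add: TP.unit_germ)
    then show ?thesis
      using h1(2)[of U "pt U s t"] \<phi>(2)[of U s t] U st pt_closed[OF U(1) st] by (simp add: TP_sections)
  qed
  show ?thesis
  proof (intro bexI conjI ballI)
    show "(\<lambda>c. h1 (h2 c)) \<in> ring_hom (stalk F z) D"
      unfolding stalk_def F_simps by (rule ring_hom_comp[OF h2(1) h1(1)])
    fix c assume c: "c \<in> carrier (stalk X1 (fst z))"
    obtain W x where W: "openin (rs_top X1) W" "fst z \<in> W" "x \<in> X1.sec W" "c = X1.germ {fst z} W x"
      by (rule X1.germ_cases_point[OF c[unfolded stalk_def]])
    let ?U = "pre1 W"
    have U: "openin Z ?U" "z \<in> ?U" using continuous_fst W(1,2) z by (auto simp: continuous_map_def)
    have n: "X1.nbhd (fst ` ?U) W" using W(1) by (auto simp: X1.nbhd_def)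
    have "stalk_map F \<pi>1 z c = F.germ {z} ?U (TP.unit ?U (pt ?U (e1 ?U W x) (one2 ?U)))"
      using pull_stalk_map[OF proj1_facts W(1-3)] z by (simp add: W(4) j1_def del: I2.sheafify_simps)
    then have "h1 (h2 (stalk_map F \<pi>1 z c)) = ?f (e1 ?U W x) \<otimes>\<^bsub>D\<^esub> ?g (one2 ?U)"
      using h12[OF U X1.pull_closed[OF fst_closed U(1) n W(3)] one2_closed[OF U(1)]] by (simp only:)
    also have "?g (one2 ?U) = \<one>\<^bsub>D\<^esub>" by (rule ring_hom_one[OF g[OF U]])
    also have "?f (e1 ?U W x) = a c" unfolding X1.collapse_pull[OF fst_closed U n W(3)] W(4) ..
    finally show "h1 (h2 (stalk_map F \<pi>1 z c)) = a c"
      using ring_hom_closed[OF a c] by simp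
  next
    fix c assume c: "c \<in> carrier (stalk X2 (snd z))"
    obtain W x where W: "openin (rs_top X2) W" "snd z \<in> W" "x \<in> X2.sec W" "c = X2.germ {snd z} W x"
      by (rule X2.germ_cases_point[OF c[unfolded stalk_def]])
    let ?U = "pre2 W"
    have U: "openin Z ?U" "z \<in> ?U" using continuous_snd W(1,2) z by (auto simp: continuous_map_def)
    have n: "X2.nbhd (snd ` ?U) W" using W(1) by (auto simp: X2.nbhd_def)
    have "stalk_map F \<pi>2 z c = F.germ {z} ?U (TP.unit ?U (pt ?U (one1 ?U) (e2 ?U W x)))"
      using pull_stalk_map[OF proj2_facts W(1-3)] z by (simp add: W(4) j2_def del: I1.sheafify_simps)
    then have "h1 (h2 (stalk_map F \<pi>2 z c)) = ?f (one1 ?U) \<otimes>\<^bsub>D\<^esub> ?g (e2 ?U W x)"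
      using h12[OF U one1_closed[OF U(1)] X2.pull_closed[OF snd_closed U(1) n W(3)]] by (simp only:)
    also have "?f (one1 ?U) = \<one>\<^bsub>D\<^esub>" by (rule ring_hom_one[OF f[OF U]])
    also have "?g (e2 ?U W x) = b c" unfolding X2.collapse_pull[OF snd_closed U n W(3)] W(4) ..
    finally show "h1 (h2 (stalk_map F \<pi>2 z c)) = b c"
      using ring_hom_closed[OF b c] by simp
  qed
qed

end

text \<open>The value is taken at a chosen preimage, and the condition on the kernels makes it
  independent of the choice. This is how the residue map at a point of \<open>X2\<close> is
  transferred to a stalk of \<open>X1\<close>.\<close>

lemma ring_hom_factor_surj:
  assumes R: "ring R" and S: "ring S" and D: "ring D"
    and g: "g \<in> ring_hom R S" "g ` carrier R = carrier S" and k: "k \<in> ring_hom R D"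
    and ker: "\<And>r. r \<in> carrier R \<Longrightarrow> g r = \<zero>\<^bsub>S\<^esub> \<Longrightarrow> k r = \<zero>\<^bsub>D\<^esub>"
  shows "\<exists>h \<in> ring_hom S D. \<forall>r \<in> carrier R. h (g r) = k r"
proof -
  interpret R: ring R by fact
  interpret S: ring S by fact
  interpret D: ring D by fact
  interpret g: ring_hom_ring R S g by (rule ring_hom_ringI2[OF R S g(1)])
  interpret k: ring_hom_ring R D k by (rule ring_hom_ringI2[OF R D k])
  have eq: "k r = k r'" if r: "r \<in> carrier R" "r' \<in> carrier R" "g r = g r'" for r r'
  proof -
    have "k (r \<ominus>\<^bsub>R\<^esub> r') = \<zero>\<^bsub>D\<^esub>" using ring_hom_eq_kernel[OF R S g(1) r] r by (intro ker) simp_all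
    then have "k r \<oplus>\<^bsub>D\<^esub> (\<ominus>\<^bsub>D\<^esub> k r') = \<zero>\<^bsub>D\<^esub>" using r by (simp add: R.minus_eq)
    then have "(k r \<oplus>\<^bsub>D\<^esub> (\<ominus>\<^bsub>D\<^esub> k r')) \<oplus>\<^bsub>D\<^esub> k r' = k r'" using r by simp
    then show ?thesis using r by (simp add: D.a_assoc D.l_neg)
  qed
  define h where "h s = k (SOME r. r \<in> carrier R \<and> g r = s)" for s
  have h: "h (g r) = k r" if "r \<in> carrier R" for r
  proof -
    have "(SOME r'. r' \<in> carrier R \<and> g r' = g r) \<in> carrier R \<and> g (SOME r'. r' \<in> carrier R \<and> g r' = g r) = g r"
      by (rule someI[of "\<lambda>r'. r' \<in> carrier R \<and> g r' = g r" r]) (use that in simp)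
    then show ?thesis unfolding h_def using eq that by blast
  qed
  have surj: "\<exists>r \<in> carrier R. s = g r" if "s \<in> carrier S" for s
    using that g(2) by (metis imageE)
  have "h \<in> ring_hom S D"
  proof (rule ring_hom_memI)
    fix s assume "s \<in> carrier S"
    then show "h s \<in> carrier D" using surj h by fastforce
  next
    fix s t assume "s \<in> carrier S" "t \<in> carrier S"
    then obtain r u where r: "r \<in> carrier R" "s = g r" "u \<in> carrier R" "t = g u" using surj by meson
    show "h (s \<otimes>\<^bsub>S\<^esub> t) = h s \<otimes>\<^bsub>D\<^esub> h t" using r h[of "r \<otimes>\<^bsub>R\<^esub> u"] by (simp add: h)
    show "h (s \<oplus>\<^bsub>S\<^esub> t) = h s \<oplus>\<^bsub>D\<^esub> h t" using r h[of "r \<oplus>\<^bsub>R\<^esub> u"] by (simp add: h)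
  next
    show "h \<one>\<^bsub>S\<^esub> = \<one>\<^bsub>D\<^esub>" using h[of "\<one>\<^bsub>R\<^esub>"] by simp
  qed
  then show ?thesis using h by blast
qed

section \<open>The universal property in ringed spaces\<close>

context rs_cospan
begin

lemma proj_comp_map:
  assumes h: "h \<in> rs_hom Q F" and x: "x \<in> rs_points Q"
  shows "rs_map (rs_comp Q F X1 \<pi>1 h) x = fst (rs_map h x)"
    and "rs_map (rs_comp Q F X2 \<pi>2 h) x = snd (rs_map h x)"
  using rs_map_closed[OF h x] x by (simp_all add: rs_comp_simps proj1_map proj2_map)

lemma proj_comp_stalk_map:
  assumes Q: "is_ringed_space Q" and h: "h \<in> rs_hom Q F" and x: "x \<in> rs_points Q"
  shows "a \<in> carrier (stalk X1 (fst (rs_map h x))) \<Longrightarrow>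
      stalk_map Q h x (stalk_map F \<pi>1 (rs_map h x) a) = stalk_map Q (rs_comp Q F X1 \<pi>1 h) x a"
    and "b \<in> carrier (stalk X2 (snd (rs_map h x))) \<Longrightarrow>
      stalk_map Q h x (stalk_map F \<pi>2 (rs_map h x) b) = stalk_map Q (rs_comp Q F X2 \<pi>2 h) x b"
  using stalk_map_comp[OF Q F_ringed X1 h proj1_hom x] stalk_map_comp[OF Q F_ringed X2 h proj2_hom x]
    rs_map_closed[OF h x] by (simp_all add: proj1_map proj2_map)

text \<open>On points the two components determine the map. On stalks both morphisms give ring
  homomorphisms, which agree on the generators.\<close>

lemma fp_hom_unique:
  assumes Q: "is_ringed_space Q" and h: "h \<in> rs_hom Q F" and k: "k \<in> rs_hom Q F"
    and eq1: "rs_comp Q F X1 \<pi>1 h = rs_comp Q F X1 \<pi>1 k"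
    and eq2: "rs_comp Q F X2 \<pi>2 h = rs_comp Q F X2 \<pi>2 k"
  shows "h = k"
proof (rule rs_hom_stalk_eqI[OF Q F_ringed h k])
  show map: "rs_map h x = rs_map k x" if "x \<in> rs_points Q" for x
    using proj_comp_map[OF h that] proj_comp_map[OF k that] eq1 eq2 by (simp add: prod_eq_iff)
  fix x c assume x: "x \<in> rs_points Q" and c: "c \<in> carrier (stalk F (rs_map h x))"
  note hx = stalk_map_hom[OF rs_is_presheaf[OF Q] rs_is_presheaf[OF F_ringed] h x]
    and kx = stalk_map_hom[OF rs_is_presheaf[OF Q] rs_is_presheaf[OF F_ringed] k x, folded map[OF x]]
  have z: "rs_map h x \<in> topspace Z" using rs_map_closed[OF h x] by simp
  have R: "ring (stalk F (rs_map h x))" "ring (stalk Q x)"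
    using stalk_cring[OF F_ringed, of "rs_map h x"] stalk_cring[OF Q x] z by (auto intro: cring.axioms(1))
  from z c show "stalk_map Q h x c = stalk_map Q k x c"
  proof (induction rule: fp_stalk_induct)
    case (proj1 a)
    then show ?case
      using proj_comp_stalk_map(1)[OF Q h x] proj_comp_stalk_map(1)[OF Q k x] by (simp add: map[OF x] eq1)
  next
    case (proj2 b)
    then show ?case
      using proj_comp_stalk_map(2)[OF Q h x] proj_comp_stalk_map(2)[OF Q k x] by (simp add: map[OF x] eq2)
  next
    case (add c d)
    then show ?case by (simp only: ring_hom_add[OF hx] ring_hom_add[OF kx])
  next
    case (mult c d)
    then show ?case by (simp only: ring_hom_mult[OF hx] ring_hom_mult[OF kx])
  next
    case (uminus c)
    then show ?case by (simp only: ring_hom_uminus[OF R hx] ring_hom_uminus[OF R kx])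
  qed
qed

text \<open>The pair of maps lands in the fibered product because the square commutes on points;
  that it commutes on stalks is the compatibility which \<open>stalk_lift\<close> asks for.\<close>

lemma fp_hom_exists:
  assumes Q: "is_ringed_space Q" and q1: "q1 \<in> rs_hom Q X1" and q2: "q2 \<in> rs_hom Q X2"
    and comm: "rs_comp Q X1 Y f1 q1 = rs_comp Q X2 Y f2 q2"
  shows "\<exists>h \<in> rs_hom Q F. rs_comp Q F X1 \<pi>1 h = q1 \<and> rs_comp Q F X2 \<pi>2 h = q2"
proof -
  interpret Q: sheaf_on "rs_top Q" "rs_sheaf Q" by (rule rs_sheaf_on[OF Q])
  define h0 where "h0 x = (rs_map q1 x, rs_map q2 x)" for x
  have h0: "h0 x \<in> topspace Z" if x: "x \<in> rs_points Q" for x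
  proof -
    have "rs_map f1 (rs_map q1 x) = rs_map f2 (rs_map q2 x)"
      using arg_cong[OF comm, of "\<lambda>q. rs_map q x"] x by (simp add: rs_comp_simps)
    then show ?thesis using rs_map_closed[OF q1 x] rs_map_closed[OF q2 x] by (simp add: fp_topspace h0_def)
  qed
  have cont: "continuous_map (rs_top Q) Z h0"
    unfolding fp_top_def
  proof (rule continuous_map_into_subtopology)
    show "continuous_map (rs_top Q) (prod_topology (rs_top X1) (rs_top X2)) h0"
      unfolding h0_def by (intro continuous_map_pairedI rs_continuous q1 q2)
    show "h0 \<in> topspace (rs_top Q) \<rightarrow> {(x1, x2). rs_map f1 x1 = rs_map f2 x2}"
      using h0 by (force simp: fp_topspace)
  qed
  have "\<exists>\<tau>. x \<in> rs_points Q \<longrightarrow> \<tau> \<in> ring_hom (stalk F (h0 x)) (stalk Q x) \<and>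
      (\<forall>c \<in> carrier (stalk X1 (rs_map q1 x)). \<tau> (stalk_map F \<pi>1 (h0 x) c) = stalk_map Q q1 x c) \<and>
      (\<forall>c \<in> carrier (stalk X2 (rs_map q2 x)). \<tau> (stalk_map F \<pi>2 (h0 x) c) = stalk_map Q q2 x c)" for x
  proof (cases "x \<in> rs_points Q")
    case x: True
    have zz: "rs_map f1 (rs_map q1 x) = rs_map f2 (rs_map q2 x)" using h0[OF x] by (simp add: h0_def fp_topspace)
    have "stalk_map Q q1 x (stalk_map X1 f1 (rs_map q1 x) c) = stalk_map Q q2 x (stalk_map X2 f2 (rs_map q2 x) c)"
      if "c \<in> carrier (stalk Y (rs_map f1 (rs_map q1 x)))" for c
      using stalk_map_comp[OF Q X1 Y q1 f1 x that] stalk_map_comp[OF Q X2 Y q2 f2 x that[unfolded zz]] comm by simp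
    then show ?thesis
      using stalk_lift[OF h0[OF x] stalk_cring[OF Q x], of "stalk_map Q q1 x" "stalk_map Q q2 x"]
        stalk_map_hom[OF Q.presheaf X1.presheaf q1 x] stalk_map_hom[OF Q.presheaf X2.presheaf q2 x]
      unfolding h0_def fst_conv snd_conv by blast
  qed simp
  then obtain \<tau> where \<tau>: "\<And>x. x \<in> rs_points Q \<Longrightarrow> \<tau> x \<in> ring_hom (stalk F (h0 x)) (stalk Q x)"
    and \<tau>1: "\<And>x c. x \<in> rs_points Q \<Longrightarrow> c \<in> carrier (stalk X1 (rs_map q1 x)) \<Longrightarrow>
        \<tau> x (stalk_map F \<pi>1 (h0 x) c) = stalk_map Q q1 x c"
    and \<tau>2: "\<And>x c. x \<in> rs_points Q \<Longrightarrow> c \<in> carrier (stalk X2 (rs_map q2 x)) \<Longrightarrow>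
        \<tau> x (stalk_map F \<pi>2 (h0 x) c) = stalk_map Q q2 x c"
    by metis
  have cont': "continuous_map (rs_top Q) (rs_top F) h0" using cont by simp
  have p1: "rs_map \<pi>1 (h0 x) = rs_map q1 x" and p2: "rs_map \<pi>2 (h0 x) = rs_map q2 x" if "x \<in> rs_points Q" for x
    using h0[OF that] by (simp_all add: proj1_map proj2_map) (simp_all add: h0_def)
  \<comment> \<open>The homomorphisms \<open>\<tau> x\<close> were chosen at each point separately.
    Liftability expresses that they fit together locally, and by induction it has to be known on the
    generators only.\<close>
  note l1 = liftable_stalk_map[OF Q F_ringed cont' \<tau> X1 proj1_hom q1 p1 \<tau>1]
    and l2 = liftable_stalk_map[OF Q F_ringed cont' \<tau> X2 proj2_hom q2 p2 \<tau>2]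
    and lo = liftable_ops[OF Q F_ringed cont' \<tau>]
  have "\<exists>h \<in> rs_hom Q F. \<forall>x \<in> rs_points Q. rs_map h x = h0 x \<and>
      (\<forall>c \<in> carrier (stalk F (h0 x)). stalk_map Q h x c = \<tau> x c)"
  proof (rule rs_hom_of_stalk_maps[OF Q F_ringed cont' \<tau>])
    fix x c assume x: "x \<in> rs_points Q" and c: "c \<in> carrier (stalk F (h0 x))"
    note z = h0[OF x]
    from z c show "liftable Q F h0 \<tau> (h0 x) c"
    proof (induction rule: fp_stalk_induct)
      case (proj1 a)
      then show ?case using z by (intro l1) (simp_all add: proj1_map)
    next
      case (proj2 b)
      then show ?case using z by (intro l2) (simp_all add: proj2_map)
    qed (blast intro: lo)+
  qed
  then obtain h where h: "h \<in> rs_hom Q F" and hx: "\<And>x. x \<in> rs_points Q \<Longrightarrow> rs_map h x = h0 x"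
    and hc: "\<And>x c. x \<in> rs_points Q \<Longrightarrow> c \<in> carrier (stalk F (h0 x)) \<Longrightarrow> stalk_map Q h x c = \<tau> x c" by blast
  have "rs_comp Q F X1 \<pi>1 h = q1"
  proof (rule rs_hom_stalk_eqI[OF Q X1 rs_comp_closed[OF Q X1 h proj1_hom] q1])
    show m: "rs_map (rs_comp Q F X1 \<pi>1 h) x = rs_map q1 x" if "x \<in> rs_points Q" for x
      using that by (simp add: proj_comp_map[OF h] hx) (simp add: h0_def)
    fix x c assume x: "x \<in> rs_points Q" and c: "c \<in> carrier (stalk X1 (rs_map (rs_comp Q F X1 \<pi>1 h) x))"
    have "stalk_map F \<pi>1 (h0 x) c \<in> carrier (stalk F (h0 x))"
      using ring_hom_closed[OF stalk_map_hom[OF proj1_facts(1,2) proj1_hom]] h0[OF x] c p1[OF x] m[OF x] by simp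
    then show "stalk_map Q (rs_comp Q F X1 \<pi>1 h) x c = stalk_map Q q1 x c"
      using proj_comp_stalk_map(1)[OF Q h x, of c] c \<tau>1[OF x] hc[OF x] m[OF x]
      by (simp add: proj_comp_map[OF h x] hx[OF x])
  qed
  moreover have "rs_comp Q F X2 \<pi>2 h = q2"
  proof (rule rs_hom_stalk_eqI[OF Q X2 rs_comp_closed[OF Q X2 h proj2_hom] q2])
    show m: "rs_map (rs_comp Q F X2 \<pi>2 h) x = rs_map q2 x" if "x \<in> rs_points Q" for x
      using that by (simp add: proj_comp_map[OF h] hx) (simp add: h0_def)
    fix x c assume x: "x \<in> rs_points Q" and c: "c \<in> carrier (stalk X2 (rs_map (rs_comp Q F X2 \<pi>2 h) x))"
    have "stalk_map F \<pi>2 (h0 x) c \<in> carrier (stalk F (h0 x))"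
      using ring_hom_closed[OF stalk_map_hom[OF proj2_facts(1,2) proj2_hom]] h0[OF x] c p2[OF x] m[OF x] by simp
    then show "stalk_map Q (rs_comp Q F X2 \<pi>2 h) x c = stalk_map Q q2 x c"
      using proj_comp_stalk_map(2)[OF Q h x, of c] c \<tau>2[OF x] hc[OF x] m[OF x]
      by (simp add: proj_comp_map[OF h x] hx[OF x])
  qed
  ultimately show ?thesis using h by blast
qed

end

section \<open>The comparison morphism for a morphism with surjective stalk maps\<close>

locale lrs_cospan_surj =
  fixes X1 :: "('a, 'r) ringed_space" and X2 :: "('b, 's) ringed_space"
    and Y :: "('c, 't) ringed_space"
    and f1 :: "('a, 'r, 'c, 't) rs_morphism" and f2 :: "('b, 's, 'c, 't) rs_morphism"
  assumes X1_local: "is_locally_ringed_space X1" and X2_local: "is_locally_ringed_space X2"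
    and Y_local: "is_locally_ringed_space Y"
    and f1_local: "f1 \<in> lrs_hom X1 Y" and f2_local: "f2 \<in> lrs_hom X2 Y"
    and surj: "stalks_surjective X1 Y f1"
begin

sublocale rs_cospan X1 X2 Y f1 f2
  by unfold_locales (intro lrs_ringed lrs_hom_rs_hom X1_local X2_local Y_local f1_local f2_local)+

context
  fixes z assumes z: "z \<in> topspace Z"
begin

private abbreviation "SY \<equiv> stalk Y (rs_map f1 (fst z))"
private abbreviation "S1 \<equiv> stalk X1 (fst z)"
private abbreviation "S2 \<equiv> stalk X2 (snd z)"
private abbreviation "SF \<equiv> stalk F z"
private abbreviation "g1 \<equiv> stalk_map X1 f1 (fst z)"
private abbreviation "g2 \<equiv> stalk_map X2 f2 (snd z)"
private abbreviation "i1 \<equiv> stalk_map F \<pi>1 z"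
private abbreviation "i2 \<equiv> stalk_map F \<pi>2 z"

private lemma x1: "fst z \<in> rs_points X1" and x2: "snd z \<in> rs_points X2"
  and yy: "rs_map f2 (snd z) = rs_map f1 (fst z)" and y: "rs_map f1 (fst z) \<in> rs_points Y"
  and \<pi>1z: "rs_map \<pi>1 z = fst z" and \<pi>2z: "rs_map \<pi>2 z = snd z"
  using z rs_map_closed[OF f1, of "fst z"] by (auto simp: fp_topspace proj1_map proj2_map)

private lemma homs:
  "g1 \<in> ring_hom SY S1"
  "g2 \<in> ring_hom SY S2"
  "i1 \<in> ring_hom S1 SF"
  "i2 \<in> ring_hom S2 SF"
  using stalk_map_hom[OF rs_is_presheaf[OF X1] rs_is_presheaf[OF Y] f1 x1]
    stalk_map_hom[OF rs_is_presheaf[OF X2] rs_is_presheaf[OF Y] f2 x2, unfolded yy]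
    stalk_map_hom[OF rs_is_presheaf[OF F_ringed] rs_is_presheaf[OF X1] proj1_hom, of z] z
    stalk_map_hom[OF rs_is_presheaf[OF F_ringed] rs_is_presheaf[OF X2] proj2_hom, of z]
  by (simp_all add: \<pi>1z \<pi>2z)

private lemma locals:
  "is_local_ring S1" "is_local_ring S2"
  "is_local_ring SY"
  by (intro stalk_local X1_local X2_local Y_local x1 x2 y)+

private lemma rings: "cring S1" "cring S2"
  "cring SY" "cring SF"
  using stalk_cring[OF X1 x1] stalk_cring[OF X2 x2] stalk_cring[OF Y y] stalk_cring[OF F_ringed] z
  by simp_all

private lemma surj1:
  "g1 ` carrier SY = carrier S1"
  using surj x1 by (simp add: stalks_surjective_def)

private lemma commute: "c \<in> carrier SY \<Longrightarrow>
    i1 (g1 c) = i2 (g2 c)"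
  using stalk_map_comp[OF F_ringed X1 Y proj1_hom f1, of z c] stalk_map_comp[OF F_ringed X2 Y proj2_hom f2, of z c]
    z by (simp add: \<pi>1z \<pi>2z yy proj_commute)

text \<open>An element of \<open>S1\<close> comes from \<open>SY\<close> by surjectivity of
  \<open>g1\<close>, and through the commutative square it reaches \<open>SF\<close> by way of
  \<open>S2\<close>.\<close>

private lemma image1: "i1 ` carrier S1 \<subseteq> i2 ` carrier S2"
proof
  fix d assume "d \<in> i1 ` carrier S1"
  then have "d \<in> i1 ` g1 ` carrier SY"
    unfolding surj1 .
  then obtain c where "c \<in> carrier SY" "d = i1 (g1 c)"
    by blast
  then show "d \<in> i2 ` carrier S2"
    using commute ring_hom_closed[OF homs(2)] by auto
qed

text \<open>The image is a subring and, by \<open>image1\<close>, contains the generators of the stalk.\<close>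

lemma proj2_stalk_surj: "i2 ` carrier S2 = carrier SF"
proof
  show "i2 ` carrier S2 \<subseteq> carrier SF"
    using ring_hom_closed[OF homs(4)] by auto
  let ?I = "i2 ` carrier S2"
  interpret R: cring "S2" by (rule rings)
  interpret S: cring "SF" by (rule rings)
  interpret h: ring_hom_ring "S2" "SF" "i2"
    by (rule ring_hom_ringI2[OF R.ring_axioms S.ring_axioms homs(4)])
  have I_add: "c \<oplus>\<^bsub>SF\<^esub> d \<in> ?I" and I_mult: "c \<otimes>\<^bsub>SF\<^esub> d \<in> ?I" if cd: "c \<in> ?I" "d \<in> ?I" for c d
  proof -
    obtain x y where x: "x \<in> carrier S2" "c = i2 x"
      and y: "y \<in> carrier S2" "d = i2 y" using cd by blast
    show "c \<oplus>\<^bsub>SF\<^esub> d \<in> ?I" unfolding x(2) y(2) h.hom_add[OF x(1) y(1), symmetric]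
      by (rule imageI[OF R.a_closed[OF x(1) y(1)]])
    show "c \<otimes>\<^bsub>SF\<^esub> d \<in> ?I" unfolding x(2) y(2) h.hom_mult[OF x(1) y(1), symmetric]
      by (rule imageI[OF R.m_closed[OF x(1) y(1)]])
  qed
  have I_uminus: "\<ominus>\<^bsub>SF\<^esub> c \<in> ?I" if c: "c \<in> ?I" for c
  proof -
    obtain x where x: "c = i2 x" "x \<in> carrier S2" using c by (rule imageE)
    show ?thesis unfolding x(1) h.hom_a_inv[OF x(2), symmetric]
      by (rule imageI[OF R.a_inv_closed[OF x(2)]])
  qed
  show "carrier SF \<subseteq> ?I"
  proof
    fix c assume "c \<in> carrier SF"
    with z show "c \<in> ?I"
    proof (induction rule: fp_stalk_induct)
      case (proj1 a)
      then show ?case using image1 by blast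
    qed (blast intro: I_add I_mult I_uminus)+
  qed
qed

text \<open>As \<open>g1\<close> is surjective, the preimage of the maximal ideal of
  \<open>S1\<close> is that of \<open>SY\<close>, so the kernel of \<open>g1\<close> lies in it; and
  \<open>g2\<close> is local. Hence the residue map of \<open>S2\<close>, composed with
  \<open>g2\<close>, factors through \<open>g1\<close>.\<close>

private lemma kernel1:
  assumes "c \<in> carrier SY" "g1 c = \<zero>\<^bsub>S1\<^esub>"
  shows "g2 c \<in> max_ideal S2"
proof -
  have "ideal (max_ideal S1) S1"
    using max_ideal_maximal[OF locals(1)] by (rule maximalideal.axioms(1))
  then have "\<zero>\<^bsub>S1\<^esub> \<in> max_ideal S1"
    by (intro additive_subgroup.zero_closed ideal.axioms(1))
  then have "c \<in> max_ideal SY"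
    using max_ideal_vimage_surj[OF locals(3,1) homs(1) surj1] assms by auto
  then show ?thesis using lrs_hom_max_ideal[OF f2_local x2] yy by simp
qed

text \<open>The homomorphism \<open>h\<close> extends the residue map: composed with
  \<open>i2\<close> it is the quotient by the maximal ideal of \<open>S2\<close>. Whatever
  \<open>i2\<close> kills therefore has residue class zero.\<close>

private lemma kernel2:
  assumes c: "c \<in> carrier S2" and 0: "i2 c = \<zero>\<^bsub>SF\<^esub>"
  shows "c \<in> max_ideal S2"
proof -
  let ?R = "S2" and ?m = "max_ideal S2"
  interpret R: cring ?R by (rule rings)
  interpret m: ideal ?m ?R using max_ideal_maximal[OF locals(2)] by (rule maximalideal.axioms(1))
  have D: "cring (?R Quot ?m)" by (rule m.quotient_is_cring[OF R.is_cring])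
  have q: "(+>\<^bsub>?R\<^esub>) ?m \<in> ring_hom ?R (?R Quot ?m)" by (rule m.rcos_ring_hom)
  have q0: "?m +>\<^bsub>?R\<^esub> x = \<zero>\<^bsub>?R Quot ?m\<^esub>" if "x \<in> ?m" for x
    using m.a_rcos_const[OF that] by (simp add: FactRing_def)
  have qf: "(\<lambda>c. ?m +>\<^bsub>?R\<^esub> g2 c) \<in> ring_hom SY (?R Quot ?m)"
    by (rule ring_hom_comp[OF homs(2) q])
  \<comment> \<open>This \<open>a\<close> is the residue map on \<open>S1\<close> with values in the
    residue field of \<open>S2\<close>; its defining equation is the compatibility over
    \<open>SY\<close> that \<open>stalk_lift\<close> requires.\<close>
  have "\<exists>a \<in> ring_hom S1 (?R Quot ?m). \<forall>c \<in> carrier SY.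
      a (g1 c) = ?m +>\<^bsub>?R\<^esub> g2 c"
    by (rule ring_hom_factor_surj[OF cring.axioms(1)[OF rings(3)] cring.axioms(1)[OF rings(1)]
      cring.axioms(1)[OF D] homs(1) surj1 qf]) (rule q0[OF kernel1])
  then obtain a where a: "a \<in> ring_hom S1 (?R Quot ?m)"
    "\<And>c. c \<in> carrier SY \<Longrightarrow>
      a (g1 c) = ?m +>\<^bsub>?R\<^esub> g2 c"
    by blast
  obtain h where h: "h \<in> ring_hom SF (?R Quot ?m)"
    "\<And>c. c \<in> carrier ?R \<Longrightarrow> h (i2 c) = ?m +>\<^bsub>?R\<^esub> c"
    using stalk_lift[OF z D a(1) q a(2)] by blast
  have "?m +>\<^bsub>?R\<^esub> c = \<zero>\<^bsub>?R Quot ?m\<^esub>"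
    using h(2)[OF c] 0 ring_hom_zero[OF h(1) cring.axioms(1)[OF rings(4)] cring.axioms(1)[OF D]] by simp
  then show "c \<in> ?m"
    using m.a_rcos_self[OF c] by (simp add: FactRing_def)
qed

lemma fp_stalk_local: "is_local_ring SF"
  and fp_max_ideal: "max_ideal SF = i2 ` max_ideal S2"
  using local_ring_surj[OF locals(2) rings(4) homs(4) proj2_stalk_surj kernel2] by blast+

text \<open>An element of the maximal ideal of \<open>S1\<close> lifts to the maximal ideal of
  \<open>SY\<close>. The way round the square through \<open>X2\<close> stays in maximal ideals,
  because \<open>f2\<close> is local and by \<open>fp_max_ideal\<close>.\<close>

lemma proj1_max_ideal:
  assumes "a \<in> max_ideal S1"
  shows "i1 a \<in> max_ideal SF"
proof -
  have "a \<in> g1 ` carrier SY"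
    unfolding surj1 using assms max_ideal_subset[OF locals(1)] by blast
  then obtain c where c: "c \<in> carrier SY" "a = g1 c" by blast
  then have "c \<in> max_ideal SY"
    using max_ideal_vimage_surj[OF locals(3,1) homs(1) surj1] assms by auto
  then have "g2 c \<in> max_ideal S2"
    using lrs_hom_max_ideal[OF f2_local x2] yy by simp
  then show ?thesis unfolding c(2) commute[OF c(1)] fp_max_ideal by blast
qed

end

section \<open>The fibered product as a locally ringed space\<close>

lemma F_local: "is_locally_ringed_space F"
  unfolding is_locally_ringed_space_def using F_ringed fp_stalk_local by simp

lemma proj1_local: "\<pi>1 \<in> lrs_hom F X1"
  unfolding lrs_hom_def using proj1_hom proj1_max_ideal by (auto simp: proj1_map)

lemma proj2_local: "\<pi>2 \<in> lrs_hom F X2"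
  unfolding lrs_hom_def using proj2_hom fp_max_ideal by (auto simp: proj2_map)

lemma fp_cone: "is_lrs_cone X1 X2 Y f1 f2 F \<pi>1 \<pi>2"
  unfolding is_lrs_cone_def using F_local proj1_local proj2_local proj_commute by blast

text \<open>The maximal ideal at a point of \<open>F\<close> is the image of the one of
  \<open>X2\<close>, so locality of \<open>h\<close> can be read off from its second
  component.\<close>

lemma fp_hom_local:
  assumes Q: "is_locally_ringed_space Q" and h: "h \<in> rs_hom Q F"
    and q2: "rs_comp Q F X2 \<pi>2 h \<in> lrs_hom Q X2"
  shows "h \<in> lrs_hom Q F"
  unfolding lrs_hom_def mem_Collect_eq
proof (intro conjI h ballI subsetI)
  fix x d assume x: "x \<in> rs_points Q" and "d \<in> stalk_map Q h x ` max_ideal (stalk F (rs_map h x))"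
  moreover have hx: "rs_map h x \<in> topspace Z" using rs_map_closed[OF h x] by simp
  ultimately obtain c where c: "c \<in> max_ideal (stalk X2 (snd (rs_map h x)))"
    "d = stalk_map Q h x (stalk_map F \<pi>2 (rs_map h x) c)"
    unfolding fp_max_ideal[OF hx] by blast
  have "snd (rs_map h x) \<in> rs_points X2" using hx by (auto simp: fp_topspace)
  then have "c \<in> carrier (stalk X2 (rs_map \<pi>2 (rs_map h x)))"
    using c(1) max_ideal_subset[OF stalk_local[OF X2_local]] proj2_map[OF hx] by auto
  then have "d = stalk_map Q (rs_comp Q F X2 \<pi>2 h) x c"
    unfolding c(2) by (rule stalk_map_comp[OF lrs_ringed[OF Q] F_ringed X2 h proj2_hom x, symmetric])
  then show "d \<in> max_ideal (stalk Q x)"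
    using lrs_hom_max_ideal[OF q2 x, of c] c(1) proj_comp_map(2)[OF h x] by simp
qed

theorem comparison_iso:
  assumes P: "is_lrs_fibered_product X1 X2 Y f1 f2 P p1 p2"
  shows "rs_iso P F (comparison X1 X2 Y f1 f2 P p1 p2)"
proof -
  have cone: "is_lrs_cone X1 X2 Y f1 f2 P p1 p2"
    and univ_P: "lrs_universal_for TYPE(('d, 'e) ringed_space) X1 X2 Y f1 f2 P p1 p2"
    and univ_F: "lrs_universal_for TYPE(('a \<times> 'b, ('a, 'r, 'b, 's) fp_section) ringed_space) X1 X2 Y f1 f2 P p1 p2"
    using P unfolding is_lrs_fibered_product_def by auto
  have P: "is_locally_ringed_space P" and p1: "p1 \<in> lrs_hom P X1" and p2: "p2 \<in> lrs_hom P X2"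
    and comm: "rs_comp P X1 Y f1 p1 = rs_comp P X2 Y f2 p2"
    using cone unfolding is_lrs_cone_def by auto
  note P' = lrs_ringed[OF P] and p1' = lrs_hom_rs_hom[OF p1] and p2' = lrs_hom_rs_hom[OF p2]
  obtain \<eta> where \<eta>: "\<eta> \<in> rs_hom P F" "rs_comp P F X1 \<pi>1 \<eta> = p1" "rs_comp P F X2 \<pi>2 \<eta> = p2"
    using fp_hom_exists[OF P' p1' p2' comm] by blast
  have "comparison X1 X2 Y f1 f2 P p1 p2 = \<eta>"
    unfolding comparison_def by (rule the_equality) (use \<eta> fp_hom_unique[OF P'] in auto)
  moreover have "rs_iso P F \<eta>"
  proof -
    \<comment> \<open>The candidate for the inverse comes from universality of \<open>P\<close> for
      the test object \<open>F\<close>, which is a cone of locally ringed spaces by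
      \<open>fp_cone\<close>.\<close>
    obtain k where k: "k \<in> lrs_hom F P" "rs_comp F P X1 p1 k = \<pi>1" "rs_comp F P X2 p2 k = \<pi>2"
      using univ_F fp_cone unfolding lrs_universal_for_def by blast
    note k' = lrs_hom_rs_hom[OF k(1)]
    \<comment> \<open>\<open>\<eta>\<close> was obtained among morphisms of ringed spaces. It has to
      be local before the universal property of \<open>P\<close>, which concerns local morphisms,
      can be applied to the composite with \<open>k\<close>.\<close>
    have \<eta>_local: "\<eta> \<in> lrs_hom P F" by (rule fp_hom_local[OF P \<eta>(1)]) (simp add: \<eta>(3) p2)
    have Fk: "rs_comp F P F \<eta> k = rs_id F"
    proof (rule fp_hom_unique[OF F_ringed rs_comp_closed[OF F_ringed F_ringed k' \<eta>(1)] rs_id_closed[OF F_ringed]])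
      show "rs_comp F F X1 \<pi>1 (rs_comp F P F \<eta> k) = rs_comp F F X1 \<pi>1 (rs_id F)"
        unfolding rs_comp_assoc[OF k' \<eta>(1) proj1_hom] \<eta>(2) k(2) rs_comp_id(1)[OF F_ringed X1 proj1_hom] ..
      show "rs_comp F F X2 \<pi>2 (rs_comp F P F \<eta> k) = rs_comp F F X2 \<pi>2 (rs_id F)"
        unfolding rs_comp_assoc[OF k' \<eta>(1) proj2_hom] \<eta>(3) k(3) rs_comp_id(1)[OF F_ringed X2 proj2_hom] ..
    qed
    \<comment> \<open>\<open>P\<close> is tested against itself: the identity and the composite of
      \<open>\<eta>\<close> and \<open>k\<close> are both local endomorphisms compatible with
      \<open>p1\<close> and \<open>p2\<close>.\<close>
    have uniq: "\<exists>!h. h \<in> lrs_hom P P \<and> rs_comp P P X1 p1 h = p1 \<and> rs_comp P P X2 p2 h = p2"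
      using univ_P cone unfolding lrs_universal_for_def by blast
    have "rs_comp P F P k \<eta> \<in> lrs_hom P P" by (rule lrs_comp_closed[OF P' F_ringed P \<eta>_local k(1)])
    moreover have "rs_comp P P X1 p1 (rs_comp P F P k \<eta>) = p1"
      unfolding rs_comp_assoc[OF \<eta>(1) k' p1'] k(2) by (rule \<eta>(2))
    moreover have "rs_comp P P X2 p2 (rs_comp P F P k \<eta>) = p2"
      unfolding rs_comp_assoc[OF \<eta>(1) k' p2'] k(3) by (rule \<eta>(3))
    ultimately have "rs_comp P F P k \<eta> = rs_id P"
      using uniq rs_id_lrs[OF P] rs_comp_id(1)[OF P' X1 p1'] rs_comp_id(1)[OF P' X2 p2'] by blast
    then show ?thesis unfolding rs_iso_def using \<eta>(1) k' Fk by blast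
  qed
  ultimately show ?thesis by simp
qed

end

section \<open>The spectrum of a field and of a residue field\<close>

locale plain_field = field R for R :: "'r ring" (structure)
begin

abbreviation "loc \<equiv> localization R (carrier R - {\<zero>})"
abbreviation "quo \<equiv> fraction R (carrier R - {\<zero>})"

definition "field_loc a = quo a \<one>"

lemma unit_cancel: "u \<in> carrier R - {\<zero>} \<Longrightarrow> x \<in> carrier R \<Longrightarrow> y \<in> carrier R \<Longrightarrow> u \<otimes> x = u \<otimes> y \<longleftrightarrow> x = y"
  using m_lcancel by auto

text \<open>The factor \<open>u\<close> in the definition of fractions is nonzero here and can be
  cancelled.\<close>

lemma fraction_eq:
  assumes "a \<in> carrier R" "s \<in> carrier R - {\<zero>}"
  shows "quo a s = {(b, t). b \<in> carrier R \<and> t \<in> carrier R - {\<zero>} \<and> t \<otimes> a = s \<otimes> b}"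
  using assms one_not_zero unfolding fraction_def
  by (auto simp: unit_cancel intro!: bexI[of _ \<one>])

lemma field_loc_mem:
  assumes "a \<in> carrier R"
  shows "(b, t) \<in> field_loc a \<longleftrightarrow> t \<in> carrier R - {\<zero>} \<and> b = t \<otimes> a"
  using assms one_not_zero by (auto simp: field_loc_def fraction_eq)

lemma fraction_mult:
  assumes "a \<in> carrier R" "s \<in> carrier R - {\<zero>}"
  shows "quo (s \<otimes> a) s = field_loc a"
proof -
  have "t \<otimes> (s \<otimes> a) = s \<otimes> b \<longleftrightarrow> b = t \<otimes> a" if "b \<in> carrier R" "t \<in> carrier R" for b t
    using that assms unit_cancel[of s "t \<otimes> a" b] by (auto simp: m_lcomm)
  then show ?thesis
    using assms one_not_zero by (auto simp: fraction_eq field_loc_def)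
qed

lemma field_loc_inj: "a \<in> carrier R \<Longrightarrow> b \<in> carrier R \<Longrightarrow> field_loc a = field_loc b \<Longrightarrow> a = b"
  using field_loc_mem[of a a \<one>] field_loc_mem[of b a \<one>] one_not_zero by auto

text \<open>The counterpart of \<open>germ_UN\<close> for fractions: the pairs in the class of
  \<open>a\<close> are \<open>(t \<otimes> a, t)\<close>, and the union collapses when the term does
  not depend on \<open>t\<close>.\<close>

lemma field_loc_UN:
  assumes a: "a \<in> carrier R" and \<phi>: "\<And>t. t \<in> carrier R - {\<zero>} \<Longrightarrow> \<phi> (t \<otimes> a) t = c"
  shows "(\<Union>(b, t) \<in> field_loc a. \<phi> b t) = c"
proof -
  have "\<phi> (fst p) (snd p) = c" if "p \<in> field_loc a" for p
    using that field_loc_mem[OF a, of "fst p" "snd p"] \<phi> by simp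
  moreover have "(a, \<one>) \<in> field_loc a" using a one_not_zero by (simp add: field_loc_mem)
  ultimately show ?thesis by (auto simp: split_def)
qed

text \<open>A fraction \<open>a/s\<close> equals \<open>(inv s \<otimes> a)/1\<close>, so localizing
  a field at its nonzero elements changes nothing and the operations are carried over along
  \<open>field_loc\<close>.\<close>

lemma loc_simps:
  "carrier loc = field_loc ` carrier R"
  "a \<in> carrier R \<Longrightarrow> b \<in> carrier R \<Longrightarrow> field_loc a \<otimes>\<^bsub>loc\<^esub> field_loc b = field_loc (a \<otimes> b)"
  "a \<in> carrier R \<Longrightarrow> b \<in> carrier R \<Longrightarrow> field_loc a \<oplus>\<^bsub>loc\<^esub> field_loc b = field_loc (a \<oplus> b)"
  "\<one>\<^bsub>loc\<^esub> = field_loc \<one>" "\<zero>\<^bsub>loc\<^esub> = field_loc \<zero>"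
proof -
  have "quo a s \<in> field_loc ` carrier R" if "a \<in> carrier R" "s \<in> carrier R - {\<zero>}" for a s
  proof
    have s: "s \<in> Units R" using that(2) by (simp add: field_Units)
    then show "inv s \<otimes> a \<in> carrier R" using that by simp
    have "s \<otimes> (inv s \<otimes> a) = a" using s that by (simp add: m_assoc[symmetric])
    then show "quo a s = field_loc (inv s \<otimes> a)"
      using fraction_mult[of "inv s \<otimes> a" s] s that by simp
  qed
  moreover have "\<exists>b s. field_loc a = quo b s \<and> b \<in> carrier R \<and> s \<in> carrier R - {\<zero>}" if "a \<in> carrier R" for a
    using that one_not_zero by (intro exI[of _ a] exI[of _ \<one>]) (simp add: field_loc_def)
  ultimately show "carrier loc = field_loc ` carrier R"
    unfolding localization_def partial_object.simps by blast
  have nz: "s \<otimes> t \<in> carrier R - {\<zero>}" if "s \<in> carrier R - {\<zero>}" "t \<in> carrier R - {\<zero>}" for s t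
    using that integral by auto
  show "field_loc a \<otimes>\<^bsub>loc\<^esub> field_loc b = field_loc (a \<otimes> b)" if ab: "a \<in> carrier R" "b \<in> carrier R"
    unfolding localization_def monoid.simps
  proof (rule field_loc_UN[OF ab(1)], rule field_loc_UN[OF ab(2)])
    fix s t assume st: "s \<in> carrier R - {\<zero>}" "t \<in> carrier R - {\<zero>}"
    have "(s \<otimes> a) \<otimes> (t \<otimes> b) = (s \<otimes> t) \<otimes> (a \<otimes> b)" using st ab by (simp add: m_ac)
    then show "quo (s \<otimes> a \<otimes> (t \<otimes> b)) (s \<otimes> t) = field_loc (a \<otimes> b)"
      using fraction_mult[of "a \<otimes> b" "s \<otimes> t"] ab nz[OF st] by simp
  qed
  show "field_loc a \<oplus>\<^bsub>loc\<^esub> field_loc b = field_loc (a \<oplus> b)" if ab: "a \<in> carrier R" "b \<in> carrier R"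
    unfolding localization_def ring_record_simps
  proof (rule field_loc_UN[OF ab(1)], rule field_loc_UN[OF ab(2)])
    fix s t assume st: "s \<in> carrier R - {\<zero>}" "t \<in> carrier R - {\<zero>}"
    have "t \<otimes> (s \<otimes> a) \<oplus> s \<otimes> (t \<otimes> b) = (s \<otimes> t) \<otimes> (a \<oplus> b)" using st ab by (simp add: m_ac r_distr)
    then show "quo (t \<otimes> (s \<otimes> a) \<oplus> s \<otimes> (t \<otimes> b)) (s \<otimes> t) = field_loc (a \<oplus> b)"
      using fraction_mult[of "a \<oplus> b" "s \<otimes> t"] ab nz[OF st] by simp
  qed
qed (simp_all add: localization_def field_loc_def)

lemma field_loc_hom: "field_loc \<in> ring_hom R loc"
  by (rule ring_hom_memI) (simp_all add: loc_simps)

lemma loc_cring: "cring loc"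
proof -
  have "field_loc \<in> ring_iso R loc"
    unfolding ring_iso_def using field_loc_hom
    by (auto simp: bij_betw_def loc_simps inj_on_def intro: field_loc_inj)
  \<comment> \<open>The transported ring has the image of zero as its zero, and this is the zero of
    \<open>loc\<close>.\<close>
  from ring_iso_imp_img_cring[OF this] show ?thesis
    by (simp flip: loc_simps(5))
qed

lemma primeideal_field_iff: "primeideal p R \<longleftrightarrow> p = {\<zero>}"
proof
  assume "primeideal p R"
  then interpret p: primeideal p R .
  have "p \<subseteq> {\<zero>}"
  proof
    fix a assume a: "a \<in> p"
    show "a \<in> {\<zero>}"
    proof (rule ccontr)
      assume "a \<notin> {\<zero>}"
      then have u: "a \<in> Units R" using a p.Icarr by (simp add: field_Units)
      have "inv a \<otimes> a \<in> p" using a u by (intro p.I_l_closed) simp_all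
      then have "\<one> \<in> p" using u by simp
      then show False using p.one_imp_carrier p.I_notcarr by simp
    qed
  qed
  then show "p = {\<zero>}" using additive_subgroup.zero_closed[OF p.additive_subgroup_axioms] by blast
next
  assume "p = {\<zero>}"
  then show "primeideal p R" using zeroprimeideal by simp
qed

lemma spec_field_topspace: "topspace (spec_top R) = {{\<zero>}}"
  using one_not_zero by (force simp: spec_top_def primeideal_field_iff)

lemma spec_field_open: "openin (spec_top R) U \<longleftrightarrow> U = {} \<or> U = {{\<zero>}}"
  using openin_subset[of "spec_top R" U] openin_topspace[of "spec_top R"]
  unfolding spec_field_topspace by auto

text \<open>The spectrum of a field is a point, over which an element of the localization is a
  single fraction \<open>a/1\<close>. The local condition thus holds for every function, and over
  the empty set it is vacuous.\<close>

lemma spec_field_carrier: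
  assumes U: "openin (spec_top R) U"
  shows "carrier (rs_sections (Spec R) U) = (\<Pi>\<^sub>E p\<in>U. carrier (localization R (carrier R - p)))"
proof -
  have "\<exists>V. openin (spec_top R) V \<and> p \<in> V \<and> V \<subseteq> U \<and>
      (\<exists>a\<in>carrier R. \<exists>b\<in>carrier R. \<forall>q\<in>V. b \<notin> q \<and> s q = fraction R (carrier R - q) a b)"
    if s: "s \<in> (\<Pi>\<^sub>E p\<in>U. carrier (localization R (carrier R - p)))" and p: "p \<in> U" for s p
  proof -
    have U': "U = {{\<zero>}}" using U p by (auto simp: spec_field_open)
    then have "s {\<zero>} \<in> carrier loc" using s by blast
    then obtain a where a: "a \<in> carrier R" "s {\<zero>} = quo a \<one>" by (auto simp: loc_simps field_loc_def)
    show ?thesis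
    proof (rule exI[of _ U], intro conjI U p subset_refl, rule bexI[OF _ a(1)], rule bexI[OF _ one_closed], intro ballI)
      fix q assume "q \<in> U"
      then have "q = {\<zero>}" using U' by simp
      then show "\<one> \<notin> q \<and> s q = fraction R (carrier R - q) a \<one>" using a(2) one_not_zero by simp
    qed
  qed
  then show ?thesis
    unfolding Spec_def ringed_space.simps presheaf.simps pointwise_ring_simps
    by (intro equalityI subsetI CollectI conjI ballI) (simp_all only: mem_Collect_eq)
qed

lemma spec_simps: "rs_top (Spec R) = spec_top R" "res (rs_sheaf (Spec R)) U V s = restrict s V"
  by (simp_all add: Spec_def)

lemma spec_pointwise: "rs_sections (Spec R) U =
    pointwise_ring U (\<lambda>p. localization R (carrier R - p)) (carrier (rs_sections (Spec R) U))"
  by (simp add: Spec_def)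

text \<open>As the sections are all functions with values in the localizations, restriction, gluing
  and the pointwise operations stay among them.\<close>

lemma spec_field_ringed: "is_ringed_space (Spec R)"
proof -
  have cr: "cring (localization R (carrier R - p))" if "p \<in> topspace (spec_top R)" for p
    using that loc_cring by (simp add: spec_field_topspace)
  have cU: "cring (localization R (carrier R - p))" if "openin (spec_top R) U" "p \<in> U" for p U
    using that cr openin_subset by blast
  note r = ring.ring_simprules[OF cring.axioms(1)[OF cU]]
  have "is_sheaf (spec_top R) \<lparr>sections = (\<lambda>U. pointwise_ring U (\<lambda>p. localization R (carrier R - p))
      (carrier (rs_sections (Spec R) U))), res = (\<lambda>U V s. restrict s V)\<rparr>"
  proof (rule local_function_sheaf[OF cr])
    fix U V s assume "openin (spec_top R) U" "openin (spec_top R) V" "V \<subseteq> U" "s \<in> carrier (rs_sections (Spec R) U)"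
    then show "restrict s V \<in> carrier (rs_sections (Spec R) V)"
      by (auto simp: spec_field_carrier)
  next
    fix U s t assume "openin (spec_top R) U" "s \<in> carrier (rs_sections (Spec R) U)" "t \<in> carrier (rs_sections (Spec R) U)"
    then show "(\<lambda>x\<in>U. s x \<oplus>\<^bsub>localization R (carrier R - x)\<^esub> t x) \<in> carrier (rs_sections (Spec R) U)"
      "(\<lambda>x\<in>U. s x \<otimes>\<^bsub>localization R (carrier R - x)\<^esub> t x) \<in> carrier (rs_sections (Spec R) U)"
      by (auto simp: spec_field_carrier intro!: r(1,5))
  next
    fix U s assume "openin (spec_top R) U" "s \<in> carrier (rs_sections (Spec R) U)"
    then show "(\<lambda>x\<in>U. \<ominus>\<^bsub>localization R (carrier R - x)\<^esub> s x) \<in> carrier (rs_sections (Spec R) U)"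
      by (auto simp: spec_field_carrier intro!: r(3))
  qed (auto simp: spec_field_carrier intro!: r(6))
  then show ?thesis by (simp add: is_ringed_space_def Spec_def)
qed

end

section \<open>The natural map from the spectrum of a residue field\<close>

locale lrs_point =
  fixes Y :: "('a, 'r) ringed_space" and y :: 'a
  assumes Y_local: "is_locally_ringed_space Y" and y: "y \<in> rs_points Y"
begin

sublocale Y: sheaf_on "rs_top Y" "rs_sheaf Y" by (rule rs_sheaf_on[OF lrs_ringed[OF Y_local]])

abbreviation "m \<equiv> max_ideal (stalk Y y)"
abbreviation "K \<equiv> residue_field Y y"
abbreviation "S \<equiv> Spec K"
abbreviation "\<iota> \<equiv> point_inclusion Y y"
abbreviation "rc \<equiv> residue_class Y y"

lemma stalk_local_y: "is_local_ring (stalk Y y)" by (rule stalk_local[OF Y_local y])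

sublocale R: cring "stalk Y y" using stalk_local_y by (simp add: is_local_ring_def)
sublocale m: maximalideal m "stalk Y y" by (rule max_ideal_maximal[OF stalk_local_y])
sublocale K: plain_field K
  unfolding plain_field_def residue_field_def by (rule m.quotient_is_field[OF R.is_cring])

lemma class_hom: "(+>\<^bsub>stalk Y y\<^esub>) m \<in> ring_hom (stalk Y y) K"
  unfolding residue_field_def by (rule m.rcos_ring_hom)

lemma rc_hom: "openin (rs_top Y) V \<Longrightarrow> y \<in> V \<Longrightarrow> rc V \<in> ring_hom (rs_sections Y V) K"
  using ring_hom_comp[OF Y.germ_hom class_hom[unfolded stalk_def], of V]
  by (simp add: residue_class_def[abs_def] stalk_def)

lemma spec_topspace: "rs_points S = {{\<zero>\<^bsub>K\<^esub>}}" and spec_open: "openin (rs_top S) U \<longleftrightarrow> U = {} \<or> U = {{\<zero>\<^bsub>K\<^esub>}}"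
  by (simp_all add: K.spec_simps K.spec_field_topspace K.spec_field_open)

lemma preimage: "rs_preimage S \<iota> V = (if y \<in> V then {{\<zero>\<^bsub>K\<^esub>}} else {})"
  by (auto simp: rs_preimage_def spec_topspace point_inclusion_def)

lemma comap:
  assumes "openin (rs_top Y) V" "s \<in> Y.sec V"
  shows "rs_comap \<iota> V s = (\<lambda>p\<in>rs_preimage S \<iota> V. K.field_loc (rc V s))"
  using assms
  by (auto simp: point_inclusion_def rs_preimage_def spec_topspace K.field_loc_def fun_eq_iff)

lemma point_hom: "\<iota> \<in> rs_hom S Y"
  unfolding rs_hom_def mem_Collect_eq
proof (intro conjI allI impI ballI)
  have "continuous_map (rs_top S) (rs_top Y) (\<lambda>p. y)" using y by simp
  then show "continuous_map (rs_top S) (rs_top Y) (rs_map \<iota>)"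
    by (rule continuous_map_eq) (simp add: point_inclusion_def)
  show "rs_map \<iota> \<in> extensional (rs_points S)" by (simp add: point_inclusion_def)
  show "rs_comap \<iota> \<in> extensional {V. openin (rs_top Y) V}" by (simp add: point_inclusion_def)
next
  fix V assume V: "openin (rs_top Y) V"
  show "rs_comap \<iota> V \<in> extensional (Y.sec V)" using V by (simp add: point_inclusion_def)
  let ?U = "rs_preimage S \<iota> V"
  have U: "openin (spec_top K) ?U" by (simp add: preimage K.spec_field_open)
  \<comment> \<open>When \<open>y\<close> is outside \<open>V\<close> the preimage is empty and
    carries a single function. A point \<open>p\<close> of the preimage forces \<open>y\<close> into
    \<open>V\<close>, where the residue class of a section is given by its germ at
    \<open>y\<close>.\<close>
  have yV: "y \<in> V" "p = {\<zero>\<^bsub>K\<^esub>}" if "p \<in> ?U" for p using that by (auto simp: preimage split: if_splits)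
  note rh = ring_hom_comp[OF rc_hom[OF V] K.field_loc_hom]
  show "rs_comap \<iota> V \<in> ring_hom (rs_sections Y V) (rs_sections S ?U)"
  proof (rule ring_hom_cong[OF _ Y.sections_ring[OF V] comap[OF V]])
    show "(\<lambda>s. \<lambda>p\<in>?U. K.field_loc (rc V s)) \<in> ring_hom (rs_sections Y V) (rs_sections S ?U)"
    proof (rule ring_hom_memI)
      fix s assume "s \<in> Y.sec V"
      then show "(\<lambda>p\<in>?U. K.field_loc (rc V s)) \<in> carrier (rs_sections S ?U)"
        using ring_hom_closed[OF rh] yV by (auto simp: K.spec_field_carrier[OF U])
    next
      fix s t assume st: "s \<in> Y.sec V" "t \<in> Y.sec V"
      show "(\<lambda>p\<in>?U. K.field_loc (rc V (s \<otimes>\<^bsub>rs_sections Y V\<^esub> t))) =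
          (\<lambda>p\<in>?U. K.field_loc (rc V s)) \<otimes>\<^bsub>rs_sections S ?U\<^esub> (\<lambda>p\<in>?U. K.field_loc (rc V t))"
        using st ring_hom_mult[OF rh] yV
        by (subst K.spec_pointwise) (auto intro!: restrict_ext)
      show "(\<lambda>p\<in>?U. K.field_loc (rc V (s \<oplus>\<^bsub>rs_sections Y V\<^esub> t))) =
          (\<lambda>p\<in>?U. K.field_loc (rc V s)) \<oplus>\<^bsub>rs_sections S ?U\<^esub> (\<lambda>p\<in>?U. K.field_loc (rc V t))"
        using st ring_hom_add[OF rh] yV
        by (subst K.spec_pointwise) (auto intro!: restrict_ext)
    next
      show "(\<lambda>p\<in>?U. K.field_loc (rc V \<one>\<^bsub>rs_sections Y V\<^esub>)) = \<one>\<^bsub>rs_sections S ?U\<^esub>"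
        using ring_hom_one[OF rh] yV
        by (subst K.spec_pointwise) (auto intro!: restrict_ext)
    qed
  qed
next
  fix U V s assume UV: "openin (rs_top Y) U \<and> openin (rs_top Y) V \<and> V \<subseteq> U" and s: "s \<in> Y.sec U"
  have "rc V (res (rs_sheaf Y) U V s) = rc U s" if "y \<in> V"
    using Y.germ_res[of "{y}" U s V] UV s that by (auto simp: residue_class_def)
  then show "rs_comap \<iota> V (res (rs_sheaf Y) U V s) =
      res (rs_sheaf S) (rs_preimage S \<iota> U) (rs_preimage S \<iota> V) (rs_comap \<iota> U s)"
    using UV s Y.res_closed[of U V s] by (auto simp: comap K.spec_simps preimage fun_eq_iff)
qed

abbreviation "p0 \<equiv> {\<zero>\<^bsub>K\<^esub>}"

lemma point_map: "rs_map \<iota> p0 = y"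
  using spec_topspace by (simp add: point_inclusion_def)

sublocale S: sheaf_on "rs_top S" "rs_sheaf S" by (rule rs_sheaf_on[OF K.spec_field_ringed])

lemma p0_point: "p0 \<in> rs_points S" by (simp add: spec_topspace)

lemma p0_open: "openin (rs_top S) {p0}" by (simp add: spec_open)

lemma stalk_germ:
  assumes "openin (rs_top Y) V" "y \<in> V" "s \<in> Y.sec V"
  shows "stalk_map S \<iota> p0 (Y.germ {y} V s) = S.germ {p0} {p0} (\<lambda>p\<in>{p0}. K.field_loc (rc V s))"
  using stalk_map_germ[OF S.presheaf Y.presheaf point_hom p0_point assms(1) _ assms(3)] assms
  by (simp add: point_map preimage comap)

lemma point_stalk_hom: "stalk_map S \<iota> p0 \<in> ring_hom (stalk Y y) (stalk S p0)"
  using stalk_map_hom[OF S.presheaf Y.presheaf point_hom p0_point] by (simp add: point_map)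

text \<open>The map is the residue map, followed by the identification of \<open>K\<close> with its
  localization and by the passage to germs at \<open>p0\<close>. Since \<open>p0\<close> has only
  itself as a neighbourhood, a germ there is a value, which is the residue class of a germ of
  \<open>Y\<close>.\<close>

lemma point_stalk_surj: "stalk_map S \<iota> p0 ` carrier (stalk Y y) = carrier (stalk S p0)"
proof
  show "stalk_map S \<iota> p0 ` carrier (stalk Y y) \<subseteq> carrier (stalk S p0)"
    using ring_hom_closed[OF point_stalk_hom] by auto
  show "carrier (stalk S p0) \<subseteq> stalk_map S \<iota> p0 ` carrier (stalk Y y)"
  proof
    fix d assume "d \<in> carrier (stalk S p0)"
    then obtain U s where U: "openin (rs_top S) U" "p0 \<in> U" "s \<in> S.sec U" "d = S.germ {p0} U s"
      unfolding stalk_def by (rule S.germ_cases_point)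
    have U': "U = {p0}" using U(1,2) by (auto simp: spec_open)
    have s: "s \<in> (\<Pi>\<^sub>E p\<in>{p0}. carrier (localization K (carrier K - p)))"
      using U(1,3) K.spec_field_carrier by (simp add: U' K.spec_simps)
    then have "s p0 \<in> K.field_loc ` carrier K" by (auto simp: K.loc_simps(1)[symmetric])
    then obtain a where a: "a \<in> carrier K" "s p0 = K.field_loc a" by blast
    obtain c where c: "c \<in> carrier (stalk Y y)" "a = m +>\<^bsub>stalk Y y\<^esub> c"
      using a(1) by (auto simp: residue_field_def FactRing_def A_RCOSETS_def')
    obtain V t where V: "openin (rs_top Y) V" "y \<in> V" "t \<in> Y.sec V" "c = Y.germ {y} V t"
      by (rule Y.germ_cases_point[OF c(1)[unfolded stalk_def]])
    have "s = (\<lambda>p\<in>{p0}. K.field_loc (rc V t))"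
      by (rule extensionalityI[of _ "{p0}"])
        (use s a(2) c(2) V(4) in \<open>auto simp: residue_class_def PiE_def\<close>)
    then have "d = stalk_map S \<iota> p0 c"
      using stalk_germ[OF V(1-3)] U(4) V(4) U' by simp
    then show "d \<in> stalk_map S \<iota> p0 ` carrier (stalk Y y)" using c(1) by blast
  qed
qed

text \<open>Equal germs at \<open>p0\<close> have equal values there, and \<open>field_loc\<close>
  is injective; so the residue class of \<open>c\<close> is zero.\<close>

lemma point_stalk_kernel:
  assumes c: "c \<in> carrier (stalk Y y)" and 0: "stalk_map S \<iota> p0 c = \<zero>\<^bsub>stalk S p0\<^esub>"
  shows "c \<in> m"
proof -
  obtain V t where V: "openin (rs_top Y) V" "y \<in> V" "t \<in> Y.sec V" "c = Y.germ {y} V t"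
    by (rule Y.germ_cases_point[OF c[unfolded stalk_def]])
  have rct: "rc V t = m +>\<^bsub>stalk Y y\<^esub> c" by (simp add: residue_class_def V(4))
  have rcK: "rc V t \<in> carrier K" using ring_hom_closed[OF rc_hom[OF V(1,2)] V(3)] .
  have "S.germ {p0} {p0} (\<lambda>p\<in>{p0}. K.field_loc (rc V t)) = S.germ {p0} {p0} \<zero>\<^bsub>rs_sections S {p0}\<^esub>"
    using 0 stalk_germ[OF V(1-3)] V(4) S.germ_zero[of "{p0}" "{p0}"] p0_open by (simp add: stalk_def)
  moreover have "\<zero>\<^bsub>rs_sections S {p0}\<^esub> \<in> S.sec {p0}"
    using ring.ring_simprules(2)[OF S.sections_ring[OF p0_open]] .
  moreover have "(\<lambda>p\<in>{p0}. K.field_loc (rc V t)) \<in> S.sec {p0}"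
    using rs_comap_closed[OF point_hom V(1,3)] comap[OF V(1,3)] V(2) by (simp add: preimage)
  ultimately obtain W where W: "S.nbhd {p0} W" "W \<subseteq> {p0} \<inter> {p0}"
    "res (rs_sheaf S) {p0} W (\<lambda>p\<in>{p0}. K.field_loc (rc V t)) = res (rs_sheaf S) {p0} W \<zero>\<^bsub>rs_sections S {p0}\<^esub>"
    using S.germ_eq_iff[of "{p0}" "{p0}" _ "{p0}" "\<zero>\<^bsub>rs_sections S {p0}\<^esub>"] p0_open by auto
  have oW: "p0 \<in> W" using W(1) by simp
  have "\<zero>\<^bsub>rs_sections S {p0}\<^esub> p0 = K.field_loc \<zero>\<^bsub>K\<^esub>"
    by (subst K.spec_pointwise) (simp add: K.loc_simps)
  then have "K.field_loc (rc V t) = K.field_loc \<zero>\<^bsub>K\<^esub>"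
    using fun_cong[OF W(3), of p0] oW by (simp add: K.spec_simps)
  then have "m +>\<^bsub>stalk Y y\<^esub> c = \<zero>\<^bsub>K\<^esub>"
    using K.field_loc_inj[OF rcK] rct by simp
  then show "c \<in> m"
    using m.a_rcos_self[OF c] by (simp add: residue_field_def FactRing_def)
qed

text \<open>The stalk of the spectrum is the image of the local ring at \<open>y\<close> under a
  surjection whose kernel lies in the maximal ideal, as with the stalks of the fibered product and
  those of \<open>X2\<close>.\<close>

lemma spec_stalk_local: "is_local_ring (stalk S p0)"
  and spec_max_ideal: "max_ideal (stalk S p0) = stalk_map S \<iota> p0 ` m"
  using local_ring_surj[OF stalk_local_y stalk_cring[OF K.spec_field_ringed p0_point] point_stalk_hom
      point_stalk_surj point_stalk_kernel] by blast+

lemma spec_local: "is_locally_ringed_space S"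
  unfolding is_locally_ringed_space_def using K.spec_field_ringed spec_stalk_local by (simp add: spec_topspace)

lemma point_local: "\<iota> \<in> lrs_hom S Y"
  unfolding lrs_hom_def using point_hom spec_max_ideal by (simp add: spec_topspace point_map)

lemma point_stalks_surjective: "stalks_surjective S Y \<iota>"
  unfolding stalks_surjective_def using point_stalk_surj by (simp add: spec_topspace point_map)

end

theorem corollary11:
  fixes X2 :: "('b, 's) ringed_space" and Y :: "('c, 't) ringed_space"
    and f2 :: "('b, 's, 'c, 't) rs_morphism"
  assumes "is_locally_ringed_space X2" and "is_locally_ringed_space Y"
    and "f2 \<in> lrs_hom X2 Y"
  shows "(\<forall>(X1 :: ('a, 'r) ringed_space) f1 (P :: ('p, 'u) ringed_space) p1 p2.
            is_locally_ringed_space X1 \<and> f1 \<in> lrs_hom X1 Y \<and>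
            is_lrs_fibered_product X1 X2 Y f1 f2 P p1 p2 \<longrightarrow>
              (stalks_surjective X1 Y f1 \<longrightarrow>
                 rs_iso P (rs_fibered_product X1 X2 Y f1 f2)
                   (comparison X1 X2 Y f1 f2 P p1 p2)) \<and>
              (is_immersion X1 Y f1 \<longrightarrow>
                 rs_iso P (rs_fibered_product X1 X2 Y f1 f2)
                   (comparison X1 X2 Y f1 f2 P p1 p2))) \<and>
         (\<forall>y \<in> rs_points Y. \<forall>(P :: ('q, 'v) ringed_space) p1 p2.
            is_lrs_fibered_product (Spec (residue_field Y y)) X2 Y (point_inclusion Y y) f2 P p1 p2
            \<longrightarrow> rs_iso P (rs_fibered_product (Spec (residue_field Y y)) X2 Y (point_inclusion Y y) f2)
                  (comparison (Spec (residue_field Y y)) X2 Y (point_inclusion Y y) f2 P p1 p2))"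
proof (intro conjI allI impI ballI)
  fix X1 :: "('a, 'r) ringed_space" and f1 and P :: "('p, 'u) ringed_space" and p1 p2
  assume *: "is_locally_ringed_space X1 \<and> f1 \<in> lrs_hom X1 Y \<and> is_lrs_fibered_product X1 X2 Y f1 f2 P p1 p2"
  show iso: "rs_iso P (rs_fibered_product X1 X2 Y f1 f2) (comparison X1 X2 Y f1 f2 P p1 p2)"
    if "stalks_surjective X1 Y f1"
  proof -
    interpret lrs_cospan_surj X1 X2 Y f1 f2 by unfold_locales (use * assms that in auto)
    show ?thesis by (rule comparison_iso) (use * in blast)
  qed
  \<comment> \<open>Surjectivity of the stalk maps is part of the notion of an immersion.\<close>
  show "rs_iso P (rs_fibered_product X1 X2 Y f1 f2) (comparison X1 X2 Y f1 f2 P p1 p2)"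
    if "is_immersion X1 Y f1"
    using iso that by (simp add: is_immersion_def)
next
  fix y and P :: "('q, 'v) ringed_space" and p1 p2
  assume y: "y \<in> rs_points Y"
    and P: "is_lrs_fibered_product (Spec (residue_field Y y)) X2 Y (point_inclusion Y y) f2 P p1 p2"
  interpret pt: lrs_point Y y by unfold_locales (fact assms(2) y)+
  \<comment> \<open>The stalk of \<open>Y\<close> at \<open>y\<close> maps onto its residue field,
    which brings the natural map under the surjective case.\<close>
  interpret lrs_cospan_surj "Spec (residue_field Y y)" X2 Y "point_inclusion Y y" f2
    by unfold_locales (fact pt.spec_local assms pt.point_local pt.point_stalks_surjective)+
  show "rs_iso P (rs_fibered_product (Spec (residue_field Y y)) X2 Y (point_inclusion Y y) f2)
      (comparison (Spec (residue_field Y y)) X2 Y (point_inclusion Y y) f2 P p1 p2)"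
    by (rule comparison_iso[OF P])
qed

end
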